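(* Let $f$ be an admissible Gaussian random field on the compact set $T\subset\mathbb{R}^d$ (as defined in the context). Let $w(b)=P(M>b)$ and let $$Z_b = I(M>b)\,\frac{dP}{dQ_b}= I(M>b)\,\frac{\int_T P(f(t)>\gamma)\,dt}{\mathrm{mes}(A_\gamma)},\qquad \gamma=b-\frac1b,$$ where $f$ is generated under the measure $Q_b$. Then $Z_b$ is strongly efficient in estimating $w(b)$; that is, $E_b(Z_b)=w(b)$ and there exists a constant $\kappa_0\in(0,\infty)$ such that $$E_b(Z_b^2)\le \kappa_0\, w^2(b)\qquad\text{for all } b>0.$$
   Context: **Field and notation.** $f=\{f(t):t\in T\}$ is a Gaussian random field on a probability space $(\Omega,\mathcal F,P)$, indexed by a compact set $T\subset\mathbb{R}^d$. Write $\mu(t)=E f(t)$, $C(s,t)=\mathrm{Cov}(f(s),f(t))$, $\sigma^2(t)=C(t,t)$ with $\sigma(t)>0$, $r(s,t)=C(s,t)/(\sigma(s)\sigma(t))$, $M=\sup_{t\in T}f(t)$, and $A_x=\{t\in T: f(t)>x\}$. $\mathrm{mes}$ is Lebesgue measure on $\mathbb{R}^d$, $I(\cdot)$ is an indicator, $B(t,\epsilon)$ is the ball of radius $\epsilon$ centered at $t$, and $\omega_d$ is the volume of the $d$-dimensional unit ball. A positive continuous function $L$ on $(0,\infty)$ is slowly varying at zero if $\lim_{x\to0}L(tx)/L(x)=1$ for all $t\in(0,1)$. **Admissible field.** $f$ is called admissible if all of the following hold. 1. $f$ is almost surely continuous in $t$. 2. For some $\alpha_1\in(0,2]$, $1-r(s,t)\sim\Delta_s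 L_1(|t-s|)|t-s|^{\alpha_1}$ as $t\to s$, where $\Delta_s\in(0,\infty)$ is continuous in $s$ and $L_1$ is slowly varying at zero. Furthermore, there exist constants $\kappa_r,\beta_0\ge0$ and $\beta_1>0$ with $\beta_0+\beta_1\ge\alpha_1$ such that $|r(t,t+s_1)-r(t,t+s_2)|\le\kappa_r L_1(|s_1|)|s_1|^{\beta_0}|s_1-s_2|^{\beta_1}$ whenever $|s_1|\ge|s_2|$ (and $t,t+s_1,t+s_2\in T$). 3. $r(s,t)<1$ for all $s\ne t$. 4. The standard deviation $\sigma$ is of one of two types. Type 1: $\sigma(t)=1$ for all $t\in T$. Type 2: $\sigma$ has a unique maximum attained at $t^*\in T$, and for some $\alpha_2\in(0,1]$, $\Lambda>0$, $\kappa_\sigma>0$ and $L_2$ slowly varying at zero such that $\lim_{x\to0+}L_1(x)/L_2(x)$ exists (in $[0,\infty]$), one has $|\sigma(t)-\sigma(s)|\le\kappa_\sigma L_2(|t-s|)|t-s|^{\alpha_2}$ for all $s,t\in T$, and $\sigma(t^* )-\sigma(t)\sim\Lambda L_2(|t-t^*|)|t-t^*|^{\alpha_2}$ as $t\to t^*$. 5. There is $\kappa_\mu>0$ such that, for $s,s+t\in T$: if $\sigma$ is of Type 1 then $|\mu(s)-\mu(s+t)|\le\kappa_\mu\sqrt{L_1(|t|)}\,|t|^{\alpha_1/2}$; if $\sigma$ is of Type 2 then $|\mu(s)-\mu(s+t)|\le\kappa_\mu\sqrt{L_2(|t|)}\,|t|^{\alpha_2/2}$. 6. There is $\kappa_m>0$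 such that for all sufficiently small $\epsilon>0$ and all $t\in T$, $\mathrm{mes}(B(t,\epsilon)\cap T)\ge\kappa_m\epsilon^d\omega_d$. **Change of measure.** For $b>0$ put $\gamma=b-1/b$. The measure $Q_b$ on sample paths is defined by $$\frac{dQ_b}{dP}=\frac{\mathrm{mes}(A_\gamma)}{\int_T P(f(t)>\gamma)\,dt},$$ and $E_b$ denotes expectation under $Q_b$. Equivalently, a path under $Q_b$ is generated as follows: draw $\tau\in T$ from the density $h_b(t)=P(f(t)>\gamma)/\int_T P(f(s)>\gamma)\,ds$; given $\tau$, draw $f(\tau)$ from its $P$-conditional law given $f(\tau)>\gamma$; given $(\tau,f(\tau))$, draw $\{f(t):t\ne\tau\}$ from the conditional law under $P$ given $f(\tau)$.
   Formalization: The local expansion 1−r(s,t) ~ Δ_s L_1(|t−s|)|t−s|^{α_1} as t→s is required to hold uniformly in s∈T; with the limit taken only for each fixed s, the claim fails for some fields. *)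

theory Defs
  imports "HOL-Probability.Probability" "HOL-Library.Landau_Symbols"
begin

definition slowly_varying_at_zero :: "(real \<Rightarrow> real) \<Rightarrow> bool" where
  "slowly_varying_at_zero L \<longleftrightarrow>
     continuous_on {0<..} L \<and> (\<forall>x>0. 0 < L x) \<and>
     (\<forall>t\<in>{0<..<1}. ((\<lambda>x. L (t * x) / L x) \<longlongrightarrow> 1) (at_right 0))"


text \<open>A random field on \<open>T\<close> is a function \<open>f\<close> with \<open>f t \<omega>\<close> the value at the point \<open>t\<close> of the
  path \<open>\<omega>\<close>; the values for \<open>t \<notin> T\<close> are never used. It is Gaussian if every finite linear
  combination of its values is Gaussian, where constants count as (degenerate) Gaussian variables.\<close>

definition gaussian_variable :: "'w measure \<Rightarrow> ('w \<Rightarrow> real) \<Rightarrow> bool" where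
  "gaussian_variable P X \<longleftrightarrow>
     X \<in> borel_measurable P \<and>
     ((\<exists>c. AE \<omega> in P. X \<omega> = c) \<or>
      (\<exists>m s. 0 < s \<and> distributed P lborel X (\<lambda>x. ennreal (normal_density m s x))))"

definition gaussian_field :: "'w measure \<Rightarrow> 'a set \<Rightarrow> ('a \<Rightarrow> 'w \<Rightarrow> real) \<Rightarrow> bool" where
  "gaussian_field P T f \<longleftrightarrow>
     (\<forall>F c. finite F \<longrightarrow> F \<subseteq> T \<longrightarrow> gaussian_variable P (\<lambda>\<omega>. \<Sum>t\<in>F. c t * f t \<omega>))"

definition mean_fun :: "'w measure \<Rightarrow> ('a \<Rightarrow> 'w \<Rightarrow> real) \<Rightarrow> 'a \<Rightarrow> real" where
  "mean_fun P f t = prob_space.expectation P (f t)"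

definition cov_fun :: "'w measure \<Rightarrow> ('a \<Rightarrow> 'w \<Rightarrow> real) \<Rightarrow> 'a \<Rightarrow> 'a \<Rightarrow> real" where
  "cov_fun P f s t =
     prob_space.expectation P (\<lambda>\<omega>. (f s \<omega> - mean_fun P f s) * (f t \<omega> - mean_fun P f t))"

definition sd_fun :: "'w measure \<Rightarrow> ('a \<Rightarrow> 'w \<Rightarrow> real) \<Rightarrow> 'a \<Rightarrow> real" where
  "sd_fun P f t = sqrt (cov_fun P f t t)"

definition corr_fun :: "'w measure \<Rightarrow> ('a \<Rightarrow> 'w \<Rightarrow> real) \<Rightarrow> 'a \<Rightarrow> 'a \<Rightarrow> real" where
  "corr_fun P f s t = cov_fun P f s t / (sd_fun P f s * sd_fun P f t)"


text \<open>The limit \<open>\<bar>t - s\<bar> \<rightarrow> 0\<close>, \<open>t \<noteq> s\<close>, for pairs \<open>(s, t)\<close> in \<open>T \<times> T\<close>. An asymptotic equivalence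
  along this filter is the one for \<open>t \<rightarrow> s\<close>, uniformly in \<open>s \<in> T\<close>.\<close>

definition near_diagonal :: "'a::metric_space set \<Rightarrow> ('a \<times> 'a) filter" where
  "near_diagonal T =
     inf (filtercomap (\<lambda>(s, t). dist s t) (at_right 0)) (principal (T \<times> T))"

definition corr_expansion ::
  "(('a::real_normed_vector) \<Rightarrow> 'a \<Rightarrow> real) \<Rightarrow> 'a set \<Rightarrow> real \<Rightarrow> (real \<Rightarrow> real) \<Rightarrow> bool" where
  "corr_expansion r T \<alpha> L \<longleftrightarrow>
     (\<exists>\<Delta>. continuous_on T \<Delta> \<and> (\<forall>s\<in>T. 0 < \<Delta> s) \<and>
        (\<lambda>(s, t). 1 - r s t)
          \<sim>[near_diagonal T] (\<lambda>(s, t). \<Delta> s * L (norm (t - s)) * norm (t - s) powr \<alpha>))"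

text \<open>In the bounds below the arguments of \<open>L\<close> may vanish, where \<open>L\<close> is unconstrained. This is
  harmless: the other factor on the right is then \<open>0 powr e = 0\<close>, and so is the left-hand side.\<close>

definition corr_regularity ::
  "(('a::real_normed_vector) \<Rightarrow> 'a \<Rightarrow> real) \<Rightarrow> 'a set \<Rightarrow> real \<Rightarrow> (real \<Rightarrow> real) \<Rightarrow> bool" where
  "corr_regularity r T \<alpha> L \<longleftrightarrow>
     (\<exists>\<kappa> \<beta>\<^sub>0 \<beta>\<^sub>1. 0 \<le> \<kappa> \<and> 0 \<le> \<beta>\<^sub>0 \<and> 0 < \<beta>\<^sub>1 \<and> \<alpha> \<le> \<beta>\<^sub>0 + \<beta>\<^sub>1 \<and>
        (\<forall>t s\<^sub>1 s\<^sub>2. t \<in> T \<longrightarrow> t + s\<^sub>1 \<in> T \<longrightarrow> t + s\<^sub>2 \<in> T \<longrightarrow> norm s\<^sub>2 \<le> norm s\<^sub>1 \<longrightarrow>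
           \<bar>r t (t + s\<^sub>1) - r t (t + s\<^sub>2)\<bar>
             \<le> \<kappa> * L (norm s\<^sub>1) * norm s\<^sub>1 powr \<beta>\<^sub>0 * norm (s\<^sub>1 - s\<^sub>2) powr \<beta>\<^sub>1))"

definition sd_type1 :: "('a \<Rightarrow> real) \<Rightarrow> 'a set \<Rightarrow> bool" where
  "sd_type1 \<sigma> T \<longleftrightarrow> (\<forall>t\<in>T. \<sigma> t = 1)"

definition sd_type2 ::
  "(('a::real_normed_vector) \<Rightarrow> real) \<Rightarrow> 'a set \<Rightarrow> (real \<Rightarrow> real) \<Rightarrow> real \<Rightarrow> (real \<Rightarrow> real) \<Rightarrow> bool" where
  "sd_type2 \<sigma> T L\<^sub>1 \<alpha>\<^sub>2 L\<^sub>2 \<longleftrightarrow>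
     0 < \<alpha>\<^sub>2 \<and> \<alpha>\<^sub>2 \<le> 1 \<and> slowly_varying_at_zero L\<^sub>2 \<and>
     (\<exists>l::ereal. ((\<lambda>x. ereal (L\<^sub>1 x / L\<^sub>2 x)) \<longlongrightarrow> l) (at_right 0)) \<and>
     (\<exists>\<kappa>>0. \<forall>s\<in>T. \<forall>t\<in>T. \<bar>\<sigma> t - \<sigma> s\<bar> \<le> \<kappa> * L\<^sub>2 (norm (t - s)) * norm (t - s) powr \<alpha>\<^sub>2) \<and>
     (\<exists>t\<^sub>0\<in>T. (\<forall>t\<in>T. t \<noteq> t\<^sub>0 \<longrightarrow> \<sigma> t < \<sigma> t\<^sub>0) \<and>
        (\<exists>\<Lambda>>0. (\<lambda>t. \<sigma> t\<^sub>0 - \<sigma> t)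
                  \<sim>[at t\<^sub>0 within T] (\<lambda>t. \<Lambda> * L\<^sub>2 (norm (t - t\<^sub>0)) * norm (t - t\<^sub>0) powr \<alpha>\<^sub>2)))"

definition mean_regularity ::
  "(('a::real_normed_vector) \<Rightarrow> real) \<Rightarrow> 'a set \<Rightarrow> real \<Rightarrow> (real \<Rightarrow> real) \<Rightarrow> bool" where
  "mean_regularity \<mu> T \<alpha> L \<longleftrightarrow>
     (\<exists>\<kappa>>0. \<forall>s t. s \<in> T \<longrightarrow> s + t \<in> T \<longrightarrow>
        \<bar>\<mu> s - \<mu> (s + t)\<bar> \<le> \<kappa> * sqrt (L (norm t)) * norm t powr (\<alpha> / 2))"

definition ball_density :: "'a::euclidean_space set \<Rightarrow> bool" where
  "ball_density T \<longleftrightarrow>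
     (\<exists>\<kappa>>0. \<forall>\<^sub>F \<epsilon> in at_right 0. \<forall>t\<in>T.
        \<kappa> * \<epsilon> ^ DIM('a) * measure lebesgue (ball (0::'a) 1) \<le> measure lebesgue (ball t \<epsilon> \<inter> T))"

definition admissible_field ::
  "'w measure \<Rightarrow> 'a::euclidean_space set \<Rightarrow> ('a \<Rightarrow> 'w \<Rightarrow> real) \<Rightarrow> bool" where
  "admissible_field P T f \<longleftrightarrow>
     gaussian_field P T f \<and>
     (\<forall>t\<in>T. 0 < sd_fun P f t) \<and>
     (AE \<omega> in P. continuous_on T (\<lambda>t. f t \<omega>)) \<and>
     (\<forall>s\<in>T. \<forall>t\<in>T. s \<noteq> t \<longrightarrow> corr_fun P f s t < 1) \<and>
     ball_density T \<and>
     (\<exists>\<alpha>\<^sub>1 L\<^sub>1. 0 < \<alpha>\<^sub>1 \<and> \<alpha>\<^sub>1 \<le> 2 \<and> slowly_varying_at_zero L\<^sub>1 \<and>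
        corr_expansion (corr_fun P f) T \<alpha>\<^sub>1 L\<^sub>1 \<and>
        corr_regularity (corr_fun P f) T \<alpha>\<^sub>1 L\<^sub>1 \<and>
        ((sd_type1 (sd_fun P f) T \<and> mean_regularity (mean_fun P f) T \<alpha>\<^sub>1 L\<^sub>1) \<or>
         (\<exists>\<alpha>\<^sub>2 L\<^sub>2. sd_type2 (sd_fun P f) T L\<^sub>1 \<alpha>\<^sub>2 L\<^sub>2 \<and> mean_regularity (mean_fun P f) T \<alpha>\<^sub>2 L\<^sub>2)))"


definition field_sup :: "'a set \<Rightarrow> ('a \<Rightarrow> 'w \<Rightarrow> real) \<Rightarrow> 'w \<Rightarrow> ereal" where
  "field_sup T f \<omega> = (SUP t\<in>T. ereal (f t \<omega>))"

definition excursion_set :: "'a set \<Rightarrow> ('a \<Rightarrow> 'w \<Rightarrow> real) \<Rightarrow> real \<Rightarrow> 'w \<Rightarrow> 'a set" where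
  "excursion_set T f x \<omega> = {t \<in> T. x < f t \<omega>}"

definition gamma_level :: "real \<Rightarrow> real" where
  "gamma_level b = b - 1 / b"

definition mean_excursion_volume ::
  "'w measure \<Rightarrow> 'a::euclidean_space set \<Rightarrow> ('a \<Rightarrow> 'w \<Rightarrow> real) \<Rightarrow> real \<Rightarrow> real" where
  "mean_excursion_volume P T f x = (LINT t:T|lebesgue. measure P {\<omega> \<in> space P. x < f t \<omega>})"

text \<open>Paths are continuous only almost surely, and nothing is assumed about the exceptional paths.
  So the supremum and the volume of the excursion set are measurable with respect to the completion
  of \<open>P\<close>, but possibly not with respect to \<open>P\<close> itself. If \<open>P\<close> is complete, the completion is \<open>P\<close>.\<close>

definition tail_prob :: "'w measure \<Rightarrow> 'a set \<Rightarrow> ('a \<Rightarrow> 'w \<Rightarrow> real) \<Rightarrow> real \<Rightarrow> real" where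
  "tail_prob P T f b = measure (completion P) {\<omega> \<in> space P. ereal b < field_sup T f \<omega>}"

definition Q_measure ::
  "'w measure \<Rightarrow> 'a::euclidean_space set \<Rightarrow> ('a \<Rightarrow> 'w \<Rightarrow> real) \<Rightarrow> real \<Rightarrow> 'w measure" where
  "Q_measure P T f b =
     density (completion P)
       (\<lambda>\<omega>. ennreal (measure lebesgue (excursion_set T f (gamma_level b) \<omega>) /
                     mean_excursion_volume P T f (gamma_level b)))"

definition Z_estimator ::
  "'w measure \<Rightarrow> 'a::euclidean_space set \<Rightarrow> ('a \<Rightarrow> 'w \<Rightarrow> real) \<Rightarrow> real \<Rightarrow> 'w \<Rightarrow> real" where
  "Z_estimator P T f b \<omega> =
     indicator {\<omega>. ereal b < field_sup T f \<omega>} \<omega> *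
     (mean_excursion_volume P T f (gamma_level b) /
      measure lebesgue (excursion_set T f (gamma_level b) \<omega>))"

end

theory Submission
  imports Defs
begin

text \<open>The density of \<open>Q\<^sub>b\<close> cancels the denominator of the estimator, so that
\<open>E\<^sub>b Z\<^sub>b = P(M > b) = w\<close> and \<open>E\<^sub>b Z\<^sub>b\<^sup>2 = m E\<^sub>P[I(M > b) / mes(A\<^sub>\<gamma>)]\<close> with
\<open>m = \<integral>\<^sub>T P(f(t) > \<gamma>) dt\<close> (lemma \<open>estimator_moments\<close>). It remains to bound this product by a
multiple of \<open>w\<^sup>2\<close>, a statement about \<open>P\<close> alone.

For each large \<open>b\<close> there is a length \<open>\<rho>\<close> over which the field moves by the order of \<open>1/b\<close>, the
distance between \<open>\<gamma>\<close> and \<open>b\<close>. Let \<open>N\<close> be a \<open>\<rho>\<close>-separated \<open>\<rho>\<close>-net of \<open>T\<close> and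
\<open>S = \<Sum>\<^sub>c P(f(c) > b)\<close>, summed over \<open>c \<in> N\<close>. With constants that do not depend on \<open>b\<close>:

\<^item> \<open>m \<le> C \<rho>\<^sup>d S\<close>, because neither the step from \<open>b\<close> down to \<open>\<gamma>\<close> nor a shift of the point by
  \<open>\<rho>\<close> changes the exceedance probability by more than a constant factor (\<open>exceed_prob_cell\<close>).

\<^item> \<open>E\<^sub>P[I(M > b) / mes(A\<^sub>\<gamma>)] \<le> C \<rho>\<^sup>-\<^sup>d S\<close>, by a union bound over the cells of the net. In the cell
  around \<open>c\<close>, chaining over dyadic nets shows that a path that exceeds \<open>b\<close> stays above \<open>\<gamma>\<close> on a
  ball of radius of the order \<open>\<rho> (j + 1) powr (- 2 / \<theta>)\<close>, and has \<open>f(c) > b - (j + 1)/b\<close>, as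
  long as its chaining increments are at most \<open>j + 1\<close> times a tolerance of order \<open>1/b\<close>
  (\<open>excursion_volume_ge\<close>, \<open>local_excursion_bound\<close>). The probability that \<open>f(c) > b - (j + 1)/b\<close>
  while an increment exceeds \<open>j\<close> times its tolerance is at most \<open>P(f(c) > b)\<close> times a factor that
  decays exponentially in \<open>j\<close> (\<open>increment_tail_at_level\<close>).

\<^item> \<open>S \<le> C w\<close>, by one of two mechanisms (\<open>net_sum_le_tail_prob_corr\<close>, \<open>net_sum_le_tail_prob_sd\<close>).
  If \<open>\<rho>\<close> is the scale \<open>u\<close> of the correlation, \<open>b\<^sup>2 L\<^sub>1(u) u\<^sup>\<alpha> = 1\<close> with \<open>\<alpha> = \<alpha>\<^sub>1\<close>, exceedances at
  different points of the net are so weakly dependent that the second moment of their number is at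
  most a multiple of its mean. If \<open>\<rho>\<close> is the scale \<open>v\<close> of the standard deviation,
  \<open>b\<^sup>2 L\<^sub>2(v) v\<^sup>\<alpha> = 1\<close> with \<open>\<alpha> = \<alpha>\<^sub>2\<close>, the sum is dominated by its term at the maximum of \<open>\<sigma>\<close>.

A field of Type 1 is regular at the scale \<open>u\<close>, one of Type 2 at the smaller of \<open>u\<close> and \<open>v\<close>, and the
three bounds give \<open>E\<^sub>b Z\<^sub>b\<^sup>2 \<le> C\<^sup>2 S\<^sup>2 \<le> \<kappa> w\<^sup>2\<close>. For \<open>b\<close> in a bounded interval \<open>(0, b\<^sub>1]\<close>, \<open>w\<close> is bounded
away from zero and the chaining argument at the fixed level \<open>b\<^sub>1\<close> bounds the second moment
(\<open>inverse_volume_moment_bounded\<close>).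

Two devices keep the argument elementary. Joint Gaussian events are always included in an event
about one linear combination of the field, so that only tails of single normal variables occur and
no conditioning is needed. And all estimates are ratios to \<open>P(f(c) > b)\<close> itself: the Gaussian tail is
compared at two levels without passing through its asymptotics (\<open>gauss_tail_compare\<close>), since the
factor of the order \<open>b\<close> by which a Chernoff bound exceeds the tail would not be affordable.\<close>

section \<open>Gaussian tails\<close>

definition gauss_tail :: "real \<Rightarrow> real" where
  "gauss_tail x = measure (density lborel std_normal_density) {x<..}"

lemma gauss_tail_emeasure:
  "ennreal (gauss_tail x) = emeasure (density lborel std_normal_density) {x<..}"
proof -
  interpret prob_space "density lborel std_normal_density"
    by (rule prob_space_normal_density) simp
  show ?thesis by (simp add: gauss_tail_def emeasure_eq_measure)
qed

text \<open>The substitution \<open>s \<mapsto> x + s\<close> writes the tail, multiplied by \<open>exp (x\<^sup>2 / 2)\<close>, as a Laplace transform,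
which visibly decreases in \<open>x\<close>. Rescaling by \<open>x\<close>, as in \<open>gauss_tail_laplace_scaled\<close> below, makes
the product with one more factor \<open>x\<close> visibly increase. These two monotonicities replace the
usual bounds on the Mills ratio.\<close>

lemma gauss_tail_laplace:
  "ennreal (gauss_tail x * exp (x\<^sup>2 / 2)) =
     (\<integral>\<^sup>+s. ennreal (1 / sqrt (2 * pi) * exp (- x * s - s\<^sup>2 / 2) * indicator {0<..} s) \<partial>lborel)"
proof -
  have "ennreal (gauss_tail x) =
     (\<integral>\<^sup>+s. ennreal (std_normal_density s) * indicator {x<..} s \<partial>lborel)"
    by (simp add: gauss_tail_emeasure emeasure_density)
  also have "\<dots> = (\<integral>\<^sup>+s. ennreal (std_normal_density (x + s)) * indicator {x<..} (x + s) \<partial>lborel)"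
    by (subst nn_integral_real_affine[where c=1 and t=x]) (auto simp del: ennreal_indicator)
  also have "\<dots> = (\<integral>\<^sup>+s. ennreal (exp (- (x\<^sup>2 / 2))) * ennreal (1 / sqrt (2 * pi) * exp (- x * s - s\<^sup>2 / 2) * indicator {0<..} s) \<partial>lborel)"
    by (intro nn_integral_cong)
      (auto simp: indicator_def std_normal_density_def ennreal_mult[symmetric]
         exp_add[symmetric] exp_minus[symmetric] mult_exp_exp power2_eq_square field_simps split: if_splits)
  also have "\<dots> = ennreal (exp (- (x\<^sup>2 / 2))) * (\<integral>\<^sup>+s. ennreal (1 / sqrt (2 * pi) * exp (- x * s - s\<^sup>2 / 2) * indicator {0<..} s) \<partial>lborel)"
    by (rule nn_integral_cmult) measurable
  finally have eq: "ennreal (gauss_tail x) = ennreal (exp (- (x\<^sup>2 / 2))) * (\<integral>\<^sup>+s. ennreal (1 / sqrt (2 * pi) * exp (- x * s - s\<^sup>2 / 2) * indicator {0<..} s) \<partial>lborel)" .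
  have "ennreal (gauss_tail x * exp (x\<^sup>2 / 2)) = ennreal (exp (x\<^sup>2 / 2)) * ennreal (gauss_tail x)"
    by (simp add: ennreal_mult gauss_tail_def mult.commute)
  also have "\<dots> = ennreal (exp (x\<^sup>2 / 2) * exp (- (x\<^sup>2 / 2))) * (\<integral>\<^sup>+s. ennreal (1 / sqrt (2 * pi) * exp (- x * s - s\<^sup>2 / 2) * indicator {0<..} s) \<partial>lborel)"
    unfolding eq by (simp add: ennreal_mult mult.assoc)
  also have "exp (x\<^sup>2 / 2) * exp (- (x\<^sup>2 / 2)) = 1" by (simp add: mult_exp_exp)
  finally show ?thesis by simp
qed

lemma gauss_tail_nonneg: "0 \<le> gauss_tail x"
  by (simp add: gauss_tail_def)

lemma gauss_tail_le_1: "gauss_tail x \<le> 1"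
proof -
  interpret prob_space "density lborel std_normal_density"
    by (rule prob_space_normal_density) simp
  show ?thesis by (simp add: gauss_tail_def)
qed

lemma gauss_tail_antimono: "x \<le> y \<Longrightarrow> gauss_tail y \<le> gauss_tail x"
proof -
  interpret prob_space "density lborel std_normal_density"
    by (rule prob_space_normal_density) simp
  show "x \<le> y \<Longrightarrow> gauss_tail y \<le> gauss_tail x"
    unfolding gauss_tail_def by (intro finite_measure_mono) auto
qed

lemma gauss_tail_pos: "0 < gauss_tail x"
proof (rule ccontr)
  assume "\<not> 0 < gauss_tail x"
  then have "gauss_tail x = 0" using gauss_tail_nonneg[of x] by linarith
  then have "(\<integral>\<^sup>+s. ennreal (1 / sqrt (2 * pi) * exp (- x * s - s\<^sup>2 / 2) * indicator {0<..} s) \<partial>lborel) = 0"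
    using gauss_tail_laplace[of x] by simp
  then have "AE s in lborel. ennreal (1 / sqrt (2 * pi) * exp (- x * s - s\<^sup>2 / 2) * indicator {0<..} s) = 0"
    by (subst (asm) nn_integral_0_iff_AE) auto
  then have "AE s in lborel. s \<notin> {0<..1::real}"
  proof eventually_elim
    case (elim s)
    show ?case
    proof
      assume "s \<in> {0<..1}"
      then have "0 < 1 / sqrt (2 * pi) * exp (- x * s - s\<^sup>2 / 2) * indicator {0<..} s" by simp
      with elim show False by (simp add: ennreal_eq_0_iff)
    qed
  qed
  then have "emeasure lborel {0<..1::real} = 0"
    by (subst (asm) AE_iff_measurable[where N="{0<..1::real}"]) auto
  then show False by simp
qed

lemma gauss_tail_decay:
  assumes "x \<le> y" "0 \<le> x"
  shows "gauss_tail y \<le> exp ((x\<^sup>2 - y\<^sup>2) / 2) * gauss_tail x"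
proof -
  have "ennreal (gauss_tail y * exp (y\<^sup>2 / 2)) \<le> ennreal (gauss_tail x * exp (x\<^sup>2 / 2))"
    unfolding gauss_tail_laplace
  proof (intro nn_integral_mono ennreal_leI)
    fix s :: real
    have "x * s \<le> y * s" if "0 < s" using assms that by (intro mult_right_mono) auto
    then show "1 / sqrt (2 * pi) * exp (- y * s - s\<^sup>2 / 2) * indicator {0<..} s
      \<le> 1 / sqrt (2 * pi) * exp (- x * s - s\<^sup>2 / 2) * indicator {0<..} s"
      by (cases "0 < s") (auto intro!: divide_right_mono)
  qed
  then have *: "gauss_tail y * exp (y\<^sup>2 / 2) \<le> gauss_tail x * exp (x\<^sup>2 / 2)"
    by (simp add: gauss_tail_nonneg)
  have "gauss_tail y = (gauss_tail y * exp (y\<^sup>2 / 2)) * exp (- (y\<^sup>2 / 2))"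
    by (simp add: mult.assoc mult_exp_exp)
  also have "\<dots> \<le> (gauss_tail x * exp (x\<^sup>2 / 2)) * exp (- (y\<^sup>2 / 2))"
    using * by (intro mult_right_mono) auto
  also have "\<dots> = exp ((x\<^sup>2 - y\<^sup>2) / 2) * gauss_tail x"
    by (simp add: mult.assoc mult_exp_exp diff_divide_distrib)
  finally show ?thesis .
qed

lemma gauss_tail_laplace_scaled:
  assumes "0 < x"
  shows "ennreal (x * gauss_tail x * exp (x\<^sup>2 / 2)) =
     (\<integral>\<^sup>+s. ennreal (1 / sqrt (2 * pi) * exp (- s - s\<^sup>2 / (2 * x\<^sup>2)) * indicator {0<..} s) \<partial>lborel)"
proof -
  have "ennreal (gauss_tail x * exp (x\<^sup>2 / 2)) =
     ennreal (1 / x) * (\<integral>\<^sup>+s. ennreal (1 / sqrt (2 * pi) * exp (- x * (s / x) - (s / x)\<^sup>2 / 2) * indicator {0<..} (s / x)) \<partial>lborel)"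
    unfolding gauss_tail_laplace using assms
    by (subst nn_integral_real_affine[where c="1/x" and t=0]) (auto simp: ac_simps)
  also have "(\<integral>\<^sup>+s. ennreal (1 / sqrt (2 * pi) * exp (- x * (s / x) - (s / x)\<^sup>2 / 2) * indicator {0<..} (s / x)) \<partial>lborel)
    = (\<integral>\<^sup>+s. ennreal (1 / sqrt (2 * pi) * exp (- s - s\<^sup>2 / (2 * x\<^sup>2)) * indicator {0<..} s) \<partial>lborel)"
    using assms by (intro nn_integral_cong) (auto simp: indicator_def field_simps power2_eq_square zero_less_divide_iff)
  finally have eq: "ennreal (gauss_tail x * exp (x\<^sup>2 / 2)) = ennreal (1 / x) * (\<integral>\<^sup>+s. ennreal (1 / sqrt (2 * pi) * exp (- s - s\<^sup>2 / (2 * x\<^sup>2)) * indicator {0<..} s) \<partial>lborel)" .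
  have "ennreal (x * gauss_tail x * exp (x\<^sup>2 / 2)) = ennreal x * ennreal (gauss_tail x * exp (x\<^sup>2 / 2))"
    using assms by (simp add: ennreal_mult[symmetric] gauss_tail_nonneg mult.assoc)
  also have "ennreal x * ennreal (1 / x) = 1"
    using assms by (simp add: ennreal_mult[symmetric])
  then have "ennreal x * ennreal (gauss_tail x * exp (x\<^sup>2 / 2)) =
     (\<integral>\<^sup>+s. ennreal (1 / sqrt (2 * pi) * exp (- s - s\<^sup>2 / (2 * x\<^sup>2)) * indicator {0<..} s) \<partial>lborel)"
    unfolding eq by (simp only: mult.assoc[symmetric] mult_1_left)
  finally show ?thesis .
qed

lemma gauss_tail_growth:
  assumes "0 < y" "y \<le> x"
  shows "gauss_tail y \<le> x / y * exp ((x\<^sup>2 - y\<^sup>2) / 2) * gauss_tail x"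
proof -
  have x: "0 < x" using assms by simp
  have "ennreal (y * gauss_tail y * exp (y\<^sup>2 / 2)) \<le> ennreal (x * gauss_tail x * exp (x\<^sup>2 / 2))"
    unfolding gauss_tail_laplace_scaled[OF assms(1)] gauss_tail_laplace_scaled[OF x]
  proof (intro nn_integral_mono ennreal_leI mult_right_mono mult_left_mono)
    fix s :: real
    have "y\<^sup>2 \<le> x\<^sup>2" using assms by (simp add: power_mono)
    then have "s\<^sup>2 / (2 * x\<^sup>2) \<le> s\<^sup>2 / (2 * y\<^sup>2)"
      using assms by (intro divide_left_mono) auto
    then show "exp (- s - s\<^sup>2 / (2 * y\<^sup>2)) \<le> exp (- s - s\<^sup>2 / (2 * x\<^sup>2))" by simp
  qed auto
  then have *: "y * gauss_tail y * exp (y\<^sup>2 / 2) \<le> x * gauss_tail x * exp (x\<^sup>2 / 2)"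
    using x by (simp add: gauss_tail_nonneg)
  have "gauss_tail y = (y * gauss_tail y * exp (y\<^sup>2 / 2)) * (exp (- (y\<^sup>2 / 2)) / y)"
    using assms by (simp add: mult_exp_exp field_simps)
  also have "\<dots> \<le> (x * gauss_tail x * exp (x\<^sup>2 / 2)) * (exp (- (y\<^sup>2 / 2)) / y)"
    using * assms by (intro mult_right_mono) auto
  also have "\<dots> = x / y * (exp (x\<^sup>2 / 2) * exp (- (y\<^sup>2 / 2))) * gauss_tail x"
    by simp
  also have "exp (x\<^sup>2 / 2) * exp (- (y\<^sup>2 / 2)) = exp ((x\<^sup>2 - y\<^sup>2) / 2)"
    by (simp add: mult_exp_exp diff_divide_distrib)
  finally show ?thesis .
qed

text \<open>Comparison of two tails with the exact exponential factor and a bounded constant; \<open>x\<close> and \<open>y\<close> may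
come in either order, provided that \<open>y\<close> is not much smaller than \<open>x\<close>.\<close>

lemma gauss_tail_compare:
  assumes "0 < x" "0 < y" "x \<le> K * y" "1 \<le> K"
  shows "gauss_tail y \<le> K * exp ((x\<^sup>2 - y\<^sup>2) / 2) * gauss_tail x"
proof (cases "x \<le> y")
  case True
  have "gauss_tail y \<le> 1 * (exp ((x\<^sup>2 - y\<^sup>2) / 2) * gauss_tail x)"
    using gauss_tail_decay[OF True] assms by simp
  also have "\<dots> \<le> K * (exp ((x\<^sup>2 - y\<^sup>2) / 2) * gauss_tail x)"
    using assms by (intro mult_right_mono) (auto simp: gauss_tail_nonneg)
  finally show ?thesis by (simp add: mult.assoc)
next
  case False
  have "gauss_tail y \<le> x / y * (exp ((x\<^sup>2 - y\<^sup>2) / 2) * gauss_tail x)"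
    using gauss_tail_growth[of y x] False assms by simp
  also have "\<dots> \<le> K * (exp ((x\<^sup>2 - y\<^sup>2) / 2) * gauss_tail x)"
    using assms by (intro mult_right_mono) (auto simp: gauss_tail_nonneg field_simps)
  finally show ?thesis by (simp add: mult.assoc)
qed

text \<open>This is the form in which tails are compared throughout. A normal variable with standard deviation
\<open>S\<close> has to exceed its mean by \<open>S x\<close>; if the distance is changed to \<open>S x + J - G\<close> and the variance
enlarged by the factor \<open>1 + k\<close>, then the gain \<open>J\<close> is felt exponentially at the rate \<open>x / S\<close>, while the
loss \<open>G\<close> and the excess \<open>k\<close> cost a constant as long as \<open>x G / S\<close> and \<open>k x\<^sup>2\<close> are bounded. In the
applications \<open>S\<close> and \<open>x\<close> are of the order \<open>b\<close> and \<open>k\<close> is of the order \<open>1 / b\<^sup>2\<close>.\<close>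

lemma gauss_tail_tilt:
  assumes "0 < S" "0 < x" "0 \<le> G" "0 \<le> J" "0 \<le> k" "2 * G \<le> S * x"
  shows "gauss_tail ((x + (J - G) / S) / sqrt (1 + k))
    \<le> 2 * sqrt (1 + k) * exp ((k * x\<^sup>2 + 2 * x * G / S) / 2 - x * J / (2 * S * (1 + k))) * gauss_tail x"
proof -
  define y where "y = (x + (J - G) / S) / sqrt (1 + k)"
  have GS: "G / S \<le> x / 2" using assms by (simp add: field_simps)
  have JS: "0 \<le> J / S" using assms by simp
  have num: "x / 2 \<le> x + (J - G) / S"
    unfolding diff_divide_distrib using GS JS by linarith
  have sq: "0 < sqrt (1 + k)" using assms by simp
  have "0 < x + (J - G) / S" using num assms(2) by linarith
  then have y0: "0 < y" unfolding y_def using sq by (intro divide_pos_pos)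
  have "x / 2 / sqrt (1 + k) \<le> y" unfolding y_def using num sq by (intro divide_right_mono) auto
  then have xy: "x \<le> 2 * sqrt (1 + k) * y"
    using sq by (simp add: field_simps)
  have K1: "1 \<le> 2 * sqrt (1 + k)" using real_sqrt_ge_1_iff[of "1+k"] assms(5) by linarith
  have "y\<^sup>2 = (x + (J - G) / S)\<^sup>2 / (1 + k)"
    unfolding y_def using assms by (simp add: power_divide)
  moreover have "x\<^sup>2 - 2 * x * G / S + x * J / S \<le> (x + (J - G) / S)\<^sup>2"
  proof -
    define g where "g = G / S" define j where "j = J / S"
    have gj: "0 \<le> j" "g \<le> x / 2" using GS JS by (auto simp: g_def j_def)
    have "(x + (j - g))\<^sup>2 = x\<^sup>2 - 2 * x * g + 2 * (x - g) * j + (j\<^sup>2 + g\<^sup>2)"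
      by (simp add: power2_eq_square algebra_simps)
    moreover have "x * j \<le> 2 * (x - g) * j" using gj by (intro mult_right_mono) auto
    moreover have "0 \<le> j\<^sup>2 + g\<^sup>2" by simp
    ultimately have "x\<^sup>2 - 2 * x * g + x * j \<le> (x + (j - g))\<^sup>2" by linarith
    then show ?thesis by (simp add: g_def j_def diff_divide_distrib)
  qed
  ultimately have "(x\<^sup>2 - 2 * x * G / S + x * J / S) / (1 + k) \<le> y\<^sup>2"
    using assms by (simp add: divide_right_mono)
  moreover have "x\<^sup>2 - k * x\<^sup>2 - 2 * x * G / S + x * J / (S * (1 + k)) \<le> (x\<^sup>2 - 2 * x * G / S + x * J / S) / (1 + k)"
  proof -
    have a: "x\<^sup>2 - k * x\<^sup>2 \<le> x\<^sup>2 / (1 + k)"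
      using assms by (simp add: field_simps power2_eq_square)
    have "2 * x * G / S / (1 + k) \<le> 2 * x * G / S / 1"
      using assms by (intro divide_left_mono) auto
    then show ?thesis using a assms by (simp add: diff_divide_distrib add_divide_distrib)
  qed
  ultimately have "(x\<^sup>2 - y\<^sup>2) / 2 \<le> (k * x\<^sup>2 + 2 * x * G / S) / 2 - x * J / (2 * S * (1 + k))"
  proof -
    assume a: "(x\<^sup>2 - 2 * x * G / S + x * J / S) / (1 + k) \<le> y\<^sup>2"
      "x\<^sup>2 - k * x\<^sup>2 - 2 * x * G / S + x * J / (S * (1 + k)) \<le> (x\<^sup>2 - 2 * x * G / S + x * J / S) / (1 + k)"
    have e: "x * J / (2 * S * (1 + k)) = (x * J / (S * (1 + k))) / 2" by (simp add: mult.assoc)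
    have aux: "(X - Y) / 2 \<le> (M + B) / 2 - A / 2" if "q \<le> Y" "X - M - B + A \<le> q" for q X Y M B A :: real
      using that by argo
    show ?thesis unfolding e using aux[OF a] .
  qed
  then have "exp ((x\<^sup>2 - y\<^sup>2) / 2) \<le> exp ((k * x\<^sup>2 + 2 * x * G / S) / 2 - x * J / (2 * S * (1 + k)))"
    by simp
  moreover have "gauss_tail y \<le> 2 * sqrt (1 + k) * exp ((x\<^sup>2 - y\<^sup>2) / 2) * gauss_tail x"
    using gauss_tail_compare[OF assms(2) y0 xy K1] .
  ultimately show ?thesis
    unfolding y_def[symmetric] using sq gauss_tail_nonneg[of x]
    by (smt (verit, best) mult_left_mono mult_right_mono)
qed

lemma gaussian_variable_integrable:
  assumes "prob_space P" "gaussian_variable P X"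
  shows "integrable P X" "integrable P (\<lambda>w. (X w)\<^sup>2)"
proof -
  interpret prob_space P by fact
  have meas: "X \<in> borel_measurable P" using assms(2) by (simp add: gaussian_variable_def)
  from assms(2) consider c where "AE w in P. X w = c"
    | m s where "0 < s" "distributed P lborel X (\<lambda>x. ennreal (normal_density m s x))"
    by (auto simp: gaussian_variable_def)
  then have "integrable P X \<and> integrable P (\<lambda>w. (X w)\<^sup>2)"
  proof cases
    case 1
    have "integrable P (\<lambda>w. c)" "integrable P (\<lambda>w. c\<^sup>2)" by auto
    moreover have "integrable P X \<longleftrightarrow> integrable P (\<lambda>w. c)"
      using 1 meas by (intro integrable_cong_AE) auto
    moreover have "integrable P (\<lambda>w. (X w)\<^sup>2) \<longleftrightarrow> integrable P (\<lambda>w. c\<^sup>2)"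
      using 1 meas by (intro integrable_cong_AE) auto
    ultimately show ?thesis by simp
  next
    case 2
    have 1: "integrable lborel (\<lambda>x. normal_density m s x * (x - m))"
      using integrable_normal_moment[of s m 1] 2 by simp
    have 0: "integrable lborel (\<lambda>x. normal_density m s x)" using 2 by auto
    have sq: "integrable lborel (\<lambda>x. normal_density m s x * (x - m)\<^sup>2)"
      using integrable_normal_moment[of s m 2] 2 by simp
    have "integrable lborel (\<lambda>x. normal_density m s x * (x - m) + m * normal_density m s x)"
      using 0 1 by auto
    then have i1: "integrable lborel (\<lambda>x. normal_density m s x * x)"
      by (simp add: algebra_simps)
    have "integrable lborel (\<lambda>x. normal_density m s x * (x - m)\<^sup>2 + 2 * m * (normal_density m s x * x) - m\<^sup>2 * normal_density m s x)"
      using i1 sq 0 by auto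
    then have i2: "integrable lborel (\<lambda>x. normal_density m s x * x\<^sup>2)"
      by (simp add: algebra_simps power2_eq_square)
    have "integrable P (\<lambda>w. X w)"
      using distributed_integrable[OF 2(2), of "\<lambda>x. x"] i1 by auto
    moreover have "integrable P (\<lambda>w. (X w)\<^sup>2)"
      using distributed_integrable[OF 2(2), of "\<lambda>x. x\<^sup>2"] i2 by auto
    ultimately show ?thesis by simp
  qed
  then show "integrable P X" "integrable P (\<lambda>w. (X w)\<^sup>2)" by auto
qed

lemma normal_tail_standardize:
  assumes "prob_space P" "0 < s" "distributed P lborel X (\<lambda>x. ennreal (normal_density m s x))"
  shows "measure P {w \<in> space P. a < X w} = gauss_tail ((a - m) / s)"
proof -
  interpret prob_space P by fact
  have "distributed P lborel (\<lambda>w. (X w - m) / s) std_normal_density"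
    using normal_standard_normal_convert[OF assms(2), of X m] assms(3) by simp
  then have "distr P lborel (\<lambda>w. (X w - m) / s) = density lborel std_normal_density"
    and meas: "(\<lambda>w. (X w - m) / s) \<in> measurable P lborel"
    by (auto simp: distributed_def)
  then have "gauss_tail ((a - m) / s) = measure (distr P lborel (\<lambda>w. (X w - m) / s)) {(a - m) / s<..}"
    by (simp add: gauss_tail_def)
  also have "\<dots> = measure P ((\<lambda>w. (X w - m) / s) -` {(a - m) / s<..} \<inter> space P)"
    using meas by (intro measure_distr) auto
  also have "(\<lambda>w. (X w - m) / s) -` {(a - m) / s<..} \<inter> space P = {w \<in> space P. a < X w}"
    using assms(2) by (auto simp: divide_less_cancel)
  finally show ?thesis by simp
qed

text \<open>The constant and the parameters in the definition of a Gaussian variable are identified with its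
mean and variance.\<close>

lemma gaussian_variable_cases:
  assumes "prob_space P" "gaussian_variable P X"
  obtains (degenerate) "AE w in P. X w = prob_space.expectation P X" "prob_space.variance P X = 0"
  | (normal) "0 < prob_space.variance P X"
      "distributed P lborel X (\<lambda>x. ennreal (normal_density (prob_space.expectation P X) (sqrt (prob_space.variance P X)) x))"
proof -
  interpret prob_space P by fact
  have meas: "X \<in> borel_measurable P" using assms(2) by (simp add: gaussian_variable_def)
  from assms(2) consider c where "AE w in P. X w = c"
    | m s where "0 < s" "distributed P lborel X (\<lambda>x. ennreal (normal_density m s x))"
    by (auto simp: gaussian_variable_def)
  then show thesis
  proof cases
    case 1
    have "expectation X = expectation (\<lambda>w. c)" using 1 meas by (intro integral_cong_AE) auto
    then have e: "expectation X = c" by (simp add: prob_space)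
    have "AE w in P. (X w - c)\<^sup>2 = 0" using 1 by eventually_elim auto
    then have "variance X = expectation (\<lambda>w. 0)"
      unfolding e using meas by (intro integral_cong_AE) auto
    then show thesis using degenerate 1 e by simp
  next
    case 2
    have e: "expectation X = m" using normal_distributed_expectation[OF 2] .
    have v: "variance X = s\<^sup>2" using normal_distributed_variance[OF 2] .
    show thesis using normal 2 e v by simp
  qed
qed

lemma gaussian_variable_tail_eq:
  assumes "prob_space P" "gaussian_variable P X" "0 < prob_space.variance P X"
  shows "measure P {w \<in> space P. a < X w}
    = gauss_tail ((a - prob_space.expectation P X) / sqrt (prob_space.variance P X))"
  using assms(1,2)
proof (cases rule: gaussian_variable_cases)
  case degenerate
  then show ?thesis using assms by simp
next
  case normal
  then show ?thesis using normal_tail_standardize[OF assms(1) _ normal(2)] by simp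
qed

text \<open>Upper bounds on the mean and the variance are enough, and a degenerate variable is covered as well:
this is what allows the later estimates to use linear combinations whose variance is only known up
to a constant and might vanish.\<close>

lemma gaussian_variable_tail_le:
  assumes "prob_space P" "gaussian_variable P X" "prob_space.expectation P X \<le> m"
    "prob_space.variance P X \<le> V" "0 < V" "m \<le> a"
  shows "measure P {w \<in> space P. a < X w} \<le> gauss_tail ((a - m) / sqrt V)"
  using assms(1,2)
proof (cases rule: gaussian_variable_cases)
  case degenerate
  interpret prob_space P by fact
  have meas: "X \<in> borel_measurable P" using assms(2) by (simp add: gaussian_variable_def)
  have "AE w in P. \<not> a < X w" using degenerate(1) by eventually_elim (use assms in linarith)
  then have "measure P {w \<in> space P. a < X w} = 0"
    using meas by (subst prob_eq_0) auto
  then show ?thesis using gauss_tail_nonneg by simp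
next
  case normal
  let ?e = "prob_space.expectation P X" and ?v = "prob_space.variance P X"
  have "measure P {w \<in> space P. a < X w} = gauss_tail ((a - ?e) / sqrt ?v)"
    using gaussian_variable_tail_eq[OF assms(1,2) normal(1)] .
  also have "\<dots> \<le> gauss_tail ((a - m) / sqrt V)"
  proof (rule gauss_tail_antimono)
    have "(a - m) / sqrt V \<le> (a - m) / sqrt ?v"
      using assms normal(1) by (intro divide_left_mono) auto
    also have "\<dots> \<le> (a - ?e) / sqrt ?v"
      using assms normal(1) by (intro divide_right_mono) auto
    finally show "(a - m) / sqrt V \<le> (a - ?e) / sqrt ?v" .
  qed
  finally show ?thesis .
qed

section \<open>Exponential against polynomial decay\<close>

text \<open>All exponential decay is eventually traded for decay of a fixed polynomial order.\<close>

lemma exp_neg_le_powr: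
  fixes a q :: real
  assumes "0 < a" "0 \<le> q"
  obtains C where "0 < C" "\<And>z. 1 \<le> z \<Longrightarrow> exp (- a * z) \<le> C * z powr (- q)"
proof -
  define m where "m = nat \<lceil>q\<rceil>"
  have m: "q \<le> real m" unfolding m_def using assms by linarith
  define C where "C = fact m / a ^ m"
  have C: "0 < C" unfolding C_def using assms by simp
  moreover have "exp (- a * z) \<le> C * z powr (- q)" if z: "1 \<le> z" for z
  proof -
    have az: "0 < a * z" using assms z by simp
    have "(a * z) ^ m / fact m \<le> exp (a * z)"
    proof -
      have s: "(\<lambda>n. (a * z) ^ n /\<^sub>R fact n) sums exp (a * z)"
        by (rule exp_converges)
      have "(\<Sum>n\<in>{m}. (a * z) ^ n /\<^sub>R fact n) \<le> (\<Sum>n. (a * z) ^ n /\<^sub>R fact n)"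
        using az s by (intro sum_le_suminf) (auto simp: sums_iff)
      then show ?thesis using s by (simp add: sums_iff divide_inverse mult.commute)
    qed
    then have "1 / exp (a * z) \<le> 1 / ((a * z) ^ m / fact m)"
      using az by (intro divide_left_mono) auto
    then have "exp (- (a * z)) \<le> fact m / (a * z) ^ m"
      by (simp add: exp_minus inverse_eq_divide)
    also have "\<dots> = C * z powr (- real m)"
      using z by (simp add: C_def power_mult_distrib powr_minus powr_realpow divide_inverse)
    also have "\<dots> \<le> C * z powr (- q)"
      using C z m by (intro mult_left_mono powr_mono) auto
    finally show ?thesis by simp
  qed
  ultimately show thesis using that by blast
qed

lemma exp_neg_powr_le:
  fixes a q \<theta> :: real
  assumes "0 < a" "0 \<le> q" "0 < \<theta>"
  obtains C where "1 \<le> C" "\<And>y. 1 \<le> y \<Longrightarrow> exp (- a * y powr \<theta>) \<le> C * (1 + y) powr (- q)"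
proof -
  obtain C where C: "0 < C" "\<And>z. 1 \<le> z \<Longrightarrow> exp (- a * z) \<le> C * z powr (- (q / \<theta>))"
    using exp_neg_le_powr[of a "q / \<theta>"] assms by auto
  define D where "D = max 1 (C * 2 powr q)"
  have "exp (- a * y powr \<theta>) \<le> D * (1 + y) powr (- q)" if y: "1 \<le> y" for y
  proof -
    have "1 \<le> y powr \<theta>" using y assms by (simp add: ge_one_powr_ge_zero)
    then have "exp (- a * y powr \<theta>) \<le> C * (y powr \<theta>) powr (- (q / \<theta>))"
      using C by blast
    also have "(y powr \<theta>) powr (- (q / \<theta>)) = y powr (- q)"
      using assms by (simp add: powr_powr)
    also have "y powr (- q) \<le> ((1 + y) / 2) powr (- q)"
      using y assms by (intro powr_mono2') auto
    also have "((1 + y) / 2) powr (- q) = 2 powr q * (1 + y) powr (- q)"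
      using y by (subst powr_divide) (auto simp: powr_minus field_simps)
    finally have "exp (- a * y powr \<theta>) \<le> C * 2 powr q * (1 + y) powr (- q)"
      using C by (simp add: mult.assoc)
    also have "\<dots> \<le> D * (1 + y) powr (- q)"
      unfolding D_def by (intro mult_right_mono) auto
    finally show ?thesis .
  qed
  then show thesis using that[of D] by (auto simp: D_def)
qed

section \<open>Slowly varying functions\<close>

lemma slowly_varying_pos: "slowly_varying_at_zero L \<Longrightarrow> 0 < x \<Longrightarrow> 0 < L x"
  by (simp add: slowly_varying_at_zero_def)

lemma slowly_varying_continuous: "slowly_varying_at_zero L \<Longrightarrow> continuous_on {0<..} L"
  by (simp add: slowly_varying_at_zero_def)

text \<open>In the variable \<open>exp (- x)\<close>, slow variation of \<open>L\<close> at zero says that the increments of \<open>ln L\<close> over any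
fixed length vanish at infinity.\<close>

lemma slowly_varying_log_tendsto:
  assumes "slowly_varying_at_zero L" "0 < s"
  shows "((\<lambda>x. ln (L (exp (- (x + s)))) - ln (L (exp (- x)))) \<longlongrightarrow> 0) at_top"
proof -
  have "exp (- s) \<in> {0<..<1}" using assms by simp
  then have "((\<lambda>x. L (exp (- s) * x) / L x) \<longlongrightarrow> 1) (at_right 0)"
    using assms by (auto simp: slowly_varying_at_zero_def)
  moreover have "filterlim (\<lambda>x::real. exp (- x)) (at_right 0) at_top"
    unfolding filterlim_at_right_to_top
    by (intro filterlim_at_withinI)
      (auto intro!: filterlim_compose[OF exp_at_bot] filterlim_uminus_at_bot_at_top)
  ultimately have "((\<lambda>x. L (exp (- s) * exp (- x)) / L (exp (- x))) \<longlongrightarrow> 1) at_top"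
    by (rule filterlim_compose)
  then have "((\<lambda>x. ln (L (exp (- s) * exp (- x)) / L (exp (- x)))) \<longlongrightarrow> ln 1) at_top"
    by (intro tendsto_ln) auto
  moreover have "ln (L (exp (- s) * exp (- x)) / L (exp (- x))) = ln (L (exp (- (x + s)))) - ln (L (exp (- x)))" for x
    using slowly_varying_pos[OF assms(1), of "exp (- s - x)"] slowly_varying_pos[OF assms(1), of "exp (- x)"]
    by (simp add: ln_div mult_exp_exp add.commute)
  ultimately show ?thesis by simp
qed

text \<open>The pointwise convergence of the increments is upgraded to a uniform bound over short lengths by
Baire's theorem: the sets of lengths that are good from a fixed time on are closed and exhaust an
interval, so one of them contains an interval, and differences of two good lengths fill a
neighbourhood of zero.\<close>

lemma locally_uniform_increments:
  fixes h :: "real \<Rightarrow> real"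
  assumes cont: "continuous_on UNIV h"
    and lim: "\<And>s. 0 < s \<Longrightarrow> ((\<lambda>x. h (x + s) - h x) \<longlongrightarrow> 0) at_top"
  shows "\<exists>X. \<exists>\<eta>>0. \<forall>x\<ge>X. \<forall>t\<in>{0..\<eta>}. \<bar>h (x + t) - h x\<bar> \<le> 2"
proof -
  define E where "E n = {s\<in>{1..2}. \<forall>x\<ge>real n. \<bar>h (x + s) - h x\<bar> \<le> 1}" for n :: nat
  have closedE: "closed (E n)" for n
  proof -
    have "E n = {1..2} \<inter> (\<Inter>x\<in>{real n..}. {s. \<bar>h (x + s) - h x\<bar> \<le> 1})"
      by (auto simp: E_def)
    moreover have "closed {s. \<bar>h (x + s) - h x\<bar> \<le> 1}" for x
      by (intro closed_Collect_le continuous_intros continuous_on_compose2[OF cont]) auto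
    ultimately show ?thesis by (auto intro!: closed_Int closed_INT)
  qed
  have cover: "{1..2::real} = (\<Union>n. E n)"
  proof
    show "(\<Union>n. E n) \<subseteq> {1..2}" by (auto simp: E_def)
    show "{1..2::real} \<subseteq> (\<Union>n. E n)"
    proof
      fix s :: real assume s: "s \<in> {1..2}"
      then have "eventually (\<lambda>x. \<bar>h (x + s) - h x\<bar> < 1) at_top"
        using tendstoD[OF lim[of s], of 1] by (auto simp: dist_real_def)
      then obtain X where X: "\<And>x. X \<le> x \<Longrightarrow> \<bar>h (x + s) - h x\<bar> < 1"
        by (auto simp: eventually_at_top_linorder)
      obtain n :: nat where "X \<le> real n" using real_arch_simple by blast
      then have "s \<in> E n" using s X by (auto simp: E_def intro!: less_imp_le)
      then show "s \<in> (\<Union>n. E n)" by blast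
    qed
  qed
  have "\<exists>n. interior (E n) \<noteq> {}"
  proof (rule ccontr)
    assume none: "\<not> (\<exists>n. interior (E n) \<noteq> {})"
    define G where "G = range (\<lambda>n. - E n)"
    have "UNIV \<subseteq> closure (\<Inter>G)"
      using none closedE by (intro Baire) (auto simp: G_def closure_complement open_Compl)
    then have "closure (\<Inter>G) = UNIV" by auto
    moreover have "\<Inter>G \<subseteq> - {1<..<2}"
    proof -
      have "\<Inter>G = - {1..2::real}" unfolding cover G_def by auto
      then show ?thesis by auto
    qed
    then have "closure (\<Inter>G) \<subseteq> - {1<..<2}"
      by (intro closure_minimal) auto
    moreover have "(3/2::real) \<in> {1<..<2}" by simp
    ultimately show False by blast
  qed
  then obtain n s where "s \<in> interior (E n)" by blast
  then obtain e where e: "0 < e" "ball s e \<subseteq> E n" by (auto simp: mem_interior)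
  define a where "a = s"
  have "\<bar>h (x + t) - h x\<bar> \<le> 2" if x: "real n + a \<le> x" and t: "0 \<le> t" "t \<le> e / 2" for x t
  proof -
    have "a \<in> E n" "a + t \<in> E n" using e t by (auto simp: a_def dist_real_def subset_eq)
    moreover have "real n \<le> x - a" using x by simp
    ultimately have "\<bar>h ((x - a) + a) - h (x - a)\<bar> \<le> 1" "\<bar>h ((x - a) + (a + t)) - h (x - a)\<bar> \<le> 1"
      by (auto simp: E_def)
    then show ?thesis by (auto simp: algebra_simps)
  qed
  then have "\<forall>x\<ge>real n + a. \<forall>t\<in>{0..e/2}. \<bar>h (x + t) - h x\<bar> \<le> 2" by auto
  moreover have "0 < e / 2" using e by simp
  ultimately show ?thesis by blast
qed

text \<open>Steps of the fixed length \<open>\<eta>\<close> contribute at most \<open>\<epsilon> \<eta>\<close> each, and the remainder is covered by the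
uniform bound.\<close>

lemma increments_sublinear:
  fixes h :: "real \<Rightarrow> real"
  assumes cont: "continuous_on UNIV h"
    and lim: "\<And>s. 0 < s \<Longrightarrow> ((\<lambda>x. h (x + s) - h x) \<longlongrightarrow> 0) at_top"
    and "0 < \<epsilon>"
  shows "\<exists>X. \<exists>A\<ge>0. \<forall>x\<ge>X. \<forall>t\<ge>0. \<bar>h (x + t) - h x\<bar> \<le> A + \<epsilon> * t"
proof -
  from locally_uniform_increments[OF cont lim]
  obtain X \<eta> where \<eta>: "0 < \<eta>" and "\<forall>x\<ge>X. \<forall>t\<in>{0..\<eta>}. \<bar>h (x + t) - h x\<bar> \<le> 2"
    by auto
  then have X: "\<bar>h (x + t) - h x\<bar> \<le> 2" if "X \<le> x" "0 \<le> t" "t \<le> \<eta>" for x t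
    using that by simp
  have "eventually (\<lambda>x. \<bar>h (x + \<eta>) - h x\<bar> < \<epsilon> * \<eta>) at_top"
    using tendstoD[OF lim[OF \<eta>], of "\<epsilon> * \<eta>"] \<eta> assms(3) by (auto simp: dist_real_def)
  then obtain Y where Y: "\<And>x. Y \<le> x \<Longrightarrow> \<bar>h (x + \<eta>) - h x\<bar> < \<epsilon> * \<eta>"
    by (auto simp: eventually_at_top_linorder)
  have step: "\<bar>h (x + real n * \<eta>) - h x\<bar> \<le> real n * (\<epsilon> * \<eta>)" if "Y \<le> x" for x n
  proof (induction n)
    case (Suc n)
    have "0 \<le> real n * \<eta>" using \<eta> by simp
    then have "Y \<le> x + real n * \<eta>" using that by linarith
    from Y[OF this] have "\<bar>h (x + real n * \<eta> + \<eta>) - h (x + real n * \<eta>)\<bar> \<le> \<epsilon> * \<eta>" by simp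
    moreover have "x + real (Suc n) * \<eta> = x + real n * \<eta> + \<eta>" by (simp add: algebra_simps)
    ultimately show ?case using Suc by (simp add: algebra_simps)
  qed auto
  have "\<bar>h (x + t) - h x\<bar> \<le> 2 + \<epsilon> * t" if x: "max X Y \<le> x" and t: "0 \<le> t" for x t
  proof -
    define n where "n = nat \<lfloor>t / \<eta>\<rfloor>"
    have "real n = of_int \<lfloor>t / \<eta>\<rfloor>" unfolding n_def using t \<eta> by simp
    then have n: "real n \<le> t / \<eta>" "t / \<eta> < real n + 1" by linarith+
    then have n': "real n * \<eta> \<le> t" "t - real n * \<eta> \<le> \<eta>" using \<eta> by (auto simp: field_simps)
    have "0 \<le> real n * \<eta>" using \<eta> by simp
    then have "X \<le> x + real n * \<eta>" using x by linarith
    then have "\<bar>h (x + real n * \<eta> + (t - real n * \<eta>)) - h (x + real n * \<eta>)\<bar> \<le> 2"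
      using n' by (intro X) auto
    moreover have "\<bar>h (x + real n * \<eta>) - h x\<bar> \<le> real n * (\<epsilon> * \<eta>)"
      using x by (intro step) simp
    moreover have "real n * (\<epsilon> * \<eta>) \<le> \<epsilon> * t"
      using n'(1) assms(3) by (simp add: mult.left_commute)
    ultimately show ?thesis by simp
  qed
  then have "\<forall>x\<ge>max X Y. \<forall>t\<ge>0. \<bar>h (x + t) - h x\<bar> \<le> 2 + \<epsilon> * t" by blast
  moreover have "(0::real) \<le> 2" by simp
  ultimately show ?thesis by blast
qed

text \<open>Potter's bounds: up to a constant, a slowly varying function changes by less than any power. They
are the exponentiated form of the sublinear growth of \<open>ln L\<close>, and all that is used about slow
variation in what follows.\<close>

lemma potter_bounds:
  assumes sv: "slowly_varying_at_zero L" and "0 < \<epsilon>"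
  obtains x0 A where "0 < x0" "1 \<le> A"
    "\<And>x y. 0 < x \<Longrightarrow> x \<le> y \<Longrightarrow> y \<le> x0 \<Longrightarrow> L x \<le> A * (y / x) powr \<epsilon> * L y"
    "\<And>x y. 0 < x \<Longrightarrow> x \<le> y \<Longrightarrow> y \<le> x0 \<Longrightarrow> L y \<le> A * (y / x) powr \<epsilon> * L x"
proof -
  define h where "h s = ln (L (exp (- s)))" for s
  have pos: "0 < L x" if "0 < x" for x using slowly_varying_pos[OF sv that] .
  have "continuous_on UNIV h"
    unfolding h_def using pos
    by (intro continuous_on_ln continuous_on_compose2[OF slowly_varying_continuous[OF sv]] continuous_intros)
      (auto simp: less_imp_neq[symmetric])
  moreover have "((\<lambda>x. h (x + s) - h x) \<longlongrightarrow> 0) at_top" if "0 < s" for s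
    using slowly_varying_log_tendsto[OF sv that] by (simp add: h_def)
  ultimately have "\<exists>X. \<exists>A\<ge>0. \<forall>x\<ge>X. \<forall>t\<ge>0. \<bar>h (x + t) - h x\<bar> \<le> A + \<epsilon> * t"
    using assms(2) by (rule increments_sublinear)
  then obtain X A where A: "0 \<le> A" and "\<forall>x\<ge>X. \<forall>t\<ge>0. \<bar>h (x + t) - h x\<bar> \<le> A + \<epsilon> * t"
    by auto
  then have hA: "\<bar>h (x + t) - h x\<bar> \<le> A + \<epsilon> * t" if "X \<le> x" "0 \<le> t" for x t
    using that by simp
  have main: "\<bar>ln (L x) - ln (L y)\<bar> \<le> A + \<epsilon> * ln (y / x)" if "0 < x" "x \<le> y" "y \<le> exp (- X)" for x y
  proof -
    have "ln y \<le> - X" using that by (metis dual_order.strict_trans1 ln_exp ln_le_cancel_iff exp_gt_zero)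
    then have "\<bar>h (- ln y + (ln y - ln x)) - h (- ln y)\<bar> \<le> A + \<epsilon> * (ln y - ln x)"
      using that by (intro hA) auto
    then show ?thesis using that by (simp add: h_def ln_div)
  qed
  have conv: "L a \<le> exp A * (y / x) powr \<epsilon> * L b"
    if "\<bar>ln (L a) - ln (L b)\<bar> \<le> A + \<epsilon> * ln (y / x)" "0 < a" "0 < b" "0 < x" "0 < y" for a b x y
  proof -
    have "L a = exp (ln (L a))" using that pos by simp
    also have "\<dots> \<le> exp (A + \<epsilon> * ln (y / x) + ln (L b))" using that by simp
    also have "\<dots> = exp A * (y / x) powr \<epsilon> * L b"
      using that pos by (simp add: exp_add powr_def)
    finally show ?thesis .
  qed
  show thesis
  proof (rule that[of "exp (- X)" "exp A"])
    show "1 \<le> exp A" using A by simp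
    fix x y :: real assume xy: "0 < x" "x \<le> y" "y \<le> exp (- X)"
    show "L x \<le> exp A * (y / x) powr \<epsilon> * L y"
      using main[OF xy] xy by (intro conv) auto
    show "L y \<le> exp A * (y / x) powr \<epsilon> * L x"
      using main[OF xy] xy by (intro conv) (auto simp: abs_minus_commute)
  qed simp
qed

text \<open>The range in which \<open>x\<close> may exceed \<open>u\<close> by a bounded factor is included, since the cells around a net of
mesh \<open>u\<close> overlap.\<close>

lemma slowly_varying_upper_near:
  assumes sv: "slowly_varying_at_zero L" and "0 < \<epsilon>" "1 \<le> R"
  obtains x0 A where "0 < x0" "1 \<le> A"
    "\<And>u x. 0 < u \<Longrightarrow> R * u \<le> x0 \<Longrightarrow> 0 < x \<Longrightarrow> x \<le> R * u \<Longrightarrow> L x \<le> A * (x / u) powr (- \<epsilon>) * L u"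
proof -
  obtain x0 A where x0: "0 < x0" and A: "1 \<le> A"
    and P1: "\<And>x y. 0 < x \<Longrightarrow> x \<le> y \<Longrightarrow> y \<le> x0 \<Longrightarrow> L x \<le> A * (y / x) powr \<epsilon> * L y"
    and P2: "\<And>x y. 0 < x \<Longrightarrow> x \<le> y \<Longrightarrow> y \<le> x0 \<Longrightarrow> L y \<le> A * (y / x) powr \<epsilon> * L x"
    using potter_bounds[OF sv assms(2)] by blast
  have pos: "0 < L x" if "0 < x" for x using slowly_varying_pos[OF sv that] .
  have R2: "1 \<le> R powr (2 * \<epsilon>)" using assms by (simp add: ge_one_powr_ge_zero)
  show thesis
  proof (rule that[of x0 "A * R powr (2 * \<epsilon>)"])
    show "1 \<le> A * R powr (2 * \<epsilon>)" using A R2 mult_mono[of 1 A 1 "R powr (2 * \<epsilon>)"] by simp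
    fix u x assume u: "0 < u" "R * u \<le> x0" "0 < x" "x \<le> R * u"
    have uR: "u \<le> R * u" using u assms(3) by simp
    show "L x \<le> A * R powr (2 * \<epsilon>) * (x / u) powr (- \<epsilon>) * L u"
    proof (cases "x \<le> u")
      case True
      have "L x \<le> A * (u / x) powr \<epsilon> * L u" using P1[of x u] u uR True by linarith
      also have "(u / x) powr \<epsilon> = 1 * (x / u) powr (- \<epsilon>)"
        using u by (simp add: powr_divide powr_minus_divide)
      also have "A * \<dots> * L u \<le> A * (R powr (2 * \<epsilon>) * (x / u) powr (- \<epsilon>)) * L u"
        using R2 A pos[OF u(1)] by (intro mult_right_mono mult_left_mono) auto
      finally show ?thesis by (simp add: mult.assoc)
    next
      case False
      have "L x \<le> A * (x / u) powr \<epsilon> * L u" using P2[of u x] u False by linarith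
      also have "(x / u) powr \<epsilon> = (x / u) powr (2 * \<epsilon>) * (x / u) powr (- \<epsilon>)"
        using u by (simp add: powr_add[symmetric])
      also have "A * \<dots> * L u \<le> A * (R powr (2 * \<epsilon>) * (x / u) powr (- \<epsilon>)) * L u"
        using A pos[OF u(1)] u assms
        by (intro mult_right_mono mult_left_mono powr_mono2) (auto simp: field_simps)
      finally show ?thesis by (simp add: mult.assoc)
    qed
  qed (use x0 in auto)
qed

lemma slowly_varying_mult_powr_tendsto:
  assumes sv: "slowly_varying_at_zero L" and "0 < \<alpha>"
  obtains x0 A where "0 < x0" "0 < A" "\<And>x. 0 < x \<Longrightarrow> x \<le> x0 \<Longrightarrow> L x * x powr \<alpha> \<le> A * x powr (\<alpha> / 2)"
proof -
  obtain x0 A where x0: "0 < x0" and A: "1 \<le> A"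
    and P1: "\<And>x y. 0 < x \<Longrightarrow> x \<le> y \<Longrightarrow> y \<le> x0 \<Longrightarrow> L x \<le> A * (y / x) powr (\<alpha>/2) * L y"
    by (rule potter_bounds[OF sv half_gt_zero[OF assms(2)]]) blast
  have pos: "0 < L x0" using slowly_varying_pos[OF sv x0] .
  show thesis
  proof (rule that[of x0 "A * x0 powr (\<alpha> / 2) * L x0"])
    fix x assume x: "0 < x" "x \<le> x0"
    have "L x * x powr \<alpha> \<le> A * (x0 / x) powr (\<alpha>/2) * L x0 * x powr \<alpha>"
      using P1[of x x0] x by (intro mult_right_mono) auto
    also have "\<dots> = A * x0 powr (\<alpha> / 2) * L x0 * (x powr \<alpha> / x powr (\<alpha> / 2))"
      using x x0 by (simp add: powr_divide)
    also have "x powr \<alpha> / x powr (\<alpha> / 2) = x powr (\<alpha> / 2)"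
      using x by (simp add: powr_diff[symmetric])
    finally show "L x * x powr \<alpha> \<le> A * x0 powr (\<alpha> / 2) * L x0 * x powr (\<alpha> / 2)" .
  qed (use x0 A pos in auto)
qed

text \<open>The length \<open>u\<close> at which a function behaving like \<open>L(h) h\<^sup>\<alpha>\<close> reaches the size \<open>1 / b\<^sup>2\<close>. Such a length
need not be unique; any one will do.\<close>

definition critical_scale :: "(real \<Rightarrow> real) \<Rightarrow> real \<Rightarrow> real \<Rightarrow> real \<Rightarrow> bool" where
  "critical_scale L \<alpha> b u \<longleftrightarrow> b\<^sup>2 * (L u * u powr \<alpha>) = 1"

text \<open>By the intermediate value theorem. The critical length is found below an arbitrary bound \<open>x1\<close>, so
smallness of the scale can be imposed when it is chosen instead of being proved.\<close>

lemma scale_exists: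
  assumes sv: "slowly_varying_at_zero L" and "0 < \<alpha>" "0 < x1"
  obtains b0 where "0 < b0"
    "\<And>b. b0 \<le> b \<Longrightarrow> \<exists>u>0. u \<le> x1 \<and> critical_scale L \<alpha> b u"
proof -
  obtain x0 A where x0: "0 < x0" and A: "0 < A" and P: "\<And>x. 0 < x \<Longrightarrow> x \<le> x0 \<Longrightarrow> L x * x powr \<alpha> \<le> A * x powr (\<alpha> / 2)"
    using slowly_varying_mult_powr_tendsto[OF sv assms(2)] by blast
  define g where "g x = L x * x powr \<alpha>" for x
  have pos: "0 < g x" if "0 < x" for x using slowly_varying_pos[OF sv that] that by (simp add: g_def)
  have cont: "continuous_on {0<..} g"
    unfolding g_def by (intro continuous_intros slowly_varying_continuous[OF sv]) auto
  define b0 where "b0 = sqrt (1 / g x1)"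
  show thesis
  proof (rule that[of b0])
    show "0 < b0" using pos[OF assms(3)] by (simp add: b0_def)
    fix b assume b: "b0 \<le> b"
    have bpos: "0 < b" using b pos[OF assms(3)] by (auto simp: b0_def intro: less_le_trans[rotated])
    have "1 / g x1 \<le> b\<^sup>2" using b pos[OF assms(3)] bpos
      by (metis b0_def real_sqrt_le_iff real_sqrt_unique less_imp_le)
    then have up: "1 / b\<^sup>2 \<le> g x1" using bpos pos[OF assms(3)] by (simp add: field_simps)
    define y where "y = min (min x0 x1) ((1 / (A * b\<^sup>2)) powr (2 / \<alpha>))"
    have y: "0 < y" "y \<le> x0" "y \<le> x1" using x0 assms A bpos by (auto simp: y_def)
    have "g y \<le> A * y powr (\<alpha> / 2)" using P y by (simp add: g_def)
    also have "y powr (\<alpha> / 2) \<le> ((1 / (A * b\<^sup>2)) powr (2 / \<alpha>)) powr (\<alpha> / 2)"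
      using y assms(2) by (intro powr_mono2) (auto simp: y_def)
    also have "\<dots> = 1 / (A * b\<^sup>2)" using assms(2) A bpos by (simp add: powr_powr)
    finally have lo: "g y \<le> 1 / b\<^sup>2" using A by simp
    have "continuous_on {y..x1} g" using cont y by (rule_tac continuous_on_subset[OF cont]) auto
    from IVT'[OF lo up y(3) this] obtain u where "y \<le> u" "u \<le> x1" "g u = 1 / b\<^sup>2" by blast
    then show "\<exists>u>0. u \<le> x1 \<and> critical_scale L \<alpha> b u"
      using y bpos by (intro exI[of _ u]) (auto simp: g_def critical_scale_def)
  qed
qed

text \<open>The critical length is at least a power of \<open>1 / b\<close>. Consequently, factors like \<open>exp (- a b\<^sup>2)\<close>
beat any power of it.\<close>

lemma scale_lower_bound:
  assumes sv: "slowly_varying_at_zero L" and "0 < \<alpha>"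
  obtains x0 B where "0 < x0" "0 < B"
    "\<And>b u. 0 < u \<Longrightarrow> u \<le> x0 \<Longrightarrow> critical_scale L \<alpha> b u \<Longrightarrow> 1 / u \<le> (B * b\<^sup>2) powr (2 / \<alpha>)"
proof -
  obtain x0 A where x0: "0 < x0" and A: "0 < A" and P: "\<And>x. 0 < x \<Longrightarrow> x \<le> x0 \<Longrightarrow> L x * x powr \<alpha> \<le> A * x powr (\<alpha> / 2)"
    using slowly_varying_mult_powr_tendsto[OF sv assms(2)] by blast
  have "1 / u \<le> (A * b\<^sup>2) powr (2 / \<alpha>)"
    if u: "0 < u" "u \<le> x0" and eq: "critical_scale L \<alpha> b u" for b u
  proof -
    have "1 \<le> b\<^sup>2 * (A * u powr (\<alpha> / 2))"
      using mult_left_mono[OF P[OF u], of "b\<^sup>2"] eq[unfolded critical_scale_def] by simp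
    then have "u powr (- (\<alpha> / 2)) \<le> A * b\<^sup>2"
      using u by (simp add: powr_minus field_simps)
    then have "(u powr (- (\<alpha> / 2))) powr (2 / \<alpha>) \<le> (A * b\<^sup>2) powr (2 / \<alpha>)"
      using assms(2) by (intro powr_mono2) auto
    also have "(u powr (- (\<alpha> / 2))) powr (2 / \<alpha>) = u powr (- 1)"
      unfolding powr_powr using assms(2) by simp
    finally show ?thesis using u by (simp add: powr_minus_divide)
  qed
  then show thesis using that x0 A by blast
qed

section \<open>Separated sets\<close>

definition separated :: "real \<Rightarrow> 'a::metric_space set \<Rightarrow> bool" where
  "separated \<delta> N \<longleftrightarrow> (\<forall>x\<in>N. \<forall>y\<in>N. x \<noteq> y \<longrightarrow> \<delta> \<le> dist x y)"

text \<open>The balls of radius \<open>\<rho> / 2\<close> around the points are disjoint and their volumes add up.\<close>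

lemma separated_card_ball:
  fixes N :: "'a::euclidean_space set"
  assumes "finite N" "0 < \<rho>" "separated \<rho> N"
    and "0 \<le> R" "N \<subseteq> cball p (R * \<rho>)"
  shows "real (card N) \<le> (2 * R + 1) ^ DIM('a)"
proof -
  have vol: "measure lborel (ball x r) = r ^ DIM('a) * measure lborel (ball (0::'a) 1)" if "0 \<le> r" for x :: 'a and r
    using content_ball_conv_unit_ball[of r x] that by simp
  have dis: "disjoint_family_on (\<lambda>c. ball c (\<rho> / 2)) N"
    unfolding disjoint_family_on_def
  proof (intro ballI impI)
    fix x y assume "x \<in> N" "y \<in> N" "x \<noteq> y"
    then have "\<rho> \<le> dist x y" using assms(3) by (simp add: separated_def)
    show "ball x (\<rho> / 2) \<inter> ball y (\<rho> / 2) = {}"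
    proof (rule ccontr)
      assume "ball x (\<rho> / 2) \<inter> ball y (\<rho> / 2) \<noteq> {}"
      then obtain z where "dist x z < \<rho> / 2" "dist y z < \<rho> / 2" by auto
      then have "dist x y < \<rho>" using dist_triangle[of x y z] by (simp add: dist_commute)
      then show False using \<open>\<rho> \<le> dist x y\<close> by simp
    qed
  qed
  have "real (card N) * ((\<rho> / 2) ^ DIM('a) * measure lborel (ball (0::'a) 1))
      = (\<Sum>c\<in>N. measure lborel (ball c (\<rho> / 2)))"
    using assms(2) vol[of "\<rho> / 2"] by (simp only: sum_constant half_gt_zero less_imp_le)
  also have "\<dots> = measure lborel (\<Union>c\<in>N. ball c (\<rho> / 2))"
    using assms(1) dis
    using emeasure_lborel_ball_finite by (intro measure_finite_Union[symmetric]) (auto simp: less_top)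
  also have "\<dots> \<le> measure lborel (ball p ((R + 1 / 2) * \<rho>))"
  proof (rule measure_mono_fmeasurable)
    show "(\<Union>c\<in>N. ball c (\<rho> / 2)) \<subseteq> ball p ((R + 1 / 2) * \<rho>)"
    proof
      fix z assume "z \<in> (\<Union>c\<in>N. ball c (\<rho> / 2))"
      then obtain c where "c \<in> N" "dist c z < \<rho> / 2" by auto
      moreover have "dist p c \<le> R * \<rho>" using assms(5) \<open>c \<in> N\<close> by auto
      ultimately show "z \<in> ball p ((R + 1 / 2) * \<rho>)"
        using dist_triangle[of p z c] by (simp add: algebra_simps)
    qed
  qed (use emeasure_lborel_ball_finite[of p "(R + 1 / 2) * \<rho>"] in
      \<open>auto simp: fmeasurable_def intro!: borel_open\<close>)
  also have "\<dots> = ((2 * R + 1) * (\<rho> / 2)) ^ DIM('a) * measure lborel (ball (0::'a) 1)"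
    using assms by (subst vol) (auto simp: algebra_simps)
  also have "\<dots> = (2 * R + 1) ^ DIM('a) * ((\<rho> / 2) ^ DIM('a) * measure lborel (ball (0::'a) 1))"
    by (simp only: power_mult_distrib mult.assoc)
  finally show ?thesis
    using assms(2) content_ball_pos[of 1 "0::'a"] by simp
qed

lemma summable_inverse_squares: "summable (\<lambda>k. 1 / (real k + 1)\<^sup>2)"
  using inverse_power_summable[of 2, where 'a=real] summable_Suc_iff[of "\<lambda>n. inverse (real n ^ 2)"]
  by (simp add: divide_inverse add.commute)

text \<open>The constant in the next bound: a separated set has at most \<open>(3 (k + 1))\<^sup>d\<close> points at distance
between \<open>k\<close> and \<open>k + 1\<close> in units of the separation, and each contributes at most \<open>(k + 1)\<close> to the power
\<open>- (d + 2)\<close>.\<close>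

definition net_sum_const :: "nat \<Rightarrow> real" where
  "net_sum_const d = 3 ^ d * (\<Sum>k. 1 / (real k + 1)\<^sup>2)"

lemma net_sum_const_nonneg: "0 \<le> net_sum_const d"
  unfolding net_sum_const_def
  by (intro mult_nonneg_nonneg suminf_nonneg summable_inverse_squares) auto

lemma separated_sum_le:
  fixes N :: "'a::euclidean_space set"
  assumes "finite N" "0 < \<rho>" "separated \<rho> N"
  shows "(\<Sum>c\<in>N. (1 + dist c p / \<rho>) powr (- (real DIM('a) + 2))) \<le> net_sum_const DIM('a)"
proof -
  define lev where "lev c = nat \<lfloor>dist c p / \<rho>\<rfloor>" for c
  let ?d = "DIM('a)"
  have lev: "real (lev c) \<le> dist c p / \<rho>" "dist c p / \<rho> < real (lev c) + 1" for c
  proof -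
    have "0 \<le> dist c p / \<rho>" using assms by simp
    then have "real (lev c) = of_int \<lfloor>dist c p / \<rho>\<rfloor>" by (simp add: lev_def)
    then show "real (lev c) \<le> dist c p / \<rho>" "dist c p / \<rho> < real (lev c) + 1" by linarith+
  qed
  have "(\<Sum>c\<in>N. (1 + dist c p / \<rho>) powr (- (real ?d + 2))) \<le> (\<Sum>c\<in>N. (1 + real (lev c)) powr (- (real ?d + 2)))"
    using lev by (intro sum_mono powr_mono2') auto
  also have "\<dots> = (\<Sum>k\<in>lev ` N. \<Sum>c\<in>{c\<in>N. lev c = k}. (1 + real (lev c)) powr (- (real ?d + 2)))"
    using assms(1) by (rule sum.image_gen)
  also have "\<dots> \<le> (\<Sum>k\<in>lev ` N. 3 ^ ?d * (1 / (real k + 1)\<^sup>2))"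
  proof (rule sum_mono)
    fix k assume "k \<in> lev ` N"
    have "(\<Sum>c\<in>{c\<in>N. lev c = k}. (1 + real (lev c)) powr (- (real ?d + 2)))
      = real (card {c\<in>N. lev c = k}) * (1 + real k) powr (- (real ?d + 2))" by simp
    also have "\<dots> \<le> (2 * (real k + 1) + 1) ^ ?d * (1 + real k) powr (- (real ?d + 2))"
    proof (intro mult_right_mono separated_card_ball[where \<rho>=\<rho> and p=p])
      show "{c \<in> N. lev c = k} \<subseteq> cball p ((real k + 1) * \<rho>)"
      proof safe
        fix c assume "c \<in> N" "k = lev c"
        then show "c \<in> cball p ((real (lev c) + 1) * \<rho>)"
          using lev(2)[of c] assms(2) by (simp add: field_simps dist_commute)
      qed
    qed (use assms in \<open>auto simp: separated_def\<close>)
    also have "\<dots> \<le> (3 * (real k + 1)) ^ ?d * (1 + real k) powr (- (real ?d + 2))"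
      by (intro mult_right_mono power_mono) auto
    also have "\<dots> = 3 ^ ?d * (1 / (real k + 1)\<^sup>2)"
    proof -
      have "(1 + real k) powr (- (real ?d + 2)) = 1 / ((real k + 1) ^ ?d * (real k + 1)\<^sup>2)"
        unfolding powr_minus_divide powr_add by (simp add: powr_realpow add.commute)
      moreover have "(3 * (real k + 1)) ^ ?d = 3 ^ ?d * (real k + 1) ^ ?d"
        by (rule power_mult_distrib)
      ultimately show ?thesis by simp
    qed
    finally show "(\<Sum>c\<in>{c\<in>N. lev c = k}. (1 + real (lev c)) powr (- (real ?d + 2))) \<le> 3 ^ ?d * (1 / (real k + 1)\<^sup>2)" .
  qed
  also have "\<dots> = 3 ^ ?d * (\<Sum>k\<in>lev ` N. 1 / (real k + 1)\<^sup>2)"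
    by (simp only: sum_distrib_left)
  also have "\<dots> \<le> net_sum_const ?d"
    unfolding net_sum_const_def using assms(1)
    by (intro mult_left_mono sum_le_suminf summable_inverse_squares) auto
  finally show ?thesis .
qed

text \<open>A separated subset of maximal cardinality is a net.\<close>

lemma compact_separated_net:
  fixes S :: "'a::metric_space set"
  assumes "compact S" "0 < \<delta>"
  obtains N where "finite N" "N \<subseteq> S" "separated \<delta> N" "\<And>x. x \<in> S \<Longrightarrow> \<exists>c\<in>N. dist x c \<le> \<delta>"
proof -
  \<comment> \<open>A finite covering by balls of half the separation bounds the cardinality of separated sets.\<close>
  obtain F where F: "finite F" "F \<subseteq> S" "S \<subseteq> (\<Union>c\<in>F. ball c (\<delta> / 2))"
    using compactE_image[OF assms(1), of S "\<lambda>c. ball c (\<delta>/2)"] assms(2) by force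
  define sep where "sep N \<longleftrightarrow> N \<subseteq> S \<and> separated \<delta> N" for N
  have card: "finite N \<and> card N \<le> card F" if "sep N" for N
  proof -
    have "\<forall>x\<in>N. \<exists>c\<in>F. dist c x < \<delta> / 2" using that F(3) by (force simp: sep_def separated_def)
    then obtain g where g: "\<And>x. x \<in> N \<Longrightarrow> g x \<in> F \<and> dist (g x) x < \<delta> / 2" by metis
    have "inj_on g N"
    proof (rule inj_onI)
      fix x y assume xy: "x \<in> N" "y \<in> N" "g x = g y"
      have "dist x y \<le> dist (g x) x + dist (g y) y"
        using dist_triangle[of x y "g x"] xy by (simp add: dist_commute)
      also have "\<dots> < \<delta>" using g[OF xy(1)] g[OF xy(2)] by linarith
      finally show "x = y" using that xy(1,2) by (force simp: sep_def separated_def)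
    qed
    moreover have "g ` N \<subseteq> F" using g by auto
    ultimately show ?thesis using F by (metis card_inj_on_le finite_imageD finite_subset)
  qed
  define n where "n = Max (card ` {N. sep N})"
  have fin: "finite (card ` {N. sep N})"
    by (rule finite_subset[of _ "{..card F}"]) (use card in auto)
  have "sep {}" by (simp add: sep_def separated_def)
  then have "n \<in> card ` {N. sep N}" unfolding n_def using fin by (intro Max_in) auto
  then obtain N where N: "sep N" "card N = n" by auto
  have "\<exists>c\<in>N. dist x c \<le> \<delta>" if x: "x \<in> S" for x
  proof (rule ccontr)
    assume *: "\<not> (\<exists>c\<in>N. dist x c \<le> \<delta>)"
    then have "sep (insert x N)" using N x by (auto simp: sep_def separated_def dist_commute not_le intro: less_imp_le)
    then have "card (insert x N) \<le> n" unfolding n_def using fin by (intro Max_ge) auto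
    moreover have "x \<notin> N" using * assms(2) by (metis dist_self less_imp_le)
    ultimately show False using N card[of N] by simp
  qed
  then show thesis using that[of N] N card[of N] by (auto simp: sep_def)
qed

section \<open>Continuous Gaussian fields on a compact set\<close>

text \<open>What follows from the Gaussian laws and the continuity of the paths alone. The supremum and the
excursion volume are measurable with respect to the completion of the base measure.\<close>

locale continuous_gaussian_field = prob_space P for P :: "'w measure" +
  fixes T :: "'a::euclidean_space set" and f :: "'a \<Rightarrow> 'w \<Rightarrow> real"
  assumes compact_T: "compact T"
    and gaussian: "gaussian_field P T f"
    and continuous_paths: "AE \<omega> in P. continuous_on T (\<lambda>t. f t \<omega>)"
begin

abbreviation "mn t \<equiv> mean_fun P f t"
abbreviation "cov s t \<equiv> cov_fun P f s t"
abbreviation "sd t \<equiv> sd_fun P f t"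
abbreviation "exceed_prob x t \<equiv> measure P {\<omega> \<in> space P. x < f t \<omega>}"

text \<open>Three terms are all that is needed: the value at the centre of a cell and the increment between two
points. The points may coincide.\<close>

lemma gaussian_combination:
  assumes "c \<in> T" "s \<in> T" "t \<in> T"
  shows "gaussian_variable P (\<lambda>\<omega>. a * f c \<omega> + p * f s \<omega> + q * f t \<omega>)"
proof -
  define k where "k u = (if u = c then a else 0) + (if u = s then p else 0) + (if u = t then q else 0)" for u
  have "gaussian_variable P (\<lambda>\<omega>. \<Sum>u\<in>{c, s, t}. k u * f u \<omega>)"
    using gaussian[unfolded gaussian_field_def, rule_format, of "{c, s, t}" k] assms by simp
  moreover have "(\<Sum>u\<in>{c, s, t}. k u * f u \<omega>) = a * f c \<omega> + p * f s \<omega> + q * f t \<omega>" for \<omega>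
  proof -
    have "(\<Sum>u\<in>{c, s, t}. k u * f u \<omega>) = (\<Sum>u\<in>{c, s, t}. (if u = c then a * f u \<omega> else 0)
        + (if u = s then p * f u \<omega> else 0) + (if u = t then q * f u \<omega> else 0))"
      by (intro sum.cong) (auto simp: k_def algebra_simps)
    then show ?thesis by (simp add: sum.distrib sum.delta del: sum.insert)
  qed
  ultimately show ?thesis by simp
qed

lemma gaussian_value: "t \<in> T \<Longrightarrow> gaussian_variable P (f t)"
  using gaussian_combination[of t t t 1 0 0] by simp

lemma measurable_value: "t \<in> T \<Longrightarrow> f t \<in> borel_measurable P"
  using gaussian_value by (simp add: gaussian_variable_def)

lemma integrable_value: "t \<in> T \<Longrightarrow> integrable P (f t)"
  using gaussian_variable_integrable(1)[OF prob_space_axioms gaussian_value] .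

lemma integrable_centered_product:
  assumes "s \<in> T" "t \<in> T"
  shows "integrable P (\<lambda>\<omega>. (f s \<omega> - mn s) * (f t \<omega> - mn t))"
proof -
  have sq: "integrable P (\<lambda>\<omega>. (f u \<omega> - mn u)\<^sup>2)" if "u \<in> T" for u
  proof -
    have "integrable P (\<lambda>\<omega>. (f u \<omega>)\<^sup>2)" "integrable P (f u)"
      using gaussian_variable_integrable[OF prob_space_axioms gaussian_value[OF that]] by auto
    then show ?thesis by (simp add: power2_diff)
  qed
  have [measurable]: "f s \<in> borel_measurable P" "f t \<in> borel_measurable P"
    using assms measurable_value by auto
  show ?thesis
  proof (rule Bochner_Integration.integrable_bound[of P "\<lambda>\<omega>. (f s \<omega> - mn s)\<^sup>2 + (f t \<omega> - mn t)\<^sup>2"])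
    show "AE \<omega> in P. norm ((f s \<omega> - mn s) * (f t \<omega> - mn t)) \<le> norm ((f s \<omega> - mn s)\<^sup>2 + (f t \<omega> - mn t)\<^sup>2)"
    proof (rule AE_I2)
      fix \<omega>
      have "\<bar>x * y\<bar> \<le> x\<^sup>2 + y\<^sup>2" for x y :: real
      proof -
        have "2 * (\<bar>x\<bar> * \<bar>y\<bar>) \<le> x\<^sup>2 + y\<^sup>2" using sum_squares_bound[of "\<bar>x\<bar>" "\<bar>y\<bar>"] by simp
        moreover have "0 \<le> \<bar>x\<bar> * \<bar>y\<bar>" by simp
        ultimately show ?thesis unfolding abs_mult by linarith
      qed
      then show "norm ((f s \<omega> - mn s) * (f t \<omega> - mn t)) \<le> norm ((f s \<omega> - mn s)\<^sup>2 + (f t \<omega> - mn t)\<^sup>2)"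
        by simp
    qed
  qed (use sq assms in auto)
qed

lemma cov_commute: "cov s t = cov t s"
  by (simp add: cov_fun_def mult.commute)

lemma combination_expectation:
  assumes "c \<in> T" "s \<in> T" "t \<in> T"
  shows "expectation (\<lambda>\<omega>. a * f c \<omega> + p * f s \<omega> + q * f t \<omega>) = a * mn c + p * mn s + q * mn t"
  using assms integrable_value by (simp add: mean_fun_def)

lemma combination_variance:
  assumes "c \<in> T" "s \<in> T" "t \<in> T"
  shows "variance (\<lambda>\<omega>. a * f c \<omega> + p * f s \<omega> + q * f t \<omega>) =
    a\<^sup>2 * cov c c + p\<^sup>2 * cov s s + q\<^sup>2 * cov t t
      + 2 * a * p * cov c s + 2 * a * q * cov c t + 2 * p * q * cov s t"
proof -
  define g where "g u \<omega> = f u \<omega> - mn u" for u \<omega>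
  have int: "integrable P (\<lambda>\<omega>. g u \<omega> * g v \<omega>)" if "u \<in> T" "v \<in> T" for u v
    using integrable_centered_product[OF that] by (simp add: g_def)
  have e: "expectation (\<lambda>\<omega>. g u \<omega> * g v \<omega>) = cov u v" for u v
    by (simp add: g_def cov_fun_def)
  have "variance (\<lambda>\<omega>. a * f c \<omega> + p * f s \<omega> + q * f t \<omega>)
      = expectation (\<lambda>\<omega>. a\<^sup>2 * (g c \<omega> * g c \<omega>) + p\<^sup>2 * (g s \<omega> * g s \<omega>) + q\<^sup>2 * (g t \<omega> * g t \<omega>)
        + 2 * a * p * (g c \<omega> * g s \<omega>) + 2 * a * q * (g c \<omega> * g t \<omega>) + 2 * p * q * (g s \<omega> * g t \<omega>))"
    unfolding combination_expectation[OF assms]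
    by (intro Bochner_Integration.integral_cong) (auto simp: g_def power2_eq_square algebra_simps)
  also have "\<dots> = a\<^sup>2 * cov c c + p\<^sup>2 * cov s s + q\<^sup>2 * cov t t
      + 2 * a * p * cov c s + 2 * a * q * cov c t + 2 * p * q * cov s t"
    using assms int by (simp add: e)
  finally show ?thesis .
qed

lemma cov_self_nonneg: "0 \<le> cov t t"
  unfolding cov_fun_def by (intro integral_nonneg_AE) (auto simp: zero_le_square)

lemma sd_power2: "(sd t)\<^sup>2 = cov t t"
  using cov_self_nonneg by (simp add: sd_fun_def)

lemma combination_tail_le:
  assumes "c \<in> T" "s \<in> T" "t \<in> T"
    and "a * mn c + p * mn s + q * mn t \<le> m"
    and "a\<^sup>2 * cov c c + p\<^sup>2 * cov s s + q\<^sup>2 * cov t t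
      + 2 * a * p * cov c s + 2 * a * q * cov c t + 2 * p * q * cov s t \<le> V"
    and "0 < V" "m \<le> x"
  shows "measure P {\<omega> \<in> space P. x < a * f c \<omega> + p * f s \<omega> + q * f t \<omega>} \<le> gauss_tail ((x - m) / sqrt V)"
proof (rule gaussian_variable_tail_le[OF prob_space_axioms gaussian_combination[OF assms(1-3)]])
  show "expectation (\<lambda>\<omega>. a * f c \<omega> + p * f s \<omega> + q * f t \<omega>) \<le> m"
    unfolding combination_expectation[OF assms(1-3)] by fact
  show "variance (\<lambda>\<omega>. a * f c \<omega> + p * f s \<omega> + q * f t \<omega>) \<le> V"
    unfolding combination_variance[OF assms(1-3)] by fact
qed fact+

lemma exceed_prob_eq:
  assumes "t \<in> T" "0 < sd t"
  shows "exceed_prob x t = gauss_tail ((x - mn t) / sd t)"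
proof -
  have v: "variance (f t) = (sd t)\<^sup>2"
    unfolding sd_power2 by (simp add: cov_fun_def mean_fun_def power2_eq_square)
  then have "0 < variance (f t)" using assms by simp
  from gaussian_variable_tail_eq[OF prob_space_axioms gaussian_value[OF assms(1)] this]
  show ?thesis unfolding v using assms by (simp add: mean_fun_def)
qed

lemma exceed_prob_pos: "t \<in> T \<Longrightarrow> 0 < sd t \<Longrightarrow> 0 < exceed_prob x t"
  by (simp add: exceed_prob_eq gauss_tail_pos)

section \<open>Measurability of the supremum and of the excursion volume\<close>

definition dense_net :: "'a set" where
  "dense_net = (SOME D. countable D \<and> D \<subseteq> T \<and> T \<subseteq> closure D)"

lemma dense_net: "countable dense_net" "dense_net \<subseteq> T" "T \<subseteq> closure dense_net"
proof -
  obtain D where "countable D" "D \<subseteq> T" "T \<subseteq> closure D" using separable by blast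
  then have "\<exists>D. countable D \<and> D \<subseteq> T \<and> T \<subseteq> closure D" by blast
  from someI_ex[OF this]
  show "countable dense_net" "dense_net \<subseteq> T" "T \<subseteq> closure dense_net"
    unfolding dense_net_def by auto
qed

text \<open>For continuous \<open>\<phi>\<close> the condition \<open>x < \<phi> t\<close> is expressed by countably many conditions on the values
at points of a dense net. Read as a condition on the pair of path and point, the right-hand side
is jointly measurable.\<close>

lemma exceeds_iff_on_dense_net:
  fixes \<phi> :: "'a \<Rightarrow> real"
  assumes cont: "continuous_on T \<phi>" and t: "t \<in> T"
  shows "x < \<phi> t \<longleftrightarrow>
    (\<exists>k n. \<forall>q\<in>dense_net. dist q t < 1 / real (Suc n) \<longrightarrow> x + 1 / real (Suc k) \<le> \<phi> q)"
proof
  assume "x < \<phi> t"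
  then obtain k where k: "1 / real (Suc k) < (\<phi> t - x) / 2"
    using nat_approx_posE[of "(\<phi> t - x) / 2"] by auto
  have "0 < (\<phi> t - x) / 2" using \<open>x < \<phi> t\<close> by simp
  then obtain d where d: "0 < d" "\<And>q. q \<in> T \<Longrightarrow> dist q t < d \<Longrightarrow> dist (\<phi> q) (\<phi> t) < (\<phi> t - x) / 2"
    using cont t unfolding continuous_on_iff by metis
  obtain n where n: "1 / real (Suc n) < d" using nat_approx_posE[OF d(1)] by auto
  have "x + 1 / real (Suc k) \<le> \<phi> q" if "q \<in> dense_net" "dist q t < 1 / real (Suc n)" for q
  proof -
    have "dist q t < d" using that(2) n by linarith
    then have "\<bar>\<phi> q - \<phi> t\<bar> < (\<phi> t - x) / 2" using d(2)[of q] that(1) dense_net(2) by (auto simp: dist_real_def)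
    moreover have "x + e \<le> v" if "\<bar>v - u\<bar> < (u - x) / 2" "e < (u - x) / 2" for u v e :: real
      using that by argo
    ultimately show ?thesis using k by blast
  qed
  then show "\<exists>k n. \<forall>q\<in>dense_net. dist q t < 1 / real (Suc n) \<longrightarrow> x + 1 / real (Suc k) \<le> \<phi> q" by blast
next
  assume "\<exists>k n. \<forall>q\<in>dense_net. dist q t < 1 / real (Suc n) \<longrightarrow> x + 1 / real (Suc k) \<le> \<phi> q"
  then obtain k n where kn: "\<And>q. q \<in> dense_net \<Longrightarrow> dist q t < 1 / real (Suc n) \<Longrightarrow> x + 1 / real (Suc k) \<le> \<phi> q"
    by blast
  have "x + 1 / real (Suc k) \<le> \<phi> t"
  proof (rule field_le_epsilon)
    fix e :: real assume "0 < e"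
    then obtain d where d: "0 < d" "\<And>q. q \<in> T \<Longrightarrow> dist q t < d \<Longrightarrow> dist (\<phi> q) (\<phi> t) < e"
      using cont t unfolding continuous_on_iff by metis
    have "0 < min d (1 / real (Suc n))" using d by simp
    then obtain q where q: "q \<in> dense_net" "dist q t < min d (1 / real (Suc n))"
      using dense_net(3) t closure_approachable by (metis subsetD)
    then have "x + 1 / real (Suc k) \<le> \<phi> q" "\<bar>\<phi> q - \<phi> t\<bar> < e"
      using kn[of q] d(2)[of q] dense_net(2) by (auto simp: dist_real_def)
    then show "x + 1 / real (Suc k) \<le> \<phi> t + e" by linarith
  qed
  moreover have "0 < 1 / real (Suc k)" by simp
  ultimately show "x < \<phi> t" by linarith
qed

text \<open>A jointly measurable set whose sections are the excursion sets of the continuous paths.\<close>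

definition excursion_graph :: "real \<Rightarrow> ('w \<times> 'a) set" where
  "excursion_graph x = {z \<in> space (P \<Otimes>\<^sub>M lborel). snd z \<in> T \<and>
     (\<exists>k n. \<forall>q\<in>dense_net. dist q (snd z) < 1 / real (Suc n) \<longrightarrow> x + 1 / real (Suc k) \<le> f q (fst z))}"

lemma sets_excursion_graph [measurable]: "excursion_graph x \<in> sets (P \<Otimes>\<^sub>M lborel)"
proof -
  have [measurable]: "T \<in> sets borel" using compact_T by (intro borel_compact)
  have m: "{z \<in> space (P \<Otimes>\<^sub>M lborel). \<not> (dist q (snd z) < 1 / real (Suc n) \<longrightarrow> x + 1 / real (Suc k) \<le> f q (fst z))}
      \<in> sets (P \<Otimes>\<^sub>M lborel)" if "q \<in> dense_net" for q k n
  proof -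
    have [measurable]: "f q \<in> borel_measurable P" using that dense_net(2) measurable_value by auto
    show ?thesis by measurable
  qed
  have "(\<lambda>z. \<forall>q\<in>dense_net. dist q (snd z) < 1 / real (Suc n) \<longrightarrow> x + 1 / real (Suc k) \<le> f q (fst z)) \<in>
      measurable (P \<Otimes>\<^sub>M lborel) (count_space UNIV)" for k n
  proof -
    let ?R = "\<lambda>q z. dist q (snd z) < 1 / real (Suc n) \<longrightarrow> x + 1 / real (Suc k) \<le> f q (fst z)"
    let ?S = "space (P \<Otimes>\<^sub>M lborel)"
    have "?S - (\<Union>q\<in>dense_net. {z \<in> ?S. \<not> ?R q z}) \<in> sets (P \<Otimes>\<^sub>M lborel)"
      by (intro sets.Diff sets.top sets.countable_UN'' dense_net(1) m)
    also have "?S - (\<Union>q\<in>dense_net. {z \<in> ?S. \<not> ?R q z}) = {z \<in> ?S. \<forall>q\<in>dense_net. ?R q z}" by auto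
    finally show ?thesis by (simp add: pred_def)
  qed
  note [measurable] = this
  show ?thesis unfolding excursion_graph_def by measurable
qed

lemma excursion_graph_section:
  assumes "continuous_on T (\<lambda>t. f t \<omega>)" "\<omega> \<in> space P"
  shows "Pair \<omega> -` excursion_graph x = excursion_set T f x \<omega>"
  using exceeds_iff_on_dense_net[OF assms(1)] assms(2)
  by (auto simp: excursion_graph_def excursion_set_def space_pair_measure)

lemma excursion_set_borel:
  assumes "continuous_on T (\<lambda>t. f t \<omega>)" "\<omega> \<in> space P"
  shows "excursion_set T f x \<omega> \<in> sets borel"
proof -
  have "Pair \<omega> -` excursion_graph x \<in> sets lborel"
    by (rule sets_Pair1) (rule sets_excursion_graph)
  then show ?thesis using excursion_graph_section[OF assms] by simp
qed

lemma emeasure_T_finite: "emeasure lborel T < \<infinity>"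
  using emeasure_compact_finite[OF compact_T] .

lemma borel_T: "T \<in> sets borel"
  using compact_T by (rule borel_compact)

lemma completion_measurable_AE_eq:
  fixes g h :: "'w \<Rightarrow> real"
  assumes g: "g \<in> borel_measurable P" and eq: "AE \<omega> in P. h \<omega> = g \<omega>"
  shows "h \<in> borel_measurable (completion P)"
proof (rule measurableI)
  fix A :: "real set" assume A: "A \<in> sets borel"
  show "h -` A \<inter> space (completion P) \<in> sets (completion P)"
  proof (rule completion.in_sets_AE)
    show "g -` A \<inter> space P \<in> sets (completion P)"
      using g A by (intro sets_completionI_sets measurable_sets)
    have "AE \<omega> in P. (\<omega> \<in> g -` A \<inter> space P) = (\<omega> \<in> h -` A \<inter> space (completion P))"
      using eq by eventually_elim simp
    then show "AE \<omega> in completion P. (\<omega> \<in> g -` A \<inter> space P) = (\<omega> \<in> h -` A \<inter> space (completion P))"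
      by (rule AE_completion)
  qed auto
qed auto

lemma excursion_volume_measurable:
  "(\<lambda>\<omega>. measure lebesgue (excursion_set T f x \<omega>)) \<in> borel_measurable (completion P)"
proof (rule completion_measurable_AE_eq)
  show "(\<lambda>\<omega>. measure lborel (Pair \<omega> -` excursion_graph x)) \<in> borel_measurable P"
    unfolding measure_def using lborel.measurable_emeasure_Pair[OF sets_excursion_graph] by simp
  show "AE \<omega> in P. measure lebesgue (excursion_set T f x \<omega>) = measure lborel (Pair \<omega> -` excursion_graph x)"
    using continuous_paths AE_space
    by eventually_elim (simp add: excursion_graph_section excursion_set_borel)
qed

lemma exceeds_event_eq:
  "{\<omega> \<in> space P. ereal b < field_sup T f \<omega>} = {\<omega> \<in> space P. \<exists>t\<in>T. b < f t \<omega>}"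
  by (auto simp: field_sup_def less_SUP_iff)

lemma exceeds_event_sets: "{\<omega> \<in> space P. ereal b < field_sup T f \<omega>} \<in> sets (completion P)"
proof (rule completion.in_sets_AE)
  have "{\<omega> \<in> space P. b < f q \<omega>} \<in> sets P" if "q \<in> dense_net" for q
  proof -
    have [measurable]: "f q \<in> borel_measurable P" using that dense_net(2) measurable_value by auto
    show ?thesis by measurable
  qed
  then have "(\<Union>q\<in>dense_net. {\<omega> \<in> space P. b < f q \<omega>}) \<in> sets P"
    using dense_net(1) by (intro sets.countable_UN'') auto
  then show "(\<Union>q\<in>dense_net. {\<omega> \<in> space P. b < f q \<omega>}) \<in> sets (completion P)" by simp
  have "AE \<omega> in P. (\<omega> \<in> (\<Union>q\<in>dense_net. {\<omega> \<in> space P. b < f q \<omega>})) =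
      (\<omega> \<in> {\<omega> \<in> space P. ereal b < field_sup T f \<omega>})"
    using continuous_paths AE_space
  proof eventually_elim
    case (elim \<omega>)
    have "\<exists>q\<in>dense_net. b < f q \<omega>" if t: "t \<in> T" "b < f t \<omega>" for t
    proof -
      obtain k n where kn: "\<And>q. q \<in> dense_net \<Longrightarrow> dist q t < 1 / real (Suc n) \<Longrightarrow> b + 1 / real (Suc k) \<le> f q \<omega>"
        using exceeds_iff_on_dense_net[OF elim(1) t(1), of b] t(2) by blast
      have "0 < 1 / real (Suc n)" by simp
      then obtain q where q: "q \<in> dense_net" "dist q t < 1 / real (Suc n)"
        using dense_net(3) t(1) closure_approachable by (metis subsetD)
      have "0 < 1 / real (Suc k)" by simp
      with kn[OF q] have "b < f q \<omega>" by linarith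
      with q(1) show ?thesis by blast
    qed
    then show ?case using dense_net(2) elim(2) unfolding exceeds_event_eq by auto
  qed
  then show "AE \<omega> in completion P. (\<omega> \<in> (\<Union>q\<in>dense_net. {\<omega> \<in> space P. b < f q \<omega>})) =
      (\<omega> \<in> {\<omega> \<in> space P. ereal b < field_sup T f \<omega>})" by (rule AE_completion)
qed auto

lemma exceed_prob_le_tail_prob:
  assumes "t \<in> T"
  shows "exceed_prob b t \<le> tail_prob P T f b"
proof -
  interpret C: prob_space "completion P" by (rule prob_space_completion)
  have [measurable]: "f t \<in> borel_measurable P" using assms measurable_value by auto
  have s: "{\<omega> \<in> space P. b < f t \<omega>} \<in> sets P" by measurable
  have "exceed_prob b t = measure (completion P) {\<omega> \<in> space P. b < f t \<omega>}"
    using s by simp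
  also have "\<dots> \<le> measure (completion P) {\<omega> \<in> space P. ereal b < field_sup T f \<omega>}"
    using assms by (intro C.finite_measure_mono exceeds_event_sets) (auto simp: exceeds_event_eq)
  finally show ?thesis by (simp add: tail_prob_def)
qed

lemma tail_prob_antimono: "b \<le> b' \<Longrightarrow> tail_prob P T f b' \<le> tail_prob P T f b"
proof -
  interpret C: prob_space "completion P" by (rule prob_space_completion)
  show "b \<le> b' \<Longrightarrow> tail_prob P T f b' \<le> tail_prob P T f b"
    unfolding tail_prob_def
    by (intro C.finite_measure_mono exceeds_event_sets) (auto simp: exceeds_event_eq intro: le_less_trans)
qed

lemma exceed_prob_borel: "(\<lambda>t. indicator T t * exceed_prob x t) \<in> borel_measurable borel"
proof -
  interpret pair_sigma_finite P lborel ..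
  have "(\<lambda>t. emeasure P ((\<lambda>\<omega>. (\<omega>, t)) -` excursion_graph x)) \<in> borel_measurable lborel"
    by (rule measurable_emeasure_Pair2[OF sets_excursion_graph])
  then have m: "(\<lambda>t. measure P ((\<lambda>\<omega>. (\<omega>, t)) -` excursion_graph x)) \<in> borel_measurable borel"
    unfolding measure_def by simp
  have "measure P ((\<lambda>\<omega>. (\<omega>, t)) -` excursion_graph x) = exceed_prob x t" if t: "t \<in> T" for t
  proof (rule finite_measure_eq_AE)
    have [measurable]: "f t \<in> borel_measurable P" using t measurable_value by auto
    show "{\<omega> \<in> space P. x < f t \<omega>} \<in> sets P" by measurable
    show "(\<lambda>\<omega>. (\<omega>, t)) -` excursion_graph x \<in> sets P"
      by (rule sets_Pair2) (rule sets_excursion_graph)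
    show "AE \<omega> in P. (\<omega> \<in> (\<lambda>\<omega>. (\<omega>, t)) -` excursion_graph x) = (\<omega> \<in> {\<omega> \<in> space P. x < f t \<omega>})"
      using continuous_paths AE_space
    proof eventually_elim
      case (elim \<omega>)
      have "(\<omega>, t) \<in> excursion_graph x \<longleftrightarrow> t \<in> excursion_set T f x \<omega>"
        using excursion_graph_section[OF elim, of x] by blast
      then show ?case using elim t by (simp add: excursion_set_def)
    qed
  qed
  then have "(\<lambda>t. indicator T t * exceed_prob x t) =
      (\<lambda>t. indicator T t * measure P ((\<lambda>\<omega>. (\<omega>, t)) -` excursion_graph x))"
    by (auto simp: indicator_def)
  then show ?thesis using m borel_T by simp
qed

lemma exceed_prob_integrable: "integrable lborel (\<lambda>t. indicator T t * exceed_prob x t)"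
proof (rule Bochner_Integration.integrable_bound[of _ "indicator T :: 'a \<Rightarrow> real"])
  show "integrable lborel (indicator T :: 'a \<Rightarrow> real)"
    using emeasure_T_finite borel_T by (intro integrable_real_indicator) auto
qed (use exceed_prob_borel in \<open>auto simp: indicator_def\<close>)

lemma mean_excursion_volume_eq:
  "mean_excursion_volume P T f x = (\<integral>t. indicator T t * exceed_prob x t \<partial>lborel)"
  unfolding mean_excursion_volume_def set_lebesgue_integral_def
  using exceed_prob_borel[of x] by (subst integral_completion) auto

lemma mean_excursion_volume_pos:
  assumes "\<And>t. t \<in> T \<Longrightarrow> 0 < sd t" "0 < measure lebesgue T"
  shows "0 < mean_excursion_volume P T f x"
proof -
  have "mean_excursion_volume P T f x \<noteq> 0"
  proof
    assume "mean_excursion_volume P T f x = 0"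
    then have "AE t in lborel. indicator T t * exceed_prob x t = 0"
      unfolding mean_excursion_volume_eq
      by (subst (asm) integral_nonneg_eq_0_iff_AE) (auto intro: exceed_prob_integrable)
    then have "AE t in lborel. t \<notin> T"
    proof eventually_elim
      case (elim t)
      show ?case
      proof
        assume "t \<in> T"
        then have "exceed_prob x t = 0" using elim by simp
        with exceed_prob_pos[OF \<open>t \<in> T\<close> assms(1)[OF \<open>t \<in> T\<close>], of x] show False by simp
      qed
    qed
    then have "emeasure lborel T = 0"
      using borel_T by (subst (asm) AE_iff_measurable[where N=T]) auto
    then show False using assms(2) borel_T by (simp add: measure_def)
  qed
  moreover have "0 \<le> mean_excursion_volume P T f x"
    unfolding mean_excursion_volume_eq by (intro integral_nonneg_AE) auto
  ultimately show ?thesis by simp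
qed

section \<open>Moments of the estimator\<close>

text \<open>On the event \<open>M > b\<close> the density of \<open>Q\<^sub>b\<close> and the estimator are reciprocal to each other up to the
constants, so the first moment reduces to \<open>P(M > b)\<close> and the second keeps one factor
\<open>m / mes(A\<^sub>\<gamma>)\<close>. That \<open>mes(A\<^sub>\<gamma>)\<close> is positive on this event keeps the convention \<open>x / 0 = 0\<close> from
interfering.\<close>

lemma estimator_moments:
  assumes m: "0 < mean_excursion_volume P T f (gamma_level b)"
    and pos: "AE \<omega> in P. (\<exists>t\<in>T. b < f t \<omega>) \<longrightarrow> 0 < measure lebesgue (excursion_set T f (gamma_level b) \<omega>)"
    and bound: "(\<integral>\<^sup>+\<omega>. ennreal (indicator {\<omega>. \<exists>t\<in>T. b < f t \<omega>} \<omega> /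
        measure lebesgue (excursion_set T f (gamma_level b) \<omega>)) \<partial>P) \<le> ennreal B" and "0 \<le> B"
  shows "integrable (Q_measure P T f b) (Z_estimator P T f b)"
    "(\<integral>\<omega>. Z_estimator P T f b \<omega> \<partial>Q_measure P T f b) = tail_prob P T f b"
    "integrable (Q_measure P T f b) (\<lambda>\<omega>. (Z_estimator P T f b \<omega>)\<^sup>2)"
    "(\<integral>\<omega>. (Z_estimator P T f b \<omega>)\<^sup>2 \<partial>Q_measure P T f b)
      \<le> mean_excursion_volume P T f (gamma_level b) * B"
proof -
  interpret C: prob_space "completion P" by (rule prob_space_completion)
  define V where "V \<omega> = measure lebesgue (excursion_set T f (gamma_level b) \<omega>)" for \<omega>
  define m where "m = mean_excursion_volume P T f (gamma_level b)"
  define E where "E = {\<omega> \<in> space P. ereal b < field_sup T f \<omega>}"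
  define I where "I \<omega> = (indicator {\<omega>. ereal b < field_sup T f \<omega>} \<omega> :: real)" for \<omega>
  have m0: "0 < m" using m by (simp add: m_def)
  have V0: "0 \<le> V \<omega>" for \<omega> by (simp add: V_def)
  have [measurable]: "V \<in> borel_measurable (completion P)"
    unfolding V_def by (rule excursion_volume_measurable)
  have E [measurable]: "E \<in> sets (completion P)" unfolding E_def by (rule exceeds_event_sets)
  have IE: "I \<omega> = indicator E \<omega>" if "\<omega> \<in> space P" for \<omega>
    using that by (auto simp: I_def E_def indicator_def)
  have [measurable]: "I \<in> borel_measurable (completion P)"
    by (subst measurable_cong[where g="indicator E"]) (auto simp: IE)
  have Z: "Z_estimator P T f b \<omega> = I \<omega> * (m / V \<omega>)" for \<omega>
    by (simp add: Z_estimator_def I_def V_def m_def)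
  have Q: "Q_measure P T f b = density (completion P) (\<lambda>\<omega>. ennreal (V \<omega> / m))"
    by (simp add: Q_measure_def V_def m_def)
  have g: "(\<lambda>\<omega>. V \<omega> / m) \<in> borel_measurable (completion P)" "AE \<omega> in completion P. 0 \<le> V \<omega> / m"
    using V0 m0 by auto
  have Vpos: "AE \<omega> in completion P. I \<omega> \<noteq> 0 \<longrightarrow> 0 < V \<omega>"
  proof (rule AE_completion)
    show "AE \<omega> in P. I \<omega> \<noteq> 0 \<longrightarrow> 0 < V \<omega>"
      using pos AE_space
      by eventually_elim (auto simp: I_def V_def indicator_def field_sup_def less_SUP_iff split: if_splits)
  qed
  have I01: "I \<omega> = 0 \<or> I \<omega> = 1" for \<omega> by (auto simp: I_def indicator_def)
  have eq1: "AE \<omega> in completion P. (V \<omega> / m) * Z_estimator P T f b \<omega> = indicator E \<omega>"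
    using Vpos AE_space
  proof eventually_elim
    case (elim \<omega>)
    then show ?case using I01[of \<omega>] m0 IE[of \<omega>] by (auto simp: Z)
  qed
  have eq2: "AE \<omega> in completion P. (V \<omega> / m) * (Z_estimator P T f b \<omega>)\<^sup>2 = m * (I \<omega> / V \<omega>)"
    using Vpos
  proof eventually_elim
    case (elim \<omega>)
    then show ?case using I01[of \<omega>] m0 by (auto simp: Z power2_eq_square)
  qed
  have Zm [measurable]: "Z_estimator P T f b \<in> borel_measurable (completion P)"
    unfolding Z[abs_def] by measurable
  have "integrable (completion P) (\<lambda>\<omega>. (V \<omega> / m) * Z_estimator P T f b \<omega>) \<longleftrightarrow>
      integrable (completion P) (indicator E :: 'w \<Rightarrow> real)"
    using eq1 by (intro integrable_cong_AE) auto
  also have "\<dots>" by (intro integrable_real_indicator) (auto simp: C.emeasure_eq_measure)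
  finally show "integrable (Q_measure P T f b) (Z_estimator P T f b)"
    unfolding Q using integrable_real_density[OF g Zm] by simp
  have "(\<integral>\<omega>. Z_estimator P T f b \<omega> \<partial>Q_measure P T f b) = (\<integral>\<omega>. (V \<omega> / m) * Z_estimator P T f b \<omega> \<partial>completion P)"
    unfolding Q by (rule integral_real_density[OF g Zm])
  also have "\<dots> = (\<integral>\<omega>. indicator E \<omega> \<partial>completion P)"
    using eq1 by (intro integral_cong_AE) auto
  also have "\<dots> = measure (completion P) E"
    using sets.sets_into_space[OF E] by (simp add: Int_absorb2)
  also have "\<dots> = tail_prob P T f b"
    by (simp add: tail_prob_def E_def)
  finally show "(\<integral>\<omega>. Z_estimator P T f b \<omega> \<partial>Q_measure P T f b) = tail_prob P T f b" .
  have nn: "(\<integral>\<^sup>+\<omega>. ennreal (I \<omega> / V \<omega>) \<partial>completion P) \<le> ennreal B"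
    using bound unfolding nn_integral_completion
    by (simp add: I_def V_def field_sup_def less_SUP_iff)
  have int: "integrable (completion P) (\<lambda>\<omega>. I \<omega> / V \<omega>)"
  proof (rule integrableI_nonneg)
    show "AE \<omega> in completion P. 0 \<le> I \<omega> / V \<omega>"
      using V0 I01 by (intro AE_I2) (metis divide_nonneg_nonneg zero_le_one order_refl)
    show "(\<integral>\<^sup>+\<omega>. ennreal (I \<omega> / V \<omega>) \<partial>completion P) < \<infinity>"
      using nn by (rule le_less_trans) simp
  qed measurable
  have intle: "(\<integral>\<omega>. I \<omega> / V \<omega> \<partial>completion P) \<le> B"
  proof -
    have "AE \<omega> in completion P. 0 \<le> I \<omega> / V \<omega>"
      using V0 I01 by (intro AE_I2) (metis divide_nonneg_nonneg zero_le_one order_refl)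
    then have "ennreal (\<integral>\<omega>. I \<omega> / V \<omega> \<partial>completion P) = (\<integral>\<^sup>+\<omega>. ennreal (I \<omega> / V \<omega>) \<partial>completion P)"
      using nn_integral_eq_integral[OF int] by simp
    with nn have "ennreal (\<integral>\<omega>. I \<omega> / V \<omega> \<partial>completion P) \<le> ennreal B" by (simp only:)
    then show ?thesis unfolding ennreal_le_iff[OF \<open>0 \<le> B\<close>] .
  qed
  have "integrable (completion P) (\<lambda>\<omega>. (V \<omega> / m) * (Z_estimator P T f b \<omega>)\<^sup>2) \<longleftrightarrow>
      integrable (completion P) (\<lambda>\<omega>. m * (I \<omega> / V \<omega>))"
    using eq2 by (intro integrable_cong_AE) auto
  also have "\<dots>" using int by (rule integrable_mult_right)
  finally show "integrable (Q_measure P T f b) (\<lambda>\<omega>. (Z_estimator P T f b \<omega>)\<^sup>2)"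
    unfolding Q using integrable_real_density[OF g, of "\<lambda>\<omega>. (Z_estimator P T f b \<omega>)\<^sup>2"] by simp
  have "(\<integral>\<omega>. (Z_estimator P T f b \<omega>)\<^sup>2 \<partial>Q_measure P T f b) = (\<integral>\<omega>. (V \<omega> / m) * (Z_estimator P T f b \<omega>)\<^sup>2 \<partial>completion P)"
    unfolding Q by (rule integral_real_density[OF g]) measurable
  also have "\<dots> = (\<integral>\<omega>. m * (I \<omega> / V \<omega>) \<partial>completion P)"
    using eq2 by (intro integral_cong_AE) auto
  also have "\<dots> = m * (\<integral>\<omega>. I \<omega> / V \<omega> \<partial>completion P)" by (rule integral_mult_right_zero)
  also have "\<dots> \<le> m * B" using intle m0 by simp
  finally show "(\<integral>\<omega>. (Z_estimator P T f b \<omega>)\<^sup>2 \<partial>Q_measure P T f b)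
      \<le> mean_excursion_volume P T f (gamma_level b) * B"
    by (simp add: m_def)
qed

end

section \<open>Chaining\<close>

text \<open>The point \<open>x\<close> is reached from \<open>p\<close> through points of finer and finer nets. Links up to three times
the mesh are allowed, so that the chain may start at any net point within twice the mesh of \<open>x\<close>; two
nearby points can then use the same starting point.\<close>

lemma chain_increment_le:
  fixes \<phi> :: "'a::metric_space \<Rightarrow> real"
  assumes cont: "continuous_on S \<phi>"
    and NS: "\<And>n. N n \<subseteq> S" and net: "\<And>n x. x \<in> S \<Longrightarrow> \<exists>p\<in>N n. dist x p \<le> D / 2 ^ n"
    and link: "\<And>n p q. p \<in> N n \<Longrightarrow> q \<in> N (Suc n) \<Longrightarrow> dist p q \<le> 3 * (D / 2 ^ n) \<Longrightarrow> \<bar>\<phi> p - \<phi> q\<bar> \<le> \<tau> n"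
    and \<tau>: "\<And>n. 0 \<le> \<tau> n" "summable \<tau>"
    and x: "x \<in> S" and p: "p \<in> N k" "dist p x \<le> 2 * (D / 2 ^ k)"
  shows "\<bar>\<phi> x - \<phi> p\<bar> \<le> (\<Sum>n. \<tau> (n + k))"
proof -
  obtain g0 where g0: "\<And>n. g0 n \<in> N n" "\<And>n. dist x (g0 n) \<le> D / 2 ^ n"
    using net[OF x] by metis
  define g where "g n = (if n = 0 then p else g0 (k + n))" for n
  have gN: "g n \<in> N (k + n)" for n using p g0 by (auto simp: g_def)
  have D: "0 \<le> D" using order_trans[OF zero_le_dist g0(2)[of 0]] by simp
  have gd: "dist x (g n) \<le> 2 * (D / 2 ^ (k + n))" for n
  proof (cases "n = 0")
    case True then show ?thesis using p by (simp add: g_def dist_commute)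
  next
    case False
    have "dist x (g n) \<le> D / 2 ^ (k + n)" using False g0(2)[of "k + n"] by (simp add: g_def)
    also have "\<dots> \<le> 2 * (D / 2 ^ (k + n))"
      using divide_nonneg_nonneg[OF D, of "2 ^ (k + n)"] by simp
    finally show ?thesis .
  qed
  have step: "\<bar>\<phi> (g n) - \<phi> (g (Suc n))\<bar> \<le> \<tau> (k + n)" for n
  proof (rule link)
    show "g n \<in> N (k + n)" using gN .
    show "g (Suc n) \<in> N (Suc (k + n))" using gN[of "Suc n"] by simp
    have "dist x (g (Suc n)) \<le> D / 2 ^ (k + Suc n)"
      using g0(2)[of "k + Suc n"] by (simp add: g_def)
    then have "dist (g n) (g (Suc n)) \<le> 2 * (D / 2 ^ (k + n)) + D / 2 ^ (k + Suc n)"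
      using dist_triangle3[of "g n" "g (Suc n)" x] gd[of n] by linarith
    also have "\<dots> \<le> 3 * (D / 2 ^ (k + n))" using D by (simp add: field_simps)
    finally show "dist (g n) (g (Suc n)) \<le> 3 * (D / 2 ^ (k + n))" .
  qed
  have sumk: "summable (\<lambda>n. \<tau> (n + k))" using \<tau>(2) by (simp add: summable_iff_shift)
  have partial: "\<bar>\<phi> (g n) - \<phi> p\<bar> \<le> (\<Sum>n. \<tau> (n + k))" for n
  proof -
    have "\<bar>\<phi> (g n) - \<phi> p\<bar> \<le> (\<Sum>i<n. \<tau> (k + i))"
    proof (induction n)
      case (Suc n)
      then show ?case using step[of n] by simp
    qed (simp add: g_def)
    also have "\<dots> = (\<Sum>i<n. \<tau> (i + k))" by (simp add: add.commute)
    also have "\<dots> \<le> (\<Sum>n. \<tau> (n + k))"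
      using sumk \<tau>(1) by (intro sum_le_suminf) auto
    finally show ?thesis .
  qed
  have "(\<lambda>n. 2 * (D / 2 ^ (k + n))) \<longlonglongrightarrow> 0"
  proof -
    have "(\<lambda>n. (2 * D / 2 ^ k) * (1 / 2) ^ n) \<longlonglongrightarrow> (2 * D / 2 ^ k) * 0"
      by (intro tendsto_mult tendsto_const LIMSEQ_power_zero) auto
    then show ?thesis by (simp add: power_add power_divide)
  qed
  then have "(\<lambda>n. dist (g n) x) \<longlonglongrightarrow> 0"
    by (rule tendsto_sandwich[OF _ _ tendsto_const, rotated 2])
      (use gd in \<open>auto simp: dist_commute\<close>)
  then have "g \<longlonglongrightarrow> x" by (subst tendsto_dist_iff)
  then have "(\<lambda>n. \<phi> (g n)) \<longlonglongrightarrow> \<phi> x"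
    by (rule continuous_on_tendsto_compose[OF cont _ x]) (use gN NS in \<open>blast intro: always_eventually\<close>)
  then have "(\<lambda>n. \<bar>\<phi> (g n) - \<phi> p\<bar>) \<longlonglongrightarrow> \<bar>\<phi> x - \<phi> p\<bar>"
    by (intro tendsto_intros)
  then show ?thesis by (rule LIMSEQ_le_const2) (use partial in auto)
qed

text \<open>The tolerances are normalised such that those from level \<open>k\<close> on add up to half of
\<open>2 powr (- k \<theta> / 2)\<close>. Their exponent \<open>\<theta> / 2\<close> is half of that of the standard deviation of
an increment, so the ratio of tolerance to standard deviation grows geometrically with the level.\<close>

definition chain_tol :: "real \<Rightarrow> nat \<Rightarrow> real" where
  "chain_tol \<theta> n = (1 - 2 powr (- \<theta> / 2)) / 2 * 2 powr (- (real n * \<theta> / 2))"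

lemma chain_tol_pos: "0 < \<theta> \<Longrightarrow> 0 < chain_tol \<theta> n"
  using powr_less_mono[of "- \<theta> / 2" 0 2] by (simp add: chain_tol_def)

lemma chain_tol_sums:
  assumes "0 < \<theta>"
  shows "(\<lambda>n. chain_tol \<theta> (n + k)) sums (2 powr (- (real k * \<theta> / 2)) / 2)"
proof -
  define w where "w = 2 powr (- \<theta> / 2)"
  have w: "0 < w" "w < 1" using powr_less_mono[of "- \<theta> / 2" 0 2] assms by (auto simp: w_def)
  have pw: "2 powr (- (real n * \<theta> / 2)) = w ^ n" for n
  proof -
    have "w ^ n = w powr real n" using w by (simp add: powr_realpow)
    also have "\<dots> = 2 powr (- (real n * \<theta> / 2))"
      unfolding w_def powr_powr by (rule arg_cong[where f="\<lambda>z. 2 powr z"]) simp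
    finally show ?thesis by simp
  qed
  have "(\<lambda>n. (1 - w) / 2 * w ^ k * w ^ n) sums ((1 - w) / 2 * w ^ k * (1 / (1 - w)))"
    using w by (intro sums_mult geometric_sums) auto
  moreover have "u / 2 * W * (1 / u) = W / 2" if "u \<noteq> 0" for u W :: real using that by simp
  then have "(1 - w) / 2 * w ^ k * (1 / (1 - w)) = w ^ k / 2" using w by (metis diff_gt_0_iff_gt less_irrefl)
  moreover have "(1 - w) / 2 * w ^ k * w ^ n = chain_tol \<theta> (n + k)" for n
    unfolding chain_tol_def pw w_def[symmetric] by (simp add: power_add)
  ultimately show ?thesis by (simp only: pw)
qed

lemma chained_oscillation:
  fixes \<phi> :: "'a::metric_space \<Rightarrow> real"
  assumes cont: "continuous_on S \<phi>"
    and NS: "\<And>n. N n \<subseteq> S" and net: "\<And>n x. x \<in> S \<Longrightarrow> \<exists>p\<in>N n. dist x p \<le> D / 2 ^ n"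
    and link: "\<And>n p q. p \<in> N n \<Longrightarrow> q \<in> N (Suc n) \<Longrightarrow> dist p q \<le> 3 * (D / 2 ^ n) \<Longrightarrow>
      \<bar>\<phi> p - \<phi> q\<bar> \<le> J * chain_tol \<theta> n"
    and "0 \<le> J" "0 < \<theta>" and x: "x \<in> S" "y \<in> S" and d: "dist x y \<le> D / 2 ^ k"
  shows "\<bar>\<phi> x - \<phi> y\<bar> \<le> J * 2 powr (- (real k * \<theta> / 2))"
proof -
  have s: "(\<lambda>n. J * chain_tol \<theta> (n + k)) sums (J * (2 powr (- (real k * \<theta> / 2)) / 2))"
    using chain_tol_sums[OF \<open>0 < \<theta>\<close>] by (rule sums_mult)
  have s0: "summable (\<lambda>n. J * chain_tol \<theta> n)"
    using chain_tol_sums[OF \<open>0 < \<theta>\<close>, of 0] by (intro summable_mult) (auto simp: sums_iff)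
  obtain p where p: "p \<in> N k" "dist x p \<le> D / 2 ^ k" using net[OF x(1)] by blast
  have D: "0 \<le> D / 2 ^ k" using d zero_le_dist[of x y] by linarith
  have "dist p y \<le> 2 * (D / 2 ^ k)"
    using dist_triangle[of p y x] p(2) d by (simp add: dist_commute)
  moreover have "dist p x \<le> 2 * (D / 2 ^ k)" using p(2) D by (simp add: dist_commute)
  moreover have "\<bar>\<phi> z - \<phi> p\<bar> \<le> J * (2 powr (- (real k * \<theta> / 2)) / 2)"
    if z: "z \<in> S" "dist p z \<le> 2 * (D / 2 ^ k)" for z
  proof -
    have "\<bar>\<phi> z - \<phi> p\<bar> \<le> (\<Sum>n. J * chain_tol \<theta> (n + k))"
      by (rule chain_increment_le[where \<tau>="\<lambda>n. J * chain_tol \<theta> n", OF cont NS net link _ s0 z(1) p(1) z(2)])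
        (use \<open>0 \<le> J\<close> chain_tol_pos[OF \<open>0 < \<theta>\<close>] in \<open>auto intro: mult_nonneg_nonneg less_imp_le\<close>)
    then show ?thesis using s by (simp add: sums_iff)
  qed
  ultimately have "\<bar>\<phi> x - \<phi> p\<bar> \<le> J * (2 powr (- (real k * \<theta> / 2)) / 2)"
    "\<bar>\<phi> y - \<phi> p\<bar> \<le> J * (2 powr (- (real k * \<theta> / 2)) / 2)"
    using x by blast+
  then show ?thesis by linarith
qed

text \<open>The level at which an oscillation of size \<open>y\<close> has been damped to one.\<close>

lemma exists_dyadic_level:
  assumes "0 < \<theta>" "1 \<le> y"
  obtains k :: nat where "y * 2 powr (- (real k * \<theta> / 2)) \<le> 1" "2 ^ k \<le> 2 * y powr (2 / \<theta>)"
proof -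
  define z where "z = log 2 y * 2 / \<theta>"
  have z0: "0 \<le> z" using assms by (simp add: z_def zero_le_log_cancel_iff)
  define k where "k = nat \<lceil>z\<rceil>"
  have k: "z \<le> real k" "real k < z + 1" using z0 by (auto simp: k_def) linarith+
  have y: "y = 2 powr (z * \<theta> / 2)" using assms by (simp add: z_def)
  have "y * 2 powr (- (real k * \<theta> / 2)) = 2 powr ((z - real k) * \<theta> / 2)"
    unfolding y powr_add[symmetric] by (rule arg_cong[where f="\<lambda>u. 2 powr u"]) (simp add: field_simps)
  also have "\<dots> \<le> 2 powr 0"
    using k assms by (intro powr_mono) (auto simp: mult_nonpos_nonneg)
  finally have 1: "y * 2 powr (- (real k * \<theta> / 2)) \<le> 1" by simp
  have "(2::real) ^ k = 2 powr real k" by (simp add: powr_realpow)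
  also have "\<dots> \<le> 2 powr (z + 1)" using k by (intro powr_mono) auto
  also have "\<dots> = 2 * y powr (2 / \<theta>)"
    unfolding y powr_powr using assms by (simp add: powr_add)
  finally show thesis using that 1 by blast
qed

text \<open>The coarsest net is the centre alone. Thus the chains also compare the field with its value at
\<open>c\<close>.\<close>

lemma dyadic_nets:
  fixes S :: "'a::euclidean_space set"
  assumes "compact S" "0 < D" "c \<in> S" "S \<subseteq> cball c D"
  obtains N where "N (0::nat) = {c}" "\<And>n. finite (N n)" "\<And>n. N n \<subseteq> S"
    "\<And>n x. x \<in> S \<Longrightarrow> \<exists>p\<in>N n. dist x p \<le> D / 2 ^ n"
    "\<And>n. real (card (N n)) \<le> (3 * 2 ^ n) ^ DIM('a)"
proof -
  have "\<exists>M. finite M \<and> M \<subseteq> S \<and> separated (D / 2 ^ n) M \<and>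
      (\<forall>x\<in>S. \<exists>p\<in>M. dist x p \<le> D / 2 ^ n)" for n :: nat
  proof -
    have "0 < D / 2 ^ n" using assms(2) by simp
    from compact_separated_net[OF assms(1) this] show ?thesis by metis
  qed
  then obtain M where M: "\<And>n::nat. finite (M n)" "\<And>n. M n \<subseteq> S"
    "\<And>n. separated (D / 2 ^ n) (M n)"
    "\<And>n x. x \<in> S \<Longrightarrow> \<exists>p\<in>M n. dist x p \<le> D / 2 ^ n" by metis
  define N where "N n = (if n = 0 then {c} else M n)" for n
  show thesis
  proof (rule that[of N])
    show "\<exists>p\<in>N n. dist x p \<le> D / 2 ^ n" if "x \<in> S" for n x
      using M(4)[OF that] assms(4) that by (auto simp: N_def dist_commute)
    show "real (card (N n)) \<le> (3 * 2 ^ n) ^ DIM('a)" for n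
    proof (cases "n = 0")
      case False
      have "N n \<subseteq> cball c (2 ^ n * (D / 2 ^ n))" using M(2) assms(4) False by (auto simp: N_def)
      then have "real (card (N n)) \<le> (2 * 2 ^ n + 1) ^ DIM('a)"
        using M False assms(2) by (intro separated_card_ball[where \<rho>="D / 2 ^ n" and p=c]) (auto simp: N_def)
      also have "\<dots> \<le> (3 * 2 ^ n) ^ DIM('a)" by (intro power_mono) auto
      finally show ?thesis .
    qed (simp add: N_def)
  qed (use M assms in \<open>auto simp: N_def\<close>)
qed

text \<open>The bound for the probability that an increment at level \<open>n\<close> exceeds \<open>j\<close> times its tolerance.\<close>

definition chain_weight :: "real \<Rightarrow> real \<Rightarrow> nat \<Rightarrow> nat \<Rightarrow> real" where
  "chain_weight a \<theta> j n = exp (- a * real j * 2 powr (real n * \<theta> / 2))"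

text \<open>The weights, summed over all links of all levels, decay in the excess \<open>Suc i\<close> faster than any power.
The factors \<open>(3 * 2 ^ n) ^ d\<close> count the points of consecutive nets, and \<open>2\<close> the signs of an
increment.\<close>

lemma chaining_series_bound:
  fixes a \<theta> :: real and d p :: nat
  assumes "0 < a" "0 < \<theta>"
  obtains C where "0 < C" "\<And>i. summable (\<lambda>n. 2 * (3 * 2 ^ n) ^ d * (3 * 2 ^ Suc n) ^ d * chain_weight a \<theta> (Suc i) n)"
    "\<And>i. (\<Sum>n. 2 * (3 * 2 ^ n) ^ d * (3 * 2 ^ Suc n) ^ d * chain_weight a \<theta> (Suc i) n)
      \<le> C * real (Suc i) powr (- (real p + 2))"
proof -
  define q where "q = max (real p + 2) (2 * (2 * real d + 1) / \<theta>)"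
  have q0: "0 \<le> q" by (simp add: q_def)
  obtain K where K: "0 < K" "\<And>z. 1 \<le> z \<Longrightarrow> exp (- a * z) \<le> K * z powr (- q)"
    using exp_neg_le_powr[OF assms(1) q0] by blast
  define t where "t i n = 2 * (3 * 2 ^ n) ^ d * (3 * 2 ^ Suc n) ^ d * chain_weight a \<theta> (Suc i) n" for i n :: nat
  define B where "B i = 2 * 18 ^ d * K * real (Suc i) powr (- (real p + 2))" for i
  have B0: "0 \<le> B i" for i using K by (simp add: B_def)
  have t_le: "t i n \<le> B i * (1 / 2) ^ n" for i n
  proof -
    define y where "y = 2 powr (real n * \<theta> / 2)"
    have y: "1 \<le> y" using assms by (simp add: y_def ge_one_powr_ge_zero)
    have z: "1 \<le> real (Suc i) * y" using mult_mono[of 1 "real (Suc i)" 1 y] y by simp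
    have "exp (- a * real (Suc i) * y) \<le> K * (real (Suc i) * y) powr (- q)"
      using K(2)[OF z] by (simp add: mult.assoc)
    also have "\<dots> = K * (real (Suc i) powr (- q) * y powr (- q))"
      using y by (simp add: powr_mult)
    also have "\<dots> \<le> K * (real (Suc i) powr (- (real p + 2)) * y powr (- (2 * (2 * real d + 1) / \<theta>)))"
      using K y by (intro mult_left_mono mult_mono powr_mono) (auto simp: q_def)
    also have "y powr (- (2 * (2 * real d + 1) / \<theta>)) = 2 powr (- (real n * (2 * real d + 1)))"
      unfolding y_def powr_powr using assms by (intro arg_cong[where f="\<lambda>u. 2 powr u"]) (simp add: field_simps)
    also have "2 powr (- (real n * (2 * real d + 1))) = 1 / (4 ^ (n * d) * 2 ^ n)"
    proof -
      have "- (real n * (2 * real d + 1)) = - real (2 * (n * d) + n)" by (simp add: algebra_simps)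
      then have "2 powr (- (real n * (2 * real d + 1))) = 1 / 2 powr (real (2 * (n * d) + n))"
        by (simp only: powr_minus_divide)
      also have "\<dots> = 1 / (2 ^ (2 * (n * d) + n))" by (subst powr_realpow) auto
      finally show ?thesis by (simp add: power_add power_mult)
    qed
    finally have e: "exp (- a * real (Suc i) * y) \<le> K * (real (Suc i) powr (- (real p + 2)) * (1 / (4 ^ (n * d) * 2 ^ n)))" .
    have pre: "2 * (3 * 2 ^ n) ^ d * (3 * 2 ^ Suc n) ^ d = 2 * 18 ^ d * (4::real) ^ (n * d)"
    proof -
      have "(3 * 2 ^ n) ^ d * (3 * 2 ^ Suc n) ^ d = (18 * (4::real) ^ n) ^ d"
      proof -
        have "(4::real) ^ n = 2 ^ n * 2 ^ n" using power_mult_distrib[of "2::real" 2 n] by simp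
        then have "(3 * 2 ^ n) * (3 * 2 ^ Suc n) = 18 * (4::real) ^ n" by simp
        then show ?thesis by (metis power_mult_distrib)
      qed
      then show ?thesis by (simp add: power_mult_distrib power_mult mult.assoc)
    qed
    have "t i n \<le> 2 * 18 ^ d * (4::real) ^ (n * d) * (K * (real (Suc i) powr (- (real p + 2)) * (1 / (4 ^ (n * d) * 2 ^ n))))"
      unfolding t_def pre chain_weight_def y_def[symmetric] using e by (intro mult_left_mono) auto
    also have "\<dots> = B i * (1 / 2) ^ n" by (simp add: B_def power_divide)
    finally show ?thesis .
  qed
  have geo: "(\<lambda>n. B i * (1 / 2) ^ n) sums (B i * 2)" for i
    using geometric_sums[of "1/2::real"] by (intro sums_mult) auto
  have t0: "0 \<le> t i n" for i n by (simp add: t_def chain_weight_def)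
  have sum_t: "summable (t i)" for i
    by (rule summable_comparison_test'[of "\<lambda>n. B i * (1 / 2) ^ n" 0]) (use geo t_le t0 in \<open>auto simp: sums_iff\<close>)
  show thesis
  proof (rule that[of "4 * 18 ^ d * K"])
    fix i
    show "summable (\<lambda>n. 2 * (3 * 2 ^ n) ^ d * (3 * 2 ^ Suc n) ^ d * chain_weight a \<theta> (Suc i) n)"
      using sum_t[of i] unfolding t_def[abs_def] .
    have "(\<Sum>n. t i n) \<le> (\<Sum>n. B i * (1 / 2) ^ n)"
      using geo sum_t t_le by (intro suminf_le) (auto simp: sums_iff)
    also have "\<dots> = B i * 2" using geo by (simp add: sums_iff)
    finally show "(\<Sum>n. 2 * (3 * 2 ^ n) ^ d * (3 * 2 ^ Suc n) ^ d * chain_weight a \<theta> (Suc i) n)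
      \<le> 4 * 18 ^ d * K * real (Suc i) powr (- (real p + 2))"
      unfolding t_def[abs_def] by (simp add: B_def)
  qed (use K in auto)
qed

section \<open>Excursion volume in one cell\<close>

text \<open>The volume condition on \<open>T\<close> with the volume of the unit ball absorbed in the constant.\<close>

definition ball_volume_bound :: "'a::euclidean_space set \<Rightarrow> real \<Rightarrow> real \<Rightarrow> bool" where
  "ball_volume_bound T \<kappa> \<epsilon>0 \<longleftrightarrow>
     (\<forall>\<epsilon> t. 0 < \<epsilon> \<longrightarrow> \<epsilon> < \<epsilon>0 \<longrightarrow> t \<in> T \<longrightarrow> \<kappa> * \<epsilon> ^ DIM('a) \<le> measure lebesgue (ball t \<epsilon> \<inter> T))"

text \<open>Suppose that all links obey \<open>y\<close> times the tolerance, in units of \<open>\<epsilon>\<close>. Over the whole cell the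
function then oscillates by at most \<open>y \<epsilon>\<close>, which controls the centre, and over the distance
\<open>\<rho> / (2 y powr (2 / \<theta>))\<close> by at most \<open>\<epsilon>\<close>, so that a point above \<open>\<beta>\<close> has a ball of this radius around
it on which the function stays above \<open>\<beta> - \<epsilon>\<close>.\<close>

lemma excursion_volume_ge:
  fixes \<phi> :: "'a::euclidean_space \<Rightarrow> real"
  assumes \<kappa>: "0 < \<kappa>"
    and dens: "ball_volume_bound T \<kappa> \<epsilon>0"
    and T: "compact T" and borel: "{t \<in> T. x < \<phi> t} \<in> sets borel" and cont: "continuous_on T \<phi>"
    and \<rho>: "0 < \<rho>" "\<rho> < \<epsilon>0" and c: "c \<in> T" and \<theta>: "0 < \<theta>"
    and NS: "\<And>n. N n \<subseteq> T \<inter> cball c (2 * \<rho>)"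
    and net: "\<And>n x. x \<in> T \<inter> cball c (2 * \<rho>) \<Longrightarrow> \<exists>p\<in>N n. dist x p \<le> 2 * \<rho> / 2 ^ n"
    and link: "\<And>n p q. p \<in> N n \<Longrightarrow> q \<in> N (Suc n) \<Longrightarrow> dist p q \<le> 3 * (2 * \<rho> / 2 ^ n) \<Longrightarrow>
      \<bar>\<phi> p - \<phi> q\<bar> \<le> y * \<epsilon> * chain_tol \<theta> n"
    and "0 < \<epsilon>" "1 \<le> y" and t0: "t0 \<in> T" "dist c t0 \<le> \<rho>" "\<beta> < \<phi> t0" and x: "x \<le> \<beta> - \<epsilon>"
  shows "\<beta> - y * \<epsilon> < \<phi> c"
    and "\<kappa> * (\<rho> / (2 * y powr (2 / \<theta>))) ^ DIM('a) \<le> measure lebesgue {t \<in> T. x < \<phi> t}"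
proof -
  have y\<epsilon>: "0 \<le> y * \<epsilon>" using \<open>0 < \<epsilon>\<close> \<open>1 \<le> y\<close> by simp
  have cont': "continuous_on (T \<inter> cball c (2 * \<rho>)) \<phi>" using cont by (rule continuous_on_subset) auto
  have osc: "\<bar>\<phi> s - \<phi> t\<bar> \<le> y * \<epsilon> * 2 powr (- (real k * \<theta> / 2))"
    if "s \<in> T \<inter> cball c (2 * \<rho>)" "t \<in> T \<inter> cball c (2 * \<rho>)" "dist s t \<le> 2 * \<rho> / 2 ^ k" for s t k
    by (rule chained_oscillation[OF cont' NS net link y\<epsilon> \<theta> that])
  have t0': "t0 \<in> T \<inter> cball c (2 * \<rho>)" using t0 \<rho> by auto
  have "\<bar>\<phi> t0 - \<phi> c\<bar> \<le> y * \<epsilon> * 2 powr (- (real 0 * \<theta> / 2))"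
    using t0' c \<rho> t0(2) by (intro osc) (auto simp: dist_commute)
  then show "\<beta> - y * \<epsilon> < \<phi> c" using t0(3) by simp
  \<comment> \<open>The radius belongs to level \<open>Suc k\<close> instead of \<open>k\<close>: it is then at most \<open>\<rho>\<close>, and the ball stays in the region covered by the nets.\<close>
  obtain k :: nat where k: "y * 2 powr (- (real k * \<theta> / 2)) \<le> 1" "2 ^ k \<le> 2 * y powr (2 / \<theta>)"
    using exists_dyadic_level[OF \<theta> \<open>1 \<le> y\<close>] by blast
  define r where "r = \<rho> / 2 ^ k"
  have r: "0 < r" "r \<le> \<rho>" using \<rho> by (auto simp: r_def field_simps)
  have small: "y * \<epsilon> * 2 powr (- (real (Suc k) * \<theta> / 2)) \<le> \<epsilon>"
  proof -
    have "2 powr (- (real (Suc k) * \<theta> / 2)) \<le> 2 powr (- (real k * \<theta> / 2))"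
      using \<theta> by (intro powr_mono) (auto simp: mult_right_mono)
    then have "y * \<epsilon> * 2 powr (- (real (Suc k) * \<theta> / 2)) \<le> y * \<epsilon> * 2 powr (- (real k * \<theta> / 2))"
      using y\<epsilon> by (intro mult_left_mono)
    also have "\<dots> = \<epsilon> * (y * 2 powr (- (real k * \<theta> / 2)))" by simp
    also have "\<dots> \<le> \<epsilon> * 1" using k(1) \<open>0 < \<epsilon>\<close> by (intro mult_left_mono) auto
    finally show ?thesis by simp
  qed
  have sub: "ball t0 r \<inter> T \<subseteq> {t \<in> T. x < \<phi> t}"
  proof
    fix t assume t: "t \<in> ball t0 r \<inter> T"
    have "dist c t \<le> 2 * \<rho>" using dist_triangle[of c t t0] t t0(2) r by auto
    moreover have "dist t0 t \<le> 2 * \<rho> / 2 ^ Suc k" using t by (simp add: r_def)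
    ultimately have "\<bar>\<phi> t0 - \<phi> t\<bar> \<le> y * \<epsilon> * 2 powr (- (real (Suc k) * \<theta> / 2))"
      using t t0' by (intro osc) auto
    then have "\<bar>\<phi> t0 - \<phi> t\<bar> \<le> \<epsilon>" using small by linarith
    then show "t \<in> {t \<in> T. x < \<phi> t}" using t t0(3) x by auto
  qed
  have "\<rho> / (2 * y powr (2 / \<theta>)) \<le> r"
    unfolding r_def using k(2) \<rho> \<open>1 \<le> y\<close> by (intro divide_left_mono) auto
  then have "\<kappa> * (\<rho> / (2 * y powr (2 / \<theta>))) ^ DIM('a) \<le> \<kappa> * r ^ DIM('a)"
    using \<kappa> \<rho> by (intro mult_left_mono power_mono) auto
  also have "\<dots> \<le> measure lebesgue (ball t0 r \<inter> T)"
    using r \<rho> t0 dens by (auto simp: ball_volume_bound_def)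
  also have "\<dots> \<le> measure lebesgue {t \<in> T. x < \<phi> t}"
  proof (rule measure_mono_fmeasurable[OF sub])
    have Tm: "T \<in> lmeasurable" using lmeasurable_compact[OF T] .
    show "ball t0 r \<inter> T \<in> sets lebesgue" using Tm by auto
    show "{t \<in> T. x < \<phi> t} \<in> lmeasurable"
      by (rule fmeasurableI2[OF Tm]) (use borel in \<open>auto intro: sets_completionI_sets\<close>)
  qed
  finally show "\<kappa> * (\<rho> / (2 * y powr (2 / \<theta>))) ^ DIM('a) \<le> measure lebesgue {t \<in> T. x < \<phi> t}" .
qed

context continuous_gaussian_field
begin

definition cell_volume_moment :: "'a \<Rightarrow> real \<Rightarrow> real \<Rightarrow> real \<Rightarrow> ennreal" where
  "cell_volume_moment c \<rho> \<beta> x = (\<integral>\<^sup>+\<omega>. ennreal (indicator {\<omega>. \<exists>t\<in>T \<inter> cball c \<rho>. \<beta> < f t \<omega>} \<omega> /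
     measure lebesgue (excursion_set T f x \<omega>)) \<partial>P)"

text \<open>The probabilistic input for one cell. At high levels \<open>E j\<close> will be the event that the centre of the
cell is above the level minus \<open>(j + 1) \<epsilon>\<close>, and \<open>B\<close> of the order of its probability for \<open>j = 0\<close>; at
bounded levels \<open>E j\<close> will be the whole space and \<open>B\<close> a constant.\<close>

definition dominated_increments ::
  "real \<Rightarrow> real \<Rightarrow> real \<Rightarrow> 'a \<Rightarrow> real \<Rightarrow> real \<Rightarrow> (nat \<Rightarrow> 'w set) \<Rightarrow> bool" where
  "dominated_increments a \<theta> \<rho> c \<epsilon> B E \<longleftrightarrow> (\<forall>j. E j \<in> sets P) \<and> measure P (E 0) \<le> B \<and>
    (\<forall>j n. \<forall>p\<in>T \<inter> cball c (2 * \<rho>). \<forall>q\<in>T \<inter> cball c (2 * \<rho>). dist p q \<le> 6 * \<rho> / 2 ^ n \<longrightarrow>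
      measure P {\<omega> \<in> E (Suc j). real (Suc j) * \<epsilon> * chain_tol \<theta> n < f p \<omega> - f q \<omega>}
        \<le> B * chain_weight a \<theta> (Suc j) n)"

text \<open>The paths are classified by the smallest \<open>j\<close> such that all links obey \<open>j + 1\<close> times their
tolerance. By \<open>excursion_volume_ge\<close> the inverse volume is then at most a constant times
\<open>\<rho>\<^sup>-\<^sup>d (j + 1) powr (2 d / \<theta>)\<close>, and for \<open>j > 0\<close> some link exceeds \<open>j\<close> times its tolerance while \<open>E j\<close>
occurs. Summing the probabilities of the latter events over the links and \<open>j\<close> gives the bound.\<close>

lemma local_excursion_bound:
  assumes \<kappa>: "0 < \<kappa>"
    and dens: "ball_volume_bound T \<kappa> \<epsilon>0"
    and \<theta>: "0 < \<theta>" and a: "0 < a"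
  shows "\<exists>C>0. \<forall>\<rho> c \<epsilon> \<beta> x B E. 0 < \<rho> \<longrightarrow> \<rho> < \<epsilon>0 \<longrightarrow> c \<in> T \<longrightarrow> 0 < \<epsilon> \<longrightarrow> x \<le> \<beta> - \<epsilon> \<longrightarrow> 0 \<le> B \<longrightarrow>
    (\<forall>j. \<forall>\<omega>\<in>space P. \<beta> - real (Suc j) * \<epsilon> < f c \<omega> \<longrightarrow> \<omega> \<in> E j) \<longrightarrow>
    dominated_increments a \<theta> \<rho> c \<epsilon> B E \<longrightarrow>
    cell_volume_moment c \<rho> \<beta> x \<le> ennreal (C * B / \<rho> ^ DIM('a))"
proof -
  let ?d = "DIM('a)"
  \<comment> \<open>An integer exponent for the growth of the inverse volume in \<open>j\<close>.\<close>
  define p0 where "p0 = nat \<lceil>2 * real ?d / \<theta>\<rceil>"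
  have p0: "2 * real ?d / \<theta> \<le> real p0" unfolding p0_def by linarith
  have p01: "1 \<le> p0"
  proof -
    have "0 < 2 * real ?d / \<theta>" using \<theta> by simp
    then show ?thesis using p0 by linarith
  qed
  obtain C1 where C1: "0 < C1"
    "\<And>i. summable (\<lambda>n. 2 * (3 * 2 ^ n) ^ ?d * (3 * 2 ^ Suc n) ^ ?d * chain_weight a \<theta> (Suc i) n)"
    "\<And>i. (\<Sum>n. 2 * (3 * 2 ^ n) ^ ?d * (3 * 2 ^ Suc n) ^ ?d * chain_weight a \<theta> (Suc i) n)
      \<le> C1 * real (Suc i) powr (- (real p0 + 2))"
    by (rule chaining_series_bound[OF a \<theta>, of ?d p0]) blast
  define S2 where "S2 = (\<Sum>i. 1 / (real i + 1)\<^sup>2)"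
  have S2s: "summable (\<lambda>i. 1 / (real i + 1)\<^sup>2)"
    by (rule summable_inverse_squares)
  have S20: "0 \<le> S2" unfolding S2_def by (intro suminf_nonneg S2s) auto
  define C where "C = 2 ^ ?d / \<kappa> * (1 + 2 ^ p0 * C1 * S2)"
  have C0: "0 < C" unfolding C_def using \<kappa> C1(1) S20 by (intro mult_pos_pos divide_pos_pos add_pos_nonneg) auto
  have "cell_volume_moment c \<rho> \<beta> x \<le> ennreal (C * B / \<rho> ^ ?d)"
    if \<rho>: "0 < \<rho>" "\<rho> < \<epsilon>0" and c: "c \<in> T" and \<epsilon>: "0 < \<epsilon>" and x: "x \<le> \<beta> - \<epsilon>" and B: "0 \<le> B"
      and Ein: "\<forall>j. \<forall>\<omega>\<in>space P. \<beta> - real (Suc j) * \<epsilon> < f c \<omega> \<longrightarrow> \<omega> \<in> E j"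
      and dom: "dominated_increments a \<theta> \<rho> c \<epsilon> B E"
    for \<rho> c \<epsilon> \<beta> x B E
  proof -
    have E: "\<forall>j. E j \<in> sets P" and E0: "measure P (E 0) \<le> B"
      and pair: "\<forall>j n. \<forall>p\<in>T \<inter> cball c (2 * \<rho>). \<forall>q\<in>T \<inter> cball c (2 * \<rho>). dist p q \<le> 6 * \<rho> / 2 ^ n \<longrightarrow>
        measure P {\<omega> \<in> E (Suc j). real (Suc j) * \<epsilon> * chain_tol \<theta> n < f p \<omega> - f q \<omega>}
        \<le> B * chain_weight a \<theta> (Suc j) n"
      using dom by (auto simp: dominated_increments_def)
    let ?S = "T \<inter> cball c (2 * \<rho>)"
    have S: "compact ?S" using compact_T by (simp add: compact_Int)
    obtain N where N0: "N (0::nat) = {c}" and Nf: "\<And>n. finite (N n)" and NS: "\<And>n. N n \<subseteq> ?S"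
      and net: "\<And>n x. x \<in> ?S \<Longrightarrow> \<exists>p\<in>N n. dist x p \<le> 2 * \<rho> / 2 ^ n"
      and Nc: "\<And>n. real (card (N n)) \<le> (3 * 2 ^ n) ^ ?d"
      using dyadic_nets[OF S, of "2 * \<rho>" c] \<rho> c by auto
    define lnk where "lnk n = {z \<in> N n \<times> N (Suc n). dist (fst z) (snd z) \<le> 3 * (2 * \<rho> / 2 ^ n)}" for n
    have lnkf: "finite (lnk n)" for n unfolding lnk_def using Nf by auto
    have lnkc: "real (card (lnk n)) \<le> (3 * 2 ^ n) ^ ?d * (3 * 2 ^ Suc n) ^ ?d" for n
    proof -
      have "card (lnk n) \<le> card (N n \<times> N (Suc n))" unfolding lnk_def using Nf by (intro card_mono) auto
      then have "real (card (lnk n)) \<le> real (card (N n)) * real (card (N (Suc n)))"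
        by (simp add: card_cartesian_product flip: of_nat_mult)
      also have "\<dots> \<le> (3 * 2 ^ n) ^ ?d * (3 * 2 ^ Suc n) ^ ?d" by (intro mult_mono Nc) auto
      finally show ?thesis .
    qed
    define H where "H i n z = {\<omega> \<in> E (Suc i). real (Suc i) * \<epsilon> * chain_tol \<theta> n < f (fst z) \<omega> - f (snd z) \<omega>} \<union>
      {\<omega> \<in> E (Suc i). real (Suc i) * \<epsilon> * chain_tol \<theta> n < f (snd z) \<omega> - f (fst z) \<omega>}" for i n z
    define F where "F i = (\<Union>n. \<Union>z\<in>lnk n. H i n z)" for i
    have zT: "fst z \<in> ?S" "snd z \<in> ?S" "dist (fst z) (snd z) \<le> 6 * \<rho> / 2 ^ n" if "z \<in> lnk n" for z n
      using that NS[of n] NS[of "Suc n"] by (auto simp: lnk_def)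
    have half: "{\<omega> \<in> E j. r < f u \<omega> - f v \<omega>} \<in> sets P" if "u \<in> ?S" "v \<in> ?S" for j r u v
    proof -
      have [measurable]: "f u \<in> borel_measurable P" "f v \<in> borel_measurable P" "E j \<in> sets P"
        using that measurable_value E by auto
      have "{\<omega> \<in> E j. r < f u \<omega> - f v \<omega>} = E j \<inter> {\<omega> \<in> space P. r < f u \<omega> - f v \<omega>}"
        using sets.sets_into_space[of "E j" P] E by auto
      then show ?thesis by simp
    qed
    have Hs: "H i n z \<in> sets P" if "z \<in> lnk n" for i n z
      unfolding H_def using half zT[OF that] by auto
    have Fs [measurable]: "F i \<in> sets P" for i
      unfolding F_def using Hs lnkf by (intro sets.countable_UN sets.finite_UN) auto
    have [measurable]: "E 0 \<in> sets P" using E by simp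
    have Hm: "measure P (H i n z) \<le> 2 * (B * chain_weight a \<theta> (Suc i) n)"
      if z: "z \<in> lnk n" for i n z
    proof -
      have "measure P (H i n z) \<le> measure P {\<omega> \<in> E (Suc i). real (Suc i) * \<epsilon> * chain_tol \<theta> n < f (fst z) \<omega> - f (snd z) \<omega>}
        + measure P {\<omega> \<in> E (Suc i). real (Suc i) * \<epsilon> * chain_tol \<theta> n < f (snd z) \<omega> - f (fst z) \<omega>}"
        unfolding H_def using half zT[OF z] by (intro measure_Un_le) auto
      moreover have "measure P {\<omega> \<in> E (Suc i). real (Suc i) * \<epsilon> * chain_tol \<theta> n < f (fst z) \<omega> - f (snd z) \<omega>}
          \<le> B * chain_weight a \<theta> (Suc i) n"
        "measure P {\<omega> \<in> E (Suc i). real (Suc i) * \<epsilon> * chain_tol \<theta> n < f (snd z) \<omega> - f (fst z) \<omega>}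
          \<le> B * chain_weight a \<theta> (Suc i) n"
        using pair zT[OF z] by (auto simp: dist_commute)
      ultimately show ?thesis by linarith
    qed
    define tt where "tt i n = 2 * (3 * 2 ^ n) ^ ?d * (3 * 2 ^ Suc n) ^ ?d * chain_weight a \<theta> (Suc i) n" for i n :: nat
    have tts: "summable (tt i)" and ttle: "(\<Sum>n. tt i n) \<le> C1 * real (Suc i) powr (- (real p0 + 2))" for i
      using C1(2,3)[of i] unfolding tt_def[abs_def] by auto
    have tt0: "0 \<le> tt i n" for i n by (simp add: tt_def chain_weight_def)
    have Gm: "measure P (\<Union>z\<in>lnk n. H i n z) \<le> B * tt i n" for i n
    proof -
      have "measure P (\<Union>z\<in>lnk n. H i n z) \<le> (\<Sum>z\<in>lnk n. measure P (H i n z))"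
        using Hs lnkf by (intro finite_measure_subadditive_finite) auto
      also have "\<dots> \<le> (\<Sum>z\<in>lnk n. 2 * (B * chain_weight a \<theta> (Suc i) n))"
        by (intro sum_mono Hm)
      also have "\<dots> = real (card (lnk n)) * (2 * (B * chain_weight a \<theta> (Suc i) n))"
        by simp
      also have "\<dots> \<le> ((3 * 2 ^ n) ^ ?d * (3 * 2 ^ Suc n) ^ ?d) * (2 * (B * chain_weight a \<theta> (Suc i) n))"
        using B by (intro mult_right_mono lnkc) (auto simp: chain_weight_def)
      also have "\<dots> = B * tt i n" by (simp add: tt_def)
      finally show ?thesis .
    qed
    have Fm: "emeasure P (F i) \<le> ennreal (B * (C1 * real (Suc i) powr (- (real p0 + 2))))" for i
    proof -
      have "emeasure P (F i) \<le> (\<Sum>n. emeasure P (\<Union>z\<in>lnk n. H i n z))"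
        unfolding F_def using Hs lnkf by (intro emeasure_subadditive_countably) auto
      also have "\<dots> \<le> (\<Sum>n. ennreal (B * tt i n))"
        using Gm by (intro suminf_le) (auto simp: emeasure_eq_measure ennreal_leI)
      also have "\<dots> = ennreal (\<Sum>n. B * tt i n)"
        using B tt0 tts by (intro suminf_ennreal2) auto
      also have "(\<Sum>n. B * tt i n) = B * (\<Sum>n. tt i n)" using tts by (rule suminf_mult)
      also have "ennreal (B * (\<Sum>n. tt i n)) \<le> ennreal (B * (C1 * real (Suc i) powr (- (real p0 + 2))))"
        using ttle B by (intro ennreal_leI mult_left_mono) auto
      finally show ?thesis .
    qed
    define A where "A = 2 ^ ?d / (\<kappa> * \<rho> ^ ?d)"
    have A0: "0 < A" using \<kappa> \<rho> by (simp add: A_def)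
    have point: "AE \<omega> in P. ennreal (indicator {\<omega>. \<exists>t\<in>T \<inter> cball c \<rho>. \<beta> < f t \<omega>} \<omega> /
        measure lebesgue (excursion_set T f x \<omega>))
      \<le> ennreal A * indicator (E 0) \<omega> + (\<Sum>i. ennreal (A * (real i + 2) ^ p0) * indicator (F i) \<omega>)"
      using continuous_paths AE_space
    proof eventually_elim
      case (elim \<omega>)
      define v where "v = indicator {\<omega>. \<exists>t\<in>T \<inter> cball c \<rho>. \<beta> < f t \<omega>} \<omega> / measure lebesgue (excursion_set T f x \<omega>)"
      let ?R = "ennreal A * indicator (E 0) \<omega> + (\<Sum>i. ennreal (A * (real i + 2) ^ p0) * indicator (F i) \<omega>)"
      have termF: "ennreal (A * (real i + 2) ^ p0) \<le> ?R" if "\<omega> \<in> F i" for i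
      proof -
        have "(\<Sum>j\<in>{i}. ennreal (A * (real j + 2) ^ p0) * indicator (F j) \<omega>)
          \<le> (\<Sum>j. ennreal (A * (real j + 2) ^ p0) * indicator (F j) \<omega>)"
          by (intro sum_le_suminf) auto
        also have "\<dots> \<le> ?R" by (rule add_increasing) auto
        finally show ?thesis using that by simp
      qed
      show "ennreal v \<le> ?R"
      proof (cases "\<exists>t\<in>T \<inter> cball c \<rho>. \<beta> < f t \<omega>")
        case False
        then have "v = 0" by (simp add: v_def)
        then show ?thesis by simp
      next
        case True
        then obtain t0 where t0: "t0 \<in> T" "dist c t0 \<le> \<rho>" "\<beta> < f t0 \<omega>" by auto
        define good where "good j \<longleftrightarrow> (\<forall>n. \<forall>z\<in>lnk n. \<bar>f (fst z) \<omega> - f (snd z) \<omega>\<bar> \<le> real (Suc j) * \<epsilon> * chain_tol \<theta> n)" for j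
        have bad: "\<omega> \<in> F i" if "\<not> good i" "\<omega> \<in> E (Suc i)" for i
        proof -
          have "\<exists>n. \<exists>z\<in>lnk n. real (Suc i) * \<epsilon> * chain_tol \<theta> n < \<bar>f (fst z) \<omega> - f (snd z) \<omega>\<bar>"
          proof (rule ccontr)
            assume none: "\<not> ?thesis"
            have "good i" unfolding good_def
            proof (intro allI ballI)
              fix n z assume "z \<in> lnk n"
              then show "\<bar>f (fst z) \<omega> - f (snd z) \<omega>\<bar> \<le> real (Suc i) * \<epsilon> * chain_tol \<theta> n"
                using none not_le by blast
            qed
            then show False using that(1) by simp
          qed
          then obtain n z where "z \<in> lnk n" "real (Suc i) * \<epsilon> * chain_tol \<theta> n < \<bar>f (fst z) \<omega> - f (snd z) \<omega>\<bar>"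
            by blast
          then have "\<omega> \<in> H i n z" using that(2) by (auto simp: H_def abs_if split: if_splits)
          then show ?thesis using \<open>z \<in> lnk n\<close> by (auto simp: F_def)
        qed
        show ?thesis
        proof (cases "\<exists>j. good j")
          case True
          define j where "j = (LEAST j. good j)"
          have gj: "good j" unfolding j_def using True by (rule LeastI_ex)
          have link: "\<bar>f p \<omega> - f q \<omega>\<bar> \<le> real (Suc j) * \<epsilon> * chain_tol \<theta> n"
            if "p \<in> N n" "q \<in> N (Suc n)" "dist p q \<le> 3 * (2 * \<rho> / 2 ^ n)" for n p q
          proof -
            have "(p, q) \<in> lnk n" using that by (simp add: lnk_def)
            then show ?thesis using gj by (force simp: good_def)
          qed
          have eb: "{t \<in> T. x < f t \<omega>} \<in> sets borel"
            using excursion_set_borel[OF elim] by (simp add: excursion_set_def)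
          have y1: "1 \<le> real (Suc j)" by simp
          note ev = excursion_volume_ge[OF \<kappa> dens compact_T eb elim(1) \<rho> c \<theta> NS net link \<epsilon> y1 t0 x]
          have Ej: "\<omega> \<in> E j" using Ein elim(2) ev(1) by blast
          define K where "K = \<kappa> * (\<rho> / (2 * real (Suc j) powr (2 / \<theta>))) ^ ?d"
          have K0: "0 < K" using \<kappa> \<rho> by (simp add: K_def)
          have "v \<le> 1 / measure lebesgue (excursion_set T f x \<omega>)"
            unfolding v_def by (intro divide_right_mono) (auto simp: indicator_def)
          also have "\<dots> \<le> 1 / K"
            using ev(2) K0 unfolding K_def excursion_set_def by (intro divide_left_mono) (auto intro!: mult_pos_pos)
          also have "1 / K = A * (real (Suc j) powr (2 / \<theta>)) ^ ?d"
            by (simp add: K_def A_def power_divide power_mult_distrib)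
          also have "(real (Suc j) powr (2 / \<theta>)) ^ ?d = real (Suc j) powr (2 * real ?d / \<theta>)"
            by (simp add: powr_power field_simps)
          also have "\<dots> \<le> real (Suc j) powr real p0" using p0 by (intro powr_mono) auto
          also have "\<dots> = (real j + 1) ^ p0" by (simp add: powr_realpow add.commute)
          finally have vle: "v \<le> A * (real j + 1) ^ p0" using A0 by simp
          show ?thesis
          proof (cases j)
            case 0
            then have "ennreal v \<le> ennreal A * indicator (E 0) \<omega>" using vle Ej by (simp add: ennreal_leI)
            also have "\<dots> \<le> ?R" by (rule add_increasing2) auto
            finally show ?thesis .
          next
            case (Suc i)
            have "\<not> good i" using not_less_Least[of i good] Suc by (simp add: j_def)
            then have "\<omega> \<in> F i" using Ej Suc by (intro bad) auto
            have "ennreal v \<le> ennreal (A * (real i + 2) ^ p0)" using vle Suc by (intro ennreal_leI) (simp add: add.commute)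
            also have "\<dots> \<le> ?R" by (rule termF) fact
            finally show ?thesis .
          qed
        next
          case False
          \<comment> \<open>No multiple of the tolerances is obeyed. One term of the series, far enough out, is at least \<open>v\<close>.\<close>
          obtain i where i: "max ((\<beta> - f c \<omega>) / \<epsilon>) (v / A) < real i" using reals_Archimedean2 by blast
          have "\<beta> - f c \<omega> < real i * \<epsilon>" using i \<epsilon> by (simp add: field_simps)
          also have "\<dots> \<le> real (Suc (Suc i)) * \<epsilon>" using \<epsilon> by simp
          finally have "\<omega> \<in> E (Suc i)" using Ein elim(2) by auto
          then have "\<omega> \<in> F i" using False by (intro bad) auto
          have "v \<le> A * real i" using i A0 by (simp add: field_simps)
          also have "\<dots> \<le> A * (real i + 2) ^ p0"
          proof (rule mult_left_mono)
            have "(real i + 2) ^ 1 \<le> (real i + 2) ^ p0" using p01 by (intro power_increasing) auto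
            then show "real i \<le> (real i + 2) ^ p0" by simp
          qed (use A0 in simp)
          finally have "ennreal v \<le> ennreal (A * (real i + 2) ^ p0)" by (rule ennreal_leI)
          also have "\<dots> \<le> ?R" by (rule termF) fact
          finally show ?thesis .
        qed
      qed
    qed
    have "cell_volume_moment c \<rho> \<beta> x
      \<le> (\<integral>\<^sup>+\<omega>. ennreal A * indicator (E 0) \<omega> + (\<Sum>i. ennreal (A * (real i + 2) ^ p0) * indicator (F i) \<omega>) \<partial>P)"
      unfolding cell_volume_moment_def using point by (rule nn_integral_mono_AE)
    also have "\<dots> = ennreal A * emeasure P (E 0) + (\<Sum>i. ennreal (A * (real i + 2) ^ p0) * emeasure P (F i))"
      by (subst nn_integral_add) (auto simp: nn_integral_suminf nn_integral_cmult_indicator)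
    also have "\<dots> \<le> ennreal (A * B) + (\<Sum>i. ennreal (A * B * (2 ^ p0 * C1) * (1 / (real i + 1)\<^sup>2)))"
    proof (intro add_mono suminf_le)
      show "ennreal A * emeasure P (E 0) \<le> ennreal (A * B)"
        using E0 A0 by (simp add: emeasure_eq_measure ennreal_mult'[symmetric] ennreal_leI)
      fix i
      have "ennreal (A * (real i + 2) ^ p0) * emeasure P (F i)
        \<le> ennreal (A * (real i + 2) ^ p0) * ennreal (B * (C1 * real (Suc i) powr (- (real p0 + 2))))"
        by (intro mult_left_mono Fm) auto
      also have "\<dots> = ennreal (A * (real i + 2) ^ p0 * (B * (C1 * real (Suc i) powr (- (real p0 + 2)))))"
        using A0 B C1 by (intro ennreal_mult[symmetric]) auto
      also have "\<dots> \<le> ennreal (A * B * (2 ^ p0 * C1) * (1 / (real i + 1)\<^sup>2))"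
      proof (rule ennreal_leI)
        have "(real i + 2) ^ p0 \<le> (2 * (real i + 1)) ^ p0" by (intro power_mono) auto
        then have "(real i + 2) ^ p0 * real (Suc i) powr (- (real p0 + 2)) \<le> (2 * (real i + 1)) ^ p0 * real (Suc i) powr (- (real p0 + 2))"
          by (intro mult_right_mono) auto
        also have "\<dots> = 2 ^ p0 * (1 / (real i + 1)\<^sup>2)"
        proof -
          have "real (Suc i) powr (- (real p0 + 2)) = 1 / ((real i + 1) ^ p0 * (real i + 1)\<^sup>2)"
            unfolding powr_minus_divide powr_add by (simp add: powr_realpow add.commute)
          then show ?thesis unfolding power_mult_distrib by simp
        qed
        finally have *: "(real i + 2) ^ p0 * real (Suc i) powr (- (real p0 + 2)) \<le> 2 ^ p0 * (1 / (real i + 1)\<^sup>2)" .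
        have "A * (real i + 2) ^ p0 * (B * (C1 * real (Suc i) powr (- (real p0 + 2))))
          = (A * B * C1) * ((real i + 2) ^ p0 * real (Suc i) powr (- (real p0 + 2)))" by simp
        also have "\<dots> \<le> (A * B * C1) * (2 ^ p0 * (1 / (real i + 1)\<^sup>2))"
          using A0 B C1 by (intro mult_left_mono *) auto
        finally show "A * (real i + 2) ^ p0 * (B * (C1 * real (Suc i) powr (- (real p0 + 2)))) \<le> A * B * (2 ^ p0 * C1) * (1 / (real i + 1)\<^sup>2)"
          by (simp add: mult_ac)
      qed
      finally show "ennreal (A * (real i + 2) ^ p0) * emeasure P (F i) \<le> ennreal (A * B * (2 ^ p0 * C1) * (1 / (real i + 1)\<^sup>2))" .
    qed auto
    also have "(\<Sum>i. ennreal (A * B * (2 ^ p0 * C1) * (1 / (real i + 1)\<^sup>2))) = ennreal (A * B * (2 ^ p0 * C1) * S2)"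
    proof -
      have "(\<Sum>i. ennreal (A * B * (2 ^ p0 * C1) * (1 / (real i + 1)\<^sup>2))) = ennreal (\<Sum>i. A * B * (2 ^ p0 * C1) * (1 / (real i + 1)\<^sup>2))"
        using A0 B C1 S2s by (intro suminf_ennreal2 summable_mult) auto
      then show ?thesis unfolding S2_def using suminf_mult[OF S2s, of "A * B * (2 ^ p0 * C1)"] by simp
    qed
    also have "ennreal (A * B) + ennreal (A * B * (2 ^ p0 * C1) * S2) = ennreal (A * B + A * B * (2 ^ p0 * C1) * S2)"
      using A0 B C1 S20 by (intro ennreal_plus[symmetric]) auto
    also have "A * B + A * B * (2 ^ p0 * C1) * S2 = C * B / \<rho> ^ ?d"
      using \<kappa> \<rho> by (simp add: A_def C_def field_simps)
    finally show ?thesis .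
  qed
  then show ?thesis using C0 by blast
qed

end

section \<open>Gaussian estimates at a regular scale\<close>

text \<open>The constants of all following estimates depend on the field through these bounds and the regularity.\<close>

locale bounded_gaussian_field = continuous_gaussian_field P T f
  for P :: "'w measure" and T :: "'a::euclidean_space set" and f :: "'a \<Rightarrow> 'w \<Rightarrow> real" +
  fixes s0 s1 m0 :: real
  assumes s0: "0 < s0" and sd_ge: "\<And>t. t \<in> T \<Longrightarrow> s0 \<le> sd_fun P f t"
    and sd_le: "\<And>t. t \<in> T \<Longrightarrow> sd_fun P f t \<le> s1"
    and mn_le: "\<And>t. t \<in> T \<Longrightarrow> \<bar>mean_fun P f t\<bar> \<le> m0"
begin

lemma sd_pos: "t \<in> T \<Longrightarrow> 0 < sd t"
  using s0 sd_ge[of t] by linarith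

text \<open>In units of \<open>\<rho>\<close>, the field varies by the order of \<open>1/b\<close>: covariances with a fixed value of the field
vary by \<open>1 / b\<^sup>2\<close> and means by \<open>1/b\<close>. Applied with \<open>c = s\<close> and \<open>c = t\<close>, the first condition also bounds
the variance of an increment, so no separate condition on it is needed. Balls of radius \<open>4 \<rho>\<close> leave
room for the pairs of points that occur in the chaining.\<close>

definition scale_regular :: "real \<Rightarrow> real \<Rightarrow> real \<Rightarrow> real \<Rightarrow> bool" where
  "scale_regular K \<theta> b \<rho> \<longleftrightarrow>
     (\<forall>c\<in>T. \<forall>s\<in>T. \<forall>t\<in>T. dist c s \<le> 4 * \<rho> \<longrightarrow> dist c t \<le> 4 * \<rho> \<longrightarrow>
        b\<^sup>2 * \<bar>cov c s - cov c t\<bar> \<le> K * (dist s t / \<rho>) powr (2 * \<theta>)) \<and>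
     (\<forall>s\<in>T. \<forall>t\<in>T. dist s t \<le> 4 * \<rho> \<longrightarrow> b * \<bar>mn s - mn t\<bar> \<le> K * (dist s t / \<rho>) powr \<theta>)"

lemma scale_regular_increments:
  assumes reg: "scale_regular K \<theta> b \<rho>" and "0 \<le> K" "0 < \<theta>" "\<theta> \<le> 1" "0 < \<rho>"
    and c: "c \<in> T" and p: "p \<in> T \<inter> cball c (2 * \<rho>)" and q: "q \<in> T \<inter> cball c (2 * \<rho>)"
    and d: "dist p q \<le> 6 * \<rho> / 2 ^ n"
  defines "z \<equiv> 2 powr (real n * \<theta>)"
  shows "b\<^sup>2 * \<bar>cov c p - cov c q\<bar> \<le> 36 * K / z\<^sup>2"
    and "b * \<bar>mn p - mn q\<bar> \<le> 6 * K / z"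
    and "b\<^sup>2 * (cov p p - 2 * cov p q + cov q q) \<le> 72 * K / z\<^sup>2"
proof -
  have z: "1 \<le> z" using assms by (simp add: z_def ge_one_powr_ge_zero)
  have h: "dist p q / \<rho> \<le> 6 / 2 ^ n" using d \<open>0 < \<rho>\<close> by (simp add: field_simps)
  have h1: "(dist p q / \<rho>) powr \<theta> \<le> 6 / z"
  proof -
    have "(dist p q / \<rho>) powr \<theta> \<le> (6 / 2 ^ n) powr \<theta>"
      using h \<open>0 < \<rho>\<close> \<open>0 < \<theta>\<close> by (intro powr_mono2) auto
    also have "\<dots> = 6 powr \<theta> / z"
      by (simp add: powr_divide z_def powr_powr flip: powr_realpow)
    also have "\<dots> \<le> 6 powr 1 / z" using z \<open>\<theta> \<le> 1\<close> by (intro divide_right_mono powr_mono) auto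
    finally show ?thesis by simp
  qed
  have h2: "(dist p q / \<rho>) powr (2 * \<theta>) \<le> 36 / z\<^sup>2"
  proof -
    have "(dist p q / \<rho>) powr (2 * \<theta>) = ((dist p q / \<rho>) powr \<theta>)\<^sup>2"
      by (simp add: power2_eq_square powr_add[symmetric])
    also have "\<dots> \<le> (6 / z)\<^sup>2" using h1 by (intro power_mono) auto
    finally show ?thesis by (simp add: power_divide)
  qed
  have pq: "dist p q \<le> 4 * \<rho>" using p q dist_triangle3[of p q c] by auto
  have near: "dist c p \<le> 4 * \<rho>" "dist c q \<le> 4 * \<rho>" using p q \<open>0 < \<rho>\<close> by auto
  have cv: "b\<^sup>2 * \<bar>cov e p - cov e q\<bar> \<le> 36 * K / z\<^sup>2"
    if e: "e \<in> T" "dist e p \<le> 4 * \<rho>" "dist e q \<le> 4 * \<rho>" for e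
  proof -
    have "b\<^sup>2 * \<bar>cov e p - cov e q\<bar> \<le> K * (dist p q / \<rho>) powr (2 * \<theta>)"
      using reg e p q unfolding scale_regular_def by blast
    also have "\<dots> \<le> K * (36 / z\<^sup>2)" using h2 \<open>0 \<le> K\<close> by (intro mult_left_mono) auto
    finally show ?thesis by (simp add: mult.commute)
  qed
  show "b\<^sup>2 * \<bar>cov c p - cov c q\<bar> \<le> 36 * K / z\<^sup>2" using cv[OF c near] .
  have "b * \<bar>mn p - mn q\<bar> \<le> K * (dist p q / \<rho>) powr \<theta>"
    using reg p q pq unfolding scale_regular_def by blast
  also have "\<dots> \<le> K * (6 / z)" using h1 \<open>0 \<le> K\<close> by (intro mult_left_mono) auto
  finally show "b * \<bar>mn p - mn q\<bar> \<le> 6 * K / z" by (simp add: mult.commute)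
  have "b\<^sup>2 * \<bar>cov p p - cov p q\<bar> \<le> 36 * K / z\<^sup>2" "b\<^sup>2 * \<bar>cov q p - cov q q\<bar> \<le> 36 * K / z\<^sup>2"
    using p q pq \<open>0 < \<rho>\<close> by (auto intro!: cv simp: dist_commute)
  moreover have "b\<^sup>2 * (cov p p - 2 * cov p q + cov q q) \<le> b\<^sup>2 * (\<bar>cov p p - cov p q\<bar> + \<bar>cov q p - cov q q\<bar>)"
    unfolding cov_commute[of q p] by (intro mult_left_mono) auto
  ultimately show "b\<^sup>2 * (cov p p - 2 * cov p q + cov q q) \<le> 72 * K / z\<^sup>2"
    by (simp add: distrib_left)
qed

text \<open>For large \<open>b\<close>, the standardised level \<open>x\<close> and the scaled deviation \<open>S\<close> are both of the order of \<open>b\<close>.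
These are the bounds that make the constants in \<open>gauss_tail_tilt\<close> independent of \<open>b\<close>.\<close>

lemma level_bounds:
  assumes c: "c \<in> T" and b: "1 \<le> b" "2 * m0 \<le> b" "4 * G \<le> b" and G: "0 \<le> G"
  defines "x \<equiv> (b - mn c) / sd c" and "S \<equiv> b * sd c"
  shows "0 < S" "0 < x" "S * x = b\<^sup>2 - b * mn c" "2 * G \<le> S * x"
    "x / S \<le> 3 / (2 * s0\<^sup>2)" "1 / (2 * s1\<^sup>2) \<le> x / S" "x\<^sup>2 \<le> 9 * b\<^sup>2 / (4 * s0\<^sup>2)" "s0\<^sup>2 * b\<^sup>2 \<le> S\<^sup>2"
proof -
  have sd: "0 < sd c" "s0 \<le> sd c" "sd c \<le> s1" using c sd_pos sd_ge sd_le by auto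
  have m: "\<bar>mn c\<bar> \<le> b / 2" using mn_le[OF c] b(2) by linarith
  then have bm: "b / 2 \<le> b - mn c" "b - mn c \<le> 3 * b / 2" by auto
  show S: "0 < S" using sd b by (simp add: S_def)
  show x: "0 < x" using sd bm b by (simp add: x_def)
  show Sx: "S * x = b\<^sup>2 - b * mn c" 
  proof -
    have "sd c * x = b - mn c" using sd by (simp add: x_def)
    then have "b * (sd c * x) = b * (b - mn c)" by simp
    then show ?thesis by (simp add: S_def power2_eq_square right_diff_distrib mult.assoc)
  qed
  have "2 * G \<le> b * (b / 2)" using mult_mono[of 1 b "4 * G" b] b G by simp
  also have "\<dots> \<le> b * (b - mn c)" using bm b by (intro mult_left_mono) auto
  finally show "2 * G \<le> S * x" unfolding Sx by (simp add: power2_eq_square algebra_simps)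
  define r where "r = (b - mn c) / b"
  have xS: "x / S = r / (sd c)\<^sup>2" by (simp add: r_def x_def S_def power2_eq_square)
  have r: "1 / 2 \<le> r" "r \<le> 3 / 2" using bm b by (auto simp: r_def field_simps)
  have sq: "s0\<^sup>2 \<le> (sd c)\<^sup>2" "(sd c)\<^sup>2 \<le> s1\<^sup>2" using sd s0 by (auto intro!: power_mono)
  have "x / S \<le> (3 / 2) / s0\<^sup>2" unfolding xS using r sq s0 by (intro frac_le) auto
  then show "x / S \<le> 3 / (2 * s0\<^sup>2)" by simp
  have "(1 / 2) / s1\<^sup>2 \<le> x / S" unfolding xS using r sq sd by (intro frac_le) auto
  then show "1 / (2 * s1\<^sup>2) \<le> x / S" by simp
  have "x \<le> (3 * b / 2) / s0" unfolding x_def using bm sd s0 b by (intro frac_le) auto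
  then have "x\<^sup>2 \<le> ((3 * b / 2) / s0)\<^sup>2" using x by (intro power_mono) auto
  then show "x\<^sup>2 \<le> 9 * b\<^sup>2 / (4 * s0\<^sup>2)" by (simp add: power_divide power_mult_distrib)
  show "s0\<^sup>2 * b\<^sup>2 \<le> S\<^sup>2" unfolding S_def power_mult_distrib using sq by (simp add: mult.commute mult_left_mono)
qed

text \<open>The tilting lemma in the scaling of the field: a variable whose variance exceeds that of \<open>b f(c)\<close> by at
most \<open>K\<close>, and whose level lies above its mean by \<open>J - G\<close> more than for \<open>b f(c)\<close>, exceeds it with
a probability exponentially small in \<open>J\<close> relative to that of \<open>f(c) > b\<close>.\<close>

lemma exceed_prob_tilt:
  assumes "0 \<le> G" "0 \<le> K"
  shows "\<exists>C>0. \<forall>b c J X m V. c \<in> T \<longrightarrow> 1 \<le> b \<longrightarrow> 2 * m0 \<le> b \<longrightarrow> 4 * G \<le> b \<longrightarrow> 0 \<le> J \<longrightarrow>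
    0 < V \<longrightarrow> V \<le> b\<^sup>2 * (sd c)\<^sup>2 + K \<longrightarrow> b\<^sup>2 - b * mn c + J - G \<le> X \<longrightarrow>
    gauss_tail (X / sqrt V) \<le> C * exceed_prob b c * exp (- J / (4 * s1\<^sup>2 * (1 + K / s0\<^sup>2)))"
proof -
  define k1 where "k1 = K / s0\<^sup>2"
  have k1: "0 \<le> k1" using assms by (simp add: k1_def)
  define C where "C = 2 * sqrt (1 + k1) * exp ((9 * K / (4 * s0 ^ 4) + 3 * G / s0\<^sup>2) / 2)"
  have C0: "0 < C" using k1 by (simp add: C_def)
  have "gauss_tail (X / sqrt V) \<le> C * exceed_prob b c * exp (- J / (4 * s1\<^sup>2 * (1 + K / s0\<^sup>2)))"
    if c: "c \<in> T" and b: "1 \<le> b" "2 * m0 \<le> b" "4 * G \<le> b" and J: "0 \<le> J" and V: "0 < V" "V \<le> b\<^sup>2 * (sd c)\<^sup>2 + K"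
      and X: "b\<^sup>2 - b * mn c + J - G \<le> X" for b c J X V
  proof -
    define x where "x = (b - mn c) / sd c"
    define S where "S = b * sd c"
    note lv = level_bounds[OF c b assms(1), folded x_def S_def]
    have s1: "0 < s1" using sd_pos[OF c] sd_le[OF c] by linarith
    define k where "k = K / S\<^sup>2"
    have k: "0 \<le> k" using assms by (simp add: k_def)
    have b2: "1 \<le> b\<^sup>2" using b(1) by simp
    have s0b: "0 < s0\<^sup>2 * b\<^sup>2" using s0 b by simp
    have kk: "k \<le> K / (s0\<^sup>2 * b\<^sup>2)" unfolding k_def using lv(1,8) assms s0b by (intro divide_left_mono) auto
    also have "\<dots> \<le> k1" unfolding k1_def using assms s0 b2 b(1) by (intro divide_left_mono) (auto simp: mult_le_cancel_left1)
    finally have kk1: "k \<le> k1" .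
    have kx: "k * x\<^sup>2 \<le> 9 * K / (4 * s0 ^ 4)"
    proof -
      have "k * x\<^sup>2 \<le> K / (s0\<^sup>2 * b\<^sup>2) * (9 * b\<^sup>2 / (4 * s0\<^sup>2))"
        using kk lv(7) assms s0b by (intro mult_mono) auto
      also have "\<dots> = 9 * K / (4 * s0 ^ 4)" using b s0 by (simp add: field_simps power4_eq_xxxx power2_eq_square)
      finally show ?thesis .
    qed
    have "V \<le> S\<^sup>2 * (1 + k)" 
    proof -
      have "S\<^sup>2 * (1 + k) = b\<^sup>2 * (sd c)\<^sup>2 + K"
        using lv(1) by (simp add: k_def distrib_left) (simp add: S_def power_mult_distrib)
      then show ?thesis using V(2) by simp
    qed
    then have "sqrt V \<le> S * sqrt (1 + k)"
      using lv(1) real_sqrt_le_mono[of V "S\<^sup>2 * (1 + k)"] by (simp add: real_sqrt_mult)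
    moreover have num: "0 \<le> S * x + J - G" using lv(4) J assms(1) by linarith
    ultimately have "(S * x + J - G) / (S * sqrt (1 + k)) \<le> (S * x + J - G) / sqrt V"
      using V(1) lv(1) k by (intro divide_left_mono mult_pos_pos) auto
    also have "\<dots> \<le> X / sqrt V" using X lv(3) V by (intro divide_right_mono) auto
    finally have "(x + (J - G) / S) / sqrt (1 + k) \<le> X / sqrt V"
      using lv(1) by (simp add: field_simps)
    then have "gauss_tail (X / sqrt V) \<le> gauss_tail ((x + (J - G) / S) / sqrt (1 + k))"
      by (rule gauss_tail_antimono)
    also have "\<dots> \<le> 2 * sqrt (1 + k) * exp ((k * x\<^sup>2 + 2 * x * G / S) / 2 - x * J / (2 * S * (1 + k))) * gauss_tail x"
      using lv assms J k by (intro gauss_tail_tilt) auto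
    also have "\<dots> \<le> (C * exp (- J / (4 * s1\<^sup>2 * (1 + k1)))) * gauss_tail x"
    proof (rule mult_right_mono[OF _ gauss_tail_nonneg])
      have e1: "2 * x * G / S \<le> 3 * G / s0\<^sup>2"
        using mult_right_mono[OF lv(5), of "2 * G"] assms by (simp add: mult.commute mult.left_commute)
      have e2: "J / (4 * s1\<^sup>2 * (1 + k1)) \<le> x * J / (2 * S * (1 + k))"
      proof -
        have "J / (4 * s1\<^sup>2 * (1 + k1)) = (1 / (2 * s1\<^sup>2)) * (J / 2) / (1 + k1)" by simp
        also have "\<dots> \<le> (x / S) * (J / 2) / (1 + k)"
        proof (rule frac_le)
          show "(1 / (2 * s1\<^sup>2)) * (J / 2) \<le> (x / S) * (J / 2)"
            using lv(6) J by (intro mult_right_mono) auto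
        qed (use J k kk1 lv(1,2) in auto)
        finally show ?thesis by (simp add: mult.commute[of S 2])
      qed
      have "exp ((k * x\<^sup>2 + 2 * x * G / S) / 2 - x * J / (2 * S * (1 + k)))
          \<le> exp ((9 * K / (4 * s0 ^ 4) + 3 * G / s0\<^sup>2) / 2 + - J / (4 * s1\<^sup>2 * (1 + k1)))"
        unfolding exp_le_cancel_iff minus_divide_left[symmetric]
        using e1 e2 kx by argo
      then have "2 * sqrt (1 + k) * exp ((k * x\<^sup>2 + 2 * x * G / S) / 2 - x * J / (2 * S * (1 + k)))
        \<le> 2 * sqrt (1 + k1) * exp ((9 * K / (4 * s0 ^ 4) + 3 * G / s0\<^sup>2) / 2 + - J / (4 * s1\<^sup>2 * (1 + k1)))"
        using kk1 k by (intro mult_mono) auto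
      then show "2 * sqrt (1 + k) * exp ((k * x\<^sup>2 + 2 * x * G / S) / 2 - x * J / (2 * S * (1 + k)))
        \<le> C * exp (- J / (4 * s1\<^sup>2 * (1 + k1)))"
        unfolding exp_add C_def by (simp add: mult.assoc)
    qed
    also have "gauss_tail x = exceed_prob b c"
      unfolding x_def using c sd_pos by (simp add: exceed_prob_eq)
    finally show ?thesis by (simp add: k1_def mult_ac)
  qed
  then show ?thesis using C0 by blast
qed

lemma exceed_prob_cell:
  assumes K: "0 \<le> K" and \<theta>: "0 < \<theta>"
  shows "\<exists>C>0. \<exists>b0\<ge>1. \<forall>b\<ge>b0. \<forall>\<rho>>0. \<forall>c\<in>T. \<forall>t\<in>T. scale_regular K \<theta> b \<rho> \<longrightarrow> dist c t \<le> \<rho> \<longrightarrow>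
    exceed_prob (gamma_level b) t \<le> C * exceed_prob b c"
proof -
  obtain C where C: "0 < C" and tilt: "\<And>b c J X V. c \<in> T \<Longrightarrow> 1 \<le> b \<Longrightarrow> 2 * m0 \<le> b \<Longrightarrow> 4 * (1 + K) \<le> b \<Longrightarrow> 0 \<le> J \<Longrightarrow>
    0 < V \<Longrightarrow> V \<le> b\<^sup>2 * (sd c)\<^sup>2 + 2 * K \<Longrightarrow> b\<^sup>2 - b * mn c + J - (1 + K) \<le> X \<Longrightarrow>
    gauss_tail (X / sqrt V) \<le> C * exceed_prob b c * exp (- J / (4 * s1\<^sup>2 * (1 + 2 * K / s0\<^sup>2)))"
    using exceed_prob_tilt[of "1 + K" "2 * K"] K by auto
  define b0 where "b0 = max 1 (max (2 * m0) (4 * (1 + K)))"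
  have "exceed_prob (gamma_level b) t \<le> C * exceed_prob b c"
    if b: "b0 \<le> b" and \<rho>: "0 < \<rho>" and c: "c \<in> T" and t: "t \<in> T" and reg: "scale_regular K \<theta> b \<rho>" and d: "dist c t \<le> \<rho>" for b \<rho> c t
  proof -
    have b': "1 \<le> b" "2 * m0 \<le> b" "4 * (1 + K) \<le> b" using b by (auto simp: b0_def)
    have h: "dist c t / \<rho> \<le> 1" "0 \<le> dist c t / \<rho>" using d \<rho> by (auto simp: field_simps)
    have pw: "(dist c t / \<rho>) powr e \<le> 1" if "0 < e" for e
      using powr_mono2[of e "dist c t / \<rho>" 1] h that by simp
    have d4: "dist c t \<le> 4 * \<rho>" "dist c c \<le> 4 * \<rho>" "dist t t \<le> 4 * \<rho>" "dist t c \<le> 4 * \<rho>"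
      using d \<rho> by (auto simp: dist_commute)
    have "b\<^sup>2 * \<bar>cov c c - cov c t\<bar> \<le> K * (dist c t / \<rho>) powr (2 * \<theta>)"
      "b\<^sup>2 * \<bar>cov t c - cov t t\<bar> \<le> K * (dist c t / \<rho>) powr (2 * \<theta>)"
      "b * \<bar>mn c - mn t\<bar> \<le> K * (dist c t / \<rho>) powr \<theta>"
      using reg c t d4 unfolding scale_regular_def by blast+
    moreover have "K * (dist c t / \<rho>) powr (2 * \<theta>) \<le> K" "K * (dist c t / \<rho>) powr \<theta> \<le> K"
      using pw[of "2 * \<theta>"] pw[of \<theta>] \<theta> K mult_left_mono[of _ 1 K] by auto
    ultimately have cv: "b\<^sup>2 * \<bar>cov c c - cov c t\<bar> \<le> K" "b\<^sup>2 * \<bar>cov t c - cov t t\<bar> \<le> K"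
      and mv: "b * \<bar>mn c - mn t\<bar> \<le> K" by linarith+
    have "b\<^sup>2 * (cov t t - cov c c) \<le> b\<^sup>2 * (\<bar>cov c c - cov c t\<bar> + \<bar>cov t c - cov t t\<bar>)"
      unfolding cov_commute[of t c] by (intro mult_left_mono) auto
    then have V: "b\<^sup>2 * (sd t)\<^sup>2 \<le> b\<^sup>2 * (sd c)\<^sup>2 + 2 * K"
      using cv by (simp add: sd_power2 algebra_simps)
    have "b * (mn t - mn c) \<le> b * \<bar>mn c - mn t\<bar>" using b' by (intro mult_left_mono) auto
    then have X: "b\<^sup>2 - b * mn c + 0 - (1 + K) \<le> b * (gamma_level b - mn t)"
      using mv b' by (simp add: gamma_level_def algebra_simps power2_eq_square)
    have "gauss_tail (b * (gamma_level b - mn t) / sqrt (b\<^sup>2 * (sd t)\<^sup>2)) \<le> C * exceed_prob b c * exp (- 0 / (4 * s1\<^sup>2 * (1 + 2 * K / s0\<^sup>2)))"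
      using b' sd_pos[OF t] by (intro tilt[OF c b' _ _ V X]) auto
    moreover have "b * (gamma_level b - mn t) / sqrt (b\<^sup>2 * (sd t)\<^sup>2) = (gamma_level b - mn t) / sd t"
      using b' sd_pos[OF t] by (simp add: real_sqrt_mult)
    ultimately show ?thesis using t sd_pos[OF t] by (simp add: exceed_prob_eq)
  qed
  then show ?thesis using C by (intro exI[of _ C] conjI exI[of _ b0]) (auto simp: b0_def)
qed

lemma chain_tol_eq: "chain_tol \<theta> n = chain_tol \<theta> 0 / 2 powr (real n * \<theta> / 2)"
  by (simp add: chain_tol_def powr_minus_divide)

text \<open>The central estimate. On the event in question the sum \<open>b f(c) + \<nu> (f(p) - f(q))\<close> exceeds
\<open>b\<^sup>2 - (j + 2) + 2 (j + 1) y\<close>, where \<open>y = 2 powr (n \<theta> / 2)\<close>. By regularity, adding \<open>\<nu> (f(p) - f(q))\<close>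
with \<open>\<nu>\<close> of the order \<open>b y\<^sup>2\<close> changes mean and variance of \<open>b f(c)\<close> by constants only: covariances at level
\<open>n\<close> are of the order \<open>1 / (b\<^sup>2 y\<^sup>4)\<close>. So the tail of a single normal variable, compared with
that of \<open>b f(c)\<close> by \<open>exceed_prob_tilt\<close>, yields a factor exponentially small in \<open>(j + 1) y\<close>; the first-order
term \<open>j + 2\<close> that was given away at the centre is absorbed as well.\<close>

lemma increment_tail_at_level:
  assumes K: "0 \<le> K" and \<theta>: "0 < \<theta>" "\<theta> \<le> 1"
  shows "\<exists>a>0. \<exists>C>0. \<exists>b0\<ge>1. \<forall>b\<ge>b0. \<forall>\<rho>>0. \<forall>c\<in>T. \<forall>j n. \<forall>p\<in>T \<inter> cball c (2 * \<rho>). \<forall>q\<in>T \<inter> cball c (2 * \<rho>).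
    scale_regular K \<theta> b \<rho> \<longrightarrow> dist p q \<le> 6 * \<rho> / 2 ^ n \<longrightarrow>
    measure P {\<omega> \<in> space P. b - real (Suc (Suc j)) * (1 / b) < f c \<omega> \<and>
        real (Suc j) * (1 / b) * chain_tol \<theta> n < f p \<omega> - f q \<omega>}
      \<le> C * exceed_prob b c * chain_weight a \<theta> (Suc j) n"
proof -
  define \<eta> where "\<eta> = chain_tol \<theta> 0"
  have \<eta>: "0 < \<eta>" unfolding \<eta>_def using chain_tol_pos[OF \<theta>(1)] .
  \<comment> \<open>Twice what is needed: one half of the resulting \<open>2 J y\<close> pays for the \<open>J\<close> given away at the centre.\<close>
  define \<kappa> where "\<kappa> = 2 / \<eta>"
  have \<kappa>: "0 < \<kappa>" using \<eta> by (simp add: \<kappa>_def)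
  define K1 where "K1 = 72 * \<kappa> * K + 72 * \<kappa>\<^sup>2 * K"
  define G where "G = 1 + 6 * \<kappa> * K"
  have K1: "0 \<le> K1" and G: "0 \<le> G" using K \<kappa> by (auto simp: K1_def G_def)
  define a where "a = 1 / (4 * s1\<^sup>2 * (1 + K1 / s0\<^sup>2))"
  obtain C where C: "0 < C" and tilt: "\<And>b c J X V. c \<in> T \<Longrightarrow> 1 \<le> b \<Longrightarrow> 2 * m0 \<le> b \<Longrightarrow> 4 * G \<le> b \<Longrightarrow> 0 \<le> J \<Longrightarrow>
    0 < V \<Longrightarrow> V \<le> b\<^sup>2 * (sd c)\<^sup>2 + K1 \<Longrightarrow> b\<^sup>2 - b * mn c + J - G \<le> X \<Longrightarrow>
    gauss_tail (X / sqrt V) \<le> C * exceed_prob b c * exp (- J / (4 * s1\<^sup>2 * (1 + K1 / s0\<^sup>2)))"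
    using exceed_prob_tilt[OF G K1] by auto
  define b0 where "b0 = max 1 (max (2 * m0) (4 * G))"
  have main: "measure P {\<omega> \<in> space P. b - real (Suc (Suc j)) * (1 / b) < f c \<omega> \<and>
        real (Suc j) * (1 / b) * chain_tol \<theta> n < f p \<omega> - f q \<omega>}
      \<le> C * exceed_prob b c * chain_weight a \<theta> (Suc j) n"
    if b: "b0 \<le> b" and \<rho>: "0 < \<rho>" and c: "c \<in> T" and p: "p \<in> T \<inter> cball c (2 * \<rho>)" and q: "q \<in> T \<inter> cball c (2 * \<rho>)"
      and reg: "scale_regular K \<theta> b \<rho>" and d: "dist p q \<le> 6 * \<rho> / 2 ^ n" for b \<rho> c j n p q
  proof -
    have b': "1 \<le> b" "2 * m0 \<le> b" "4 * G \<le> b" using b by (auto simp: b0_def)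
    define y where "y = 2 powr (real n * \<theta> / 2)"
    define z where "z = 2 powr (real n * \<theta>)"
    have y1: "1 \<le> y" using \<theta> by (simp add: y_def ge_one_powr_ge_zero)
    have zy: "z = y * y" by (simp add: z_def y_def powr_add[symmetric] mult.commute)
    have z1: "1 \<le> z" unfolding zy using mult_mono[of 1 y 1 y] y1 by simp
    define J where "J = real (Suc j)"
    have J1: "1 \<le> J" by (simp add: J_def)
    have Jy: "J \<le> J * y" using J1 y1 by simp
    define \<nu> where "\<nu> = \<kappa> * z * b"
    have \<nu>0: "0 < \<nu>" using \<kappa> z1 b' by (simp add: \<nu>_def)
    note inc = scale_regular_increments[OF reg K \<theta> \<rho> c p q d, folded z_def]
    have "\<nu> * (mn p - mn q) \<le> \<kappa> * z * (b * \<bar>mn p - mn q\<bar>)"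
      using \<nu>0 mult_left_mono[of "mn p - mn q" "\<bar>mn p - mn q\<bar>" \<nu>] by (simp add: \<nu>_def mult.assoc)
    also have "\<dots> \<le> \<kappa> * z * (6 * K / z)" using inc(2) \<kappa> z1 by (intro mult_left_mono) auto
    also have "\<dots> = 6 * \<kappa> * K" using z1 by simp
    finally have mean: "b * mn c + \<nu> * mn p + (- \<nu>) * mn q \<le> b * mn c + 6 * \<kappa> * K"
      by (simp add: algebra_simps)
    have v1: "2 * b * \<nu> * (cov c p - cov c q) \<le> 72 * \<kappa> * K"
    proof -
      have "2 * b * \<nu> * (cov c p - cov c q) = 2 * \<kappa> * z * (b\<^sup>2 * (cov c p - cov c q))"
        by (simp add: \<nu>_def power2_eq_square)
      also have "\<dots> \<le> 2 * \<kappa> * z * (b\<^sup>2 * \<bar>cov c p - cov c q\<bar>)"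
        using \<kappa> z1 by (intro mult_left_mono) auto
      also have "\<dots> \<le> 2 * \<kappa> * z * (36 * K / z\<^sup>2)" using inc(1) \<kappa> z1 by (intro mult_left_mono) auto
      also have "\<dots> = 72 * \<kappa> * K / z" using z1 by (simp add: power2_eq_square)
      also have "\<dots> \<le> 72 * \<kappa> * K / 1" using z1 \<kappa> K by (intro divide_left_mono) auto
      finally show ?thesis by simp
    qed
    have v2: "\<nu>\<^sup>2 * (cov p p - 2 * cov p q + cov q q) \<le> 72 * \<kappa>\<^sup>2 * K"
    proof -
      have "\<nu>\<^sup>2 * (cov p p - 2 * cov p q + cov q q) = (\<kappa> * z)\<^sup>2 * (b\<^sup>2 * (cov p p - 2 * cov p q + cov q q))"
        by (simp add: \<nu>_def power_mult_distrib)
      also have "\<dots> \<le> (\<kappa> * z)\<^sup>2 * (72 * K / z\<^sup>2)" using inc(3) by (intro mult_left_mono) auto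
      also have "\<dots> = 72 * \<kappa>\<^sup>2 * K" using z1 by (simp add: power_mult_distrib)
      finally show ?thesis .
    qed
    define V where "V = b\<^sup>2 * (sd c)\<^sup>2 + K1"
    have var: "b\<^sup>2 * cov c c + \<nu>\<^sup>2 * cov p p + (- \<nu>)\<^sup>2 * cov q q
      + 2 * b * \<nu> * cov c p + 2 * b * (- \<nu>) * cov c q + 2 * \<nu> * (- \<nu>) * cov p q \<le> V"
    proof -
      have "b\<^sup>2 * cov c c + \<nu>\<^sup>2 * cov p p + (- \<nu>)\<^sup>2 * cov q q
        + 2 * b * \<nu> * cov c p + 2 * b * (- \<nu>) * cov c q + 2 * \<nu> * (- \<nu>) * cov p q
        = b\<^sup>2 * cov c c + 2 * b * \<nu> * (cov c p - cov c q) + \<nu>\<^sup>2 * (cov p p - 2 * cov p q + cov q q)"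
        by (simp add: algebra_simps power2_eq_square)
      also have "\<dots> \<le> b\<^sup>2 * cov c c + 72 * \<kappa> * K + 72 * \<kappa>\<^sup>2 * K"
        using v1 v2 by linarith
      finally show ?thesis by (simp only: V_def K1_def sd_power2 add.assoc)
    qed
    have V0: "0 < V" using b' sd_pos[OF c] K1 by (simp add: V_def add_pos_nonneg)
    \<comment> \<open>In comparison to \<open>b f(c) > b\<^sup>2\<close>, the level has risen by at least \<open>J y - 1\<close>.\<close>
    define X where "X = b\<^sup>2 - (J + 1) + 2 * J * y"
    have Xge: "b\<^sup>2 - b * mn c + J * y - G \<le> X - (b * mn c + 6 * \<kappa> * K)"
      using Jy by (simp add: X_def G_def)
    have "2 * G \<le> b\<^sup>2 - b * mn c" using level_bounds(3,4)[OF c b' G] by simp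
    then have mX: "b * mn c + 6 * \<kappa> * K \<le> X" using Xge Jy J1 G by linarith
    have "measure P {\<omega> \<in> space P. b - real (Suc (Suc j)) * (1 / b) < f c \<omega> \<and>
        real (Suc j) * (1 / b) * chain_tol \<theta> n < f p \<omega> - f q \<omega>}
      \<le> measure P {\<omega> \<in> space P. X < b * f c \<omega> + \<nu> * f p \<omega> + (- \<nu>) * f q \<omega>}"
    proof (rule finite_measure_mono)
      have [measurable]: "f c \<in> borel_measurable P" "f p \<in> borel_measurable P" "f q \<in> borel_measurable P"
        using c p q measurable_value by auto
      show "{\<omega> \<in> space P. X < b * f c \<omega> + \<nu> * f p \<omega> + (- \<nu>) * f q \<omega>} \<in> sets P" by measurable
      show "{\<omega> \<in> space P. b - real (Suc (Suc j)) * (1 / b) < f c \<omega> \<and>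
        real (Suc j) * (1 / b) * chain_tol \<theta> n < f p \<omega> - f q \<omega>}
        \<subseteq> {\<omega> \<in> space P. X < b * f c \<omega> + \<nu> * f p \<omega> + (- \<nu>) * f q \<omega>}"
      proof safe
        fix \<omega> assume 1: "b - real (Suc (Suc j)) * (1 / b) < f c \<omega>"
          and 2: "real (Suc j) * (1 / b) * chain_tol \<theta> n < f p \<omega> - f q \<omega>"
        have "b * (b - real (Suc (Suc j)) * (1 / b)) < b * f c \<omega>"
          using 1 b' by (intro mult_strict_left_mono) auto
        moreover have "b * (b - real (Suc (Suc j)) * (1 / b)) = b\<^sup>2 - (J + 1)"
          using b' by (simp add: J_def power2_eq_square algebra_simps)
        moreover have "\<nu> * (real (Suc j) * (1 / b) * chain_tol \<theta> n) < \<nu> * (f p \<omega> - f q \<omega>)"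
          using 2 \<nu>0 by (rule mult_strict_left_mono)
        moreover have "\<nu> * (real (Suc j) * (1 / b) * chain_tol \<theta> n) = 2 * J * y"
        proof -
          have "chain_tol \<theta> n = \<eta> / y" unfolding \<eta>_def y_def by (rule chain_tol_eq)
          then show ?thesis using b' \<eta> y1 by (simp add: \<nu>_def \<kappa>_def zy J_def)
        qed
        ultimately show "X < b * f c \<omega> + \<nu> * f p \<omega> + (- \<nu>) * f q \<omega>"
          by (simp add: X_def right_diff_distrib)
      qed
    qed
    also have "\<dots> \<le> gauss_tail ((X - (b * mn c + 6 * \<kappa> * K)) / sqrt V)"
      using c p q by (intro combination_tail_le mean var V0 mX) auto
    also have "\<dots> \<le> C * exceed_prob b c * exp (- (J * y) / (4 * s1\<^sup>2 * (1 + K1 / s0\<^sup>2)))"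
      using J1 y1 by (intro tilt[OF c b' _ V0 _ Xge]) (auto simp: V_def)
    also have "- (J * y) / (4 * s1\<^sup>2 * (1 + K1 / s0\<^sup>2)) = - a * real (Suc j) * 2 powr (real n * \<theta> / 2)"
      by (simp add: a_def J_def y_def)
    finally show ?thesis by (simp only: chain_weight_def)
  qed
  show ?thesis
  proof (cases "T = {}")
    case True
    then show ?thesis by (auto intro!: exI[of _ 1])
  next
    case False
    then obtain c where "c \<in> T" by blast
    then have "0 < s1" using sd_pos[of c] sd_le[of c] by linarith
    then have "0 < a" using K1 unfolding a_def
      by (intro divide_pos_pos mult_pos_pos add_pos_nonneg) auto
    moreover have "1 \<le> b0" by (simp add: b0_def)
    ultimately show ?thesis using C main by blast
  qed
qed

text \<open>The same estimate without the condition on the centre, for the range of bounded levels.\<close>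

lemma increment_tail:
  assumes K: "0 \<le> K" and \<theta>: "0 < \<theta>" "\<theta> \<le> 1"
  shows "\<exists>a>0. \<exists>C>0. \<forall>b>0. \<forall>\<rho>>0. \<forall>c\<in>T. \<forall>j n. \<forall>p\<in>T \<inter> cball c (2 * \<rho>). \<forall>q\<in>T \<inter> cball c (2 * \<rho>).
    scale_regular K \<theta> b \<rho> \<longrightarrow> dist p q \<le> 6 * \<rho> / 2 ^ n \<longrightarrow>
    measure P {\<omega> \<in> space P. real (Suc j) * (1 / b) * chain_tol \<theta> n < f p \<omega> - f q \<omega>}
      \<le> C * chain_weight a \<theta> (Suc j) n"
proof -
  define \<eta> where "\<eta> = chain_tol \<theta> 0"
  have \<eta>: "0 < \<eta>" unfolding \<eta>_def using chain_tol_pos[OF \<theta>(1)] .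
  define V0 where "V0 = sqrt (72 * K + 1)"
  have V0: "0 < V0" using K by (simp add: V0_def)
  define a where "a = \<eta> / V0"
  define C where "C = exp (1 / 2 + 6 * K / V0)"
  have "measure P {\<omega> \<in> space P. real (Suc j) * (1 / b) * chain_tol \<theta> n < f p \<omega> - f q \<omega>}
      \<le> C * chain_weight a \<theta> (Suc j) n"
    if b: "0 < b" and \<rho>: "0 < \<rho>" and c: "c \<in> T" and p: "p \<in> T \<inter> cball c (2 * \<rho>)" and q: "q \<in> T \<inter> cball c (2 * \<rho>)"
      and reg: "scale_regular K \<theta> b \<rho>" and d: "dist p q \<le> 6 * \<rho> / 2 ^ n" for b \<rho> c j n p q
  proof -
    define y where "y = 2 powr (real n * \<theta> / 2)"
    define z where "z = 2 powr (real n * \<theta>)"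
    have y1: "1 \<le> y" using \<theta> by (simp add: y_def ge_one_powr_ge_zero)
    have zy: "z = y * y" by (simp add: z_def y_def powr_add[symmetric] mult.commute)
    have z1: "1 \<le> z" unfolding zy using mult_mono[of 1 y 1 y] y1 by simp
    define J where "J = real (Suc j)"
    note inc = scale_regular_increments[OF reg K \<theta> \<rho> c p q d, folded z_def]
    define u where "u = (J * \<eta> * y - 6 * K) / V0"
    have Ce: "C * chain_weight a \<theta> (Suc j) n = exp (1 / 2 - u)"
    proof -
      have "C * chain_weight a \<theta> (Suc j) n = exp ((1 / 2 + 6 * K / V0) + (- a * J * y))"
        unfolding C_def J_def y_def chain_weight_def by (rule exp_add[symmetric])
      also have "(1 / 2 + 6 * K / V0) + (- a * J * y) = 1 / 2 - u"
        by (simp add: u_def a_def diff_divide_distrib mult_ac)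
      finally show ?thesis .
    qed
    have "measure P {\<omega> \<in> space P. real (Suc j) * (1 / b) * chain_tol \<theta> n < f p \<omega> - f q \<omega>} \<le> exp (1 / 2 - u)"
    proof (cases "0 \<le> u")
      case False
      have "measure P {\<omega> \<in> space P. real (Suc j) * (1 / b) * chain_tol \<theta> n < f p \<omega> - f q \<omega>} \<le> 1" by simp
      also have "1 \<le> exp (1 / 2 - u)" using False by simp
      finally show ?thesis .
    next
      case True
      then have nn: "6 * K \<le> J * \<eta> * y" using V0 by (simp add: u_def zero_le_divide_iff)
      define V where "V = (72 * K + 1) / z\<^sup>2"
      have Vp: "0 < V" using K z1 by (simp add: V_def)
      have tol: "chain_tol \<theta> n = \<eta> / y" unfolding \<eta>_def y_def by (rule chain_tol_eq)
      have ev: "{\<omega> \<in> space P. real (Suc j) * (1 / b) * chain_tol \<theta> n < f p \<omega> - f q \<omega>}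
        = {\<omega> \<in> space P. J * \<eta> / y < 0 * f p \<omega> + b * f p \<omega> + (- b) * f q \<omega>}"
      proof -
        have "J * (1 / b) * (\<eta> / y) < f p \<omega> - f q \<omega> \<longleftrightarrow> J * \<eta> / y < b * (f p \<omega> - f q \<omega>)" for \<omega>
          using mult_less_cancel_left_pos[OF b, of "J * (1 / b) * (\<eta> / y)" "f p \<omega> - f q \<omega>"] b by simp
        then show ?thesis unfolding tol J_def[symmetric] by (simp add: right_diff_distrib)
      qed
      have e1: "6 * K / z \<le> J * \<eta> / y"
        using nn y1 by (simp add: zy divide_le_eq)
      have "b * mn p - b * mn q \<le> b * \<bar>mn p - mn q\<bar>"
        using b mult_left_mono[of "mn p - mn q" "\<bar>mn p - mn q\<bar>" b] by (simp add: right_diff_distrib)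
      then have mean: "0 * mn p + b * mn p + (- b) * mn q \<le> 6 * K / z" using inc(2) by simp
      have "b\<^sup>2 * (cov p p - 2 * cov p q + cov q q) \<le> V"
        using inc(3) by (rule order_trans) (simp add: V_def divide_right_mono)
      then have var: "0\<^sup>2 * cov p p + b\<^sup>2 * cov p p + (- b)\<^sup>2 * cov q q
        + 2 * 0 * b * cov p p + 2 * 0 * (- b) * cov p q + 2 * b * (- b) * cov p q \<le> V"
        by (simp add: algebra_simps power2_eq_square)
      have "measure P {\<omega> \<in> space P. J * \<eta> / y < 0 * f p \<omega> + b * f p \<omega> + (- b) * f q \<omega>}
        \<le> gauss_tail ((J * \<eta> / y - 6 * K / z) / sqrt V)"
        using p q by (intro combination_tail_le mean var Vp e1) auto
      also have "(J * \<eta> / y - 6 * K / z) / sqrt V = u"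
      proof -
        have "sqrt V = V0 / z" using z1 by (simp add: V_def V0_def real_sqrt_divide)
        moreover have "J * \<eta> / y - 6 * K / z = (J * \<eta> * y - 6 * K) / z" using y1 by (simp add: zy field_simps)
        ultimately show ?thesis using z1 by (simp add: u_def)
      qed
      also have "gauss_tail u \<le> exp ((0\<^sup>2 - u\<^sup>2) / 2) * gauss_tail 0"
        by (rule gauss_tail_decay[OF True]) simp
      also have "\<dots> \<le> exp ((0\<^sup>2 - u\<^sup>2) / 2) * 1" by (intro mult_left_mono gauss_tail_le_1) auto
      also have "\<dots> \<le> exp (1 / 2 - u)"
      proof -
        have "0 \<le> (u - 1)\<^sup>2" by simp
        then have "(0\<^sup>2 - u\<^sup>2) / 2 \<le> 1 / 2 - u" by (simp add: power2_eq_square algebra_simps)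
        then show ?thesis by simp
      qed
      finally show ?thesis unfolding ev .
    qed
    then show ?thesis unfolding Ce .
  qed
  moreover have "0 < a" "0 < C" using \<eta> V0 by (auto simp: a_def C_def)
  ultimately show ?thesis by blast
qed

end

section \<open>Summing over a net of cells\<close>

context continuous_gaussian_field
begin

lemma continuous_gaussian_field_subset:
  assumes "compact S" "S \<subseteq> T"
  shows "continuous_gaussian_field P S f"
proof (unfold_locales)
  show "gaussian_field P S f" using gaussian assms(2) by (auto simp: gaussian_field_def)
  show "AE \<omega> in P. continuous_on S (\<lambda>t. f t \<omega>)"
    using continuous_paths by eventually_elim (use assms(2) continuous_on_subset in blast)
qed fact

definition inverse_volume_moment :: "real \<Rightarrow> real \<Rightarrow> ennreal" where
  "inverse_volume_moment b x = (\<integral>\<^sup>+\<omega>. ennreal (indicator {\<omega>. \<exists>t\<in>T. b < f t \<omega>} \<omega> /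
     measure lebesgue (excursion_set T f x \<omega>)) \<partial>P)"

text \<open>A path that exceeds \<open>b\<close> somewhere exceeds it in some cell. Measurability with respect to the
completion is what allows the integral to be interchanged with the sum.\<close>

lemma inverse_volume_moment_le_cells:
  assumes N: "finite N" "\<And>t. t \<in> T \<Longrightarrow> \<exists>c\<in>N. dist t c \<le> \<rho>"
  shows "inverse_volume_moment b x \<le> (\<Sum>c\<in>N. cell_volume_moment c \<rho> b x)"
proof -
  let ?V = "\<lambda>\<omega>. measure lebesgue (excursion_set T f x \<omega>)"
  let ?I = "\<lambda>c. {\<omega>. \<exists>t\<in>T \<inter> cball c \<rho>. b < f t \<omega>}"
  have m: "(\<lambda>\<omega>. ennreal (indicator (?I c) \<omega> / ?V \<omega>)) \<in> borel_measurable (completion P)" for c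
  proof -
    interpret cell: continuous_gaussian_field P "T \<inter> cball c \<rho>" f
      using compact_T by (intro continuous_gaussian_field_subset) auto
    have E [measurable]: "{\<omega> \<in> space P. \<exists>t\<in>T \<inter> cball c \<rho>. b < f t \<omega>} \<in> sets (completion P)"
      using cell.exceeds_event_sets[of b] unfolding cell.exceeds_event_eq .
    have [measurable]: "?V \<in> borel_measurable (completion P)" by (rule excursion_volume_measurable)
    have "(\<lambda>\<omega>. ennreal (indicator {\<omega> \<in> space P. \<exists>t\<in>T \<inter> cball c \<rho>. b < f t \<omega>} \<omega> / ?V \<omega>))
        \<in> borel_measurable (completion P)" by measurable
    then show ?thesis
      by (subst measurable_cong[where g="\<lambda>\<omega>. ennreal (indicator {\<omega> \<in> space P. \<exists>t\<in>T \<inter> cball c \<rho>. b < f t \<omega>} \<omega> / ?V \<omega>)"])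
        (auto simp: indicator_def)
  qed
  have "inverse_volume_moment b x = (\<integral>\<^sup>+\<omega>. ennreal (indicator {\<omega>. \<exists>t\<in>T. b < f t \<omega>} \<omega> / ?V \<omega>) \<partial>completion P)"
    by (simp add: inverse_volume_moment_def nn_integral_completion)
  also have "\<dots> \<le> (\<integral>\<^sup>+\<omega>. (\<Sum>c\<in>N. ennreal (indicator (?I c) \<omega> / ?V \<omega>)) \<partial>completion P)"
  proof (rule nn_integral_mono)
    fix \<omega>
    show "ennreal (indicator {\<omega>. \<exists>t\<in>T. b < f t \<omega>} \<omega> / ?V \<omega>) \<le> (\<Sum>c\<in>N. ennreal (indicator (?I c) \<omega> / ?V \<omega>))"
    proof (cases "\<exists>t\<in>T. b < f t \<omega>")
      case True
      then obtain t where "t \<in> T" "b < f t \<omega>" by blast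
      moreover obtain c where "c \<in> N" "dist t c \<le> \<rho>" using N(2)[OF \<open>t \<in> T\<close>] by blast
      ultimately have "\<omega> \<in> ?I c" by (auto simp: dist_commute)
      then have "ennreal (indicator {\<omega>. \<exists>t\<in>T. b < f t \<omega>} \<omega> / ?V \<omega>) = (\<Sum>c\<in>{c}. ennreal (indicator (?I c) \<omega> / ?V \<omega>))"
        using True by (simp add: indicator_def)
      also have "\<dots> \<le> (\<Sum>c\<in>N. ennreal (indicator (?I c) \<omega> / ?V \<omega>))"
        using N(1) \<open>c \<in> N\<close> by (intro sum_mono2) auto
      finally show ?thesis .
    next
      case False
      then have "indicator {\<omega>. \<exists>t\<in>T. b < f t \<omega>} \<omega> / ?V \<omega> = 0" by (simp add: indicator_def)
      then show ?thesis by (simp only: ennreal_0 zero_le)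
    qed
  qed
  also have "\<dots> = (\<Sum>c\<in>N. \<integral>\<^sup>+\<omega>. ennreal (indicator (?I c) \<omega> / ?V \<omega>) \<partial>completion P)"
    using m by (intro nn_integral_sum) auto
  finally show ?thesis by (simp only: nn_integral_completion cell_volume_moment_def)
qed

lemma mean_excursion_volume_le_cells:
  assumes N: "finite N" "\<And>t. t \<in> T \<Longrightarrow> \<exists>c\<in>N. dist t c \<le> \<rho>" and "0 \<le> \<rho>"
    and D: "\<And>c t. c \<in> N \<Longrightarrow> t \<in> T \<Longrightarrow> dist c t \<le> \<rho> \<Longrightarrow> exceed_prob x t \<le> D c"
    and D0: "\<And>c. c \<in> N \<Longrightarrow> 0 \<le> D c"
  shows "mean_excursion_volume P T f x \<le> \<rho> ^ DIM('a) * measure lborel (cball (0::'a) 1) * (\<Sum>c\<in>N. D c)"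
proof -
  have ic: "integrable lborel (\<lambda>t. D c * indicator (cball c \<rho>) t)" for c :: 'a
    using emeasure_lborel_cball_finite[of c \<rho>] by (intro integrable_mult_right integrable_real_indicator) auto
  have "mean_excursion_volume P T f x \<le> (\<integral>t. (\<Sum>c\<in>N. D c * indicator (cball c \<rho>) t) \<partial>lborel)"
    unfolding mean_excursion_volume_eq
  proof (rule integral_mono)
    show "integrable lborel (\<lambda>t. indicator T t * exceed_prob x t)" by (rule exceed_prob_integrable)
    show "integrable lborel (\<lambda>t. \<Sum>c\<in>N. D c * indicator (cball c \<rho>) t)" using ic by auto
    fix t
    show "indicator T t * exceed_prob x t \<le> (\<Sum>c\<in>N. D c * indicator (cball c \<rho>) t)"
    proof (cases "t \<in> T")
      case True
      then obtain c where c: "c \<in> N" "dist t c \<le> \<rho>" using N(2) by blast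
      then have "indicator T t * exceed_prob x t \<le> (\<Sum>c\<in>{c}. D c * indicator (cball c \<rho>) t)"
        using True D[of c t] by (simp add: dist_commute)
      also have "\<dots> \<le> (\<Sum>c\<in>N. D c * indicator (cball c \<rho>) t)"
        using c N(1) D0 by (intro sum_mono2) auto
      finally show ?thesis .
    qed (use D0 in \<open>auto intro!: sum_nonneg\<close>)
  qed
  also have "\<dots> = (\<Sum>c\<in>N. D c * measure lborel (cball c \<rho>))"
    using ic by (subst Bochner_Integration.integral_sum) auto
  also have "\<dots> = (\<Sum>c\<in>N. D c * (\<rho> ^ DIM('a) * measure lborel (cball (0::'a) 1)))"
  proof (rule sum.cong[OF refl])
    fix c :: 'a
    have "measure lborel (cball c \<rho>) = \<rho> ^ DIM('a) * measure lborel (cball (0::'a) 1)"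
      using content_cball[OF \<open>0 \<le> \<rho>\<close>, of c] content_cball[of 1 "0::'a"] by simp
    then show "D c * measure lborel (cball c \<rho>) = D c * (\<rho> ^ DIM('a) * measure lborel (cball (0::'a) 1))" by simp
  qed
  also have "\<dots> = \<rho> ^ DIM('a) * measure lborel (cball (0::'a) 1) * (\<Sum>c\<in>N. D c)"
    by (simp only: sum_distrib_right[symmetric] mult.commute)
  finally show ?thesis .
qed

end

context bounded_gaussian_field
begin

text \<open>Both factors of the second moment are bounded by the same sum over the net, and the powers of \<open>\<rho>\<close>
cancel in their product.\<close>

lemma moments_at_level:
  assumes \<kappa>: "0 < \<kappa>"
    and dens: "ball_volume_bound T \<kappa> \<epsilon>0"
    and K: "0 \<le> K" and \<theta>: "0 < \<theta>" "\<theta> \<le> 1"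
  shows "\<exists>C>0. \<exists>b0\<ge>1. \<forall>b\<ge>b0. \<forall>\<rho> N. 0 < \<rho> \<longrightarrow> \<rho> < \<epsilon>0 \<longrightarrow> scale_regular K \<theta> b \<rho> \<longrightarrow> finite N \<longrightarrow> N \<subseteq> T \<longrightarrow>
    (\<forall>t\<in>T. \<exists>c\<in>N. dist t c \<le> \<rho>) \<longrightarrow>
    inverse_volume_moment b (gamma_level b) \<le> ennreal (C * (\<Sum>c\<in>N. exceed_prob b c) / \<rho> ^ DIM('a)) \<and>
    mean_excursion_volume P T f (gamma_level b) \<le> C * (\<Sum>c\<in>N. exceed_prob b c) * \<rho> ^ DIM('a)"
proof -
  let ?d = "DIM('a)"
  from increment_tail_at_level[OF K \<theta>]
  obtain a C1 b1 where a: "0 < a" and C1: "0 < C1" and b1: "1 \<le> b1"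
    and inc: "\<forall>b\<ge>b1. \<forall>\<rho>>0. \<forall>c\<in>T. \<forall>j n. \<forall>p\<in>T \<inter> cball c (2 * \<rho>). \<forall>q\<in>T \<inter> cball c (2 * \<rho>).
    scale_regular K \<theta> b \<rho> \<longrightarrow> dist p q \<le> 6 * \<rho> / 2 ^ n \<longrightarrow>
    measure P {\<omega> \<in> space P. b - real (Suc (Suc j)) * (1 / b) < f c \<omega> \<and>
        real (Suc j) * (1 / b) * chain_tol \<theta> n < f p \<omega> - f q \<omega>}
      \<le> C1 * exceed_prob b c * chain_weight a \<theta> (Suc j) n"
    by (elim exE conjE)
  from exceed_prob_cell[OF K \<theta>(1)]
  obtain C2 b2 where C2: "0 < C2" and b2: "1 \<le> b2"
    and cell: "\<forall>b\<ge>b2. \<forall>\<rho>>0. \<forall>c\<in>T. \<forall>t\<in>T. scale_regular K \<theta> b \<rho> \<longrightarrow> dist c t \<le> \<rho> \<longrightarrow>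
      exceed_prob (gamma_level b) t \<le> C2 * exceed_prob b c"
    by (elim exE conjE)
  from local_excursion_bound[OF \<kappa> dens \<theta>(1) a]
  obtain C3 where C3: "0 < C3" and loc: "\<forall>\<rho> c \<epsilon> \<beta> x B E. 0 < \<rho> \<longrightarrow> \<rho> < \<epsilon>0 \<longrightarrow> c \<in> T \<longrightarrow> 0 < \<epsilon> \<longrightarrow> x \<le> \<beta> - \<epsilon> \<longrightarrow> 0 \<le> B \<longrightarrow>
    (\<forall>j. \<forall>\<omega>\<in>space P. \<beta> - real (Suc j) * \<epsilon> < f c \<omega> \<longrightarrow> \<omega> \<in> E j) \<longrightarrow>
    dominated_increments a \<theta> \<rho> c \<epsilon> B E \<longrightarrow>
    cell_volume_moment c \<rho> \<beta> x \<le> ennreal (C3 * B / \<rho> ^ DIM('a))"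
    by (elim exE conjE)
  define B0 where "B0 = max C1 C2"
  have B0: "0 < B0" "C1 \<le> B0" "C2 \<le> B0" using C1 by (auto simp: B0_def)
  define W where "W = measure lborel (cball (0::'a) 1)"
  have W: "0 \<le> W" by (simp add: W_def)
  define C where "C = max (C3 * B0) (C2 * W)"
  have C: "0 < C" "C3 * B0 \<le> C" "C2 * W \<le> C" using C3 B0 by (auto simp: C_def less_max_iff_disj)
  have "inverse_volume_moment b (gamma_level b) \<le> ennreal (C * (\<Sum>c\<in>N. exceed_prob b c) / \<rho> ^ ?d) \<and>
    mean_excursion_volume P T f (gamma_level b) \<le> C * (\<Sum>c\<in>N. exceed_prob b c) * \<rho> ^ ?d"
    if b: "max b1 b2 \<le> b" and \<rho>: "0 < \<rho>" "\<rho> < \<epsilon>0" and reg: "scale_regular K \<theta> b \<rho>" and N: "finite N" "N \<subseteq> T"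
      "\<forall>t\<in>T. \<exists>c\<in>N. dist t c \<le> \<rho>" for b \<rho> N
  proof -
    have bb: "b1 \<le> b" "b2 \<le> b" "1 \<le> b" "0 < b" using b b1 by auto
    have "cell_volume_moment c \<rho> b (gamma_level b) \<le> ennreal (C3 * (B0 * exceed_prob b c) / \<rho> ^ ?d)"
      if "c \<in> N" for c
    proof -
      have c: "c \<in> T" using that N by auto
      define E where "E j = {\<omega> \<in> space P. b - real (Suc j) * (1 / b) < f c \<omega>}" for j
      have [measurable]: "f c \<in> borel_measurable P" using c measurable_value by auto
      have Es: "\<forall>j. E j \<in> sets P" unfolding E_def by measurable
      have E0: "measure P (E 0) \<le> B0 * exceed_prob b c"
      proof -
        have "measure P (E 0) = exceed_prob (gamma_level b) c" by (simp add: E_def gamma_level_def)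
        also have "\<dots> \<le> C2 * exceed_prob b c" using cell bb \<rho> c reg by auto
        also have "\<dots> \<le> B0 * exceed_prob b c" using B0 by (intro mult_right_mono) auto
        finally show ?thesis .
      qed
      have pr: "measure P {\<omega> \<in> E (Suc j). real (Suc j) * (1 / b) * chain_tol \<theta> n < f p \<omega> - f q \<omega>}
        \<le> B0 * exceed_prob b c * chain_weight a \<theta> (Suc j) n"
        if pq: "p \<in> T \<inter> cball c (2 * \<rho>)" "q \<in> T \<inter> cball c (2 * \<rho>)" "dist p q \<le> 6 * \<rho> / 2 ^ n" for j n p q
      proof -
        have "measure P {\<omega> \<in> E (Suc j). real (Suc j) * (1 / b) * chain_tol \<theta> n < f p \<omega> - f q \<omega>}
          = measure P {\<omega> \<in> space P. b - real (Suc (Suc j)) * (1 / b) < f c \<omega> \<and>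
            real (Suc j) * (1 / b) * chain_tol \<theta> n < f p \<omega> - f q \<omega>}"
          by (rule arg_cong[where f="measure P"]) (auto simp: E_def)
        also have "\<dots> \<le> C1 * exceed_prob b c * chain_weight a \<theta> (Suc j) n"
          using inc[rule_format, OF bb(1) \<rho>(1) c pq(1,2) reg pq(3)] .
        also have "\<dots> \<le> B0 * exceed_prob b c * chain_weight a \<theta> (Suc j) n"
          using B0 by (intro mult_right_mono) (auto simp: chain_weight_def)
        finally show ?thesis .
      qed
      show ?thesis
        by (rule loc[rule_format, where \<epsilon>="1 / b" and E=E, OF \<rho> c])
          (use bb Es E0 pr B0 in \<open>auto simp: gamma_level_def E_def dominated_increments_def\<close>)
    qed
    then have "inverse_volume_moment b (gamma_level b) \<le> (\<Sum>c\<in>N. ennreal (C3 * (B0 * exceed_prob b c) / \<rho> ^ ?d))"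
      using N by (intro order_trans[OF inverse_volume_moment_le_cells[of N \<rho>]] sum_mono) auto
    also have "\<dots> = ennreal (\<Sum>c\<in>N. C3 * (B0 * exceed_prob b c) / \<rho> ^ ?d)"
      using C3 B0 \<rho> by (intro sum_ennreal) auto
    also have "(\<Sum>c\<in>N. C3 * (B0 * exceed_prob b c) / \<rho> ^ ?d) = (C3 * B0) * (\<Sum>c\<in>N. exceed_prob b c) / \<rho> ^ ?d"
      by (simp add: sum_distrib_left sum_divide_distrib mult.assoc)
    also have "ennreal \<dots> \<le> ennreal (C * (\<Sum>c\<in>N. exceed_prob b c) / \<rho> ^ ?d)"
      using C \<rho> by (intro ennreal_leI divide_right_mono mult_right_mono sum_nonneg) auto
    finally have 1: "inverse_volume_moment b (gamma_level b) \<le> ennreal (C * (\<Sum>c\<in>N. exceed_prob b c) / \<rho> ^ ?d)" .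
    have "mean_excursion_volume P T f (gamma_level b) \<le> \<rho> ^ ?d * W * (\<Sum>c\<in>N. C2 * exceed_prob b c)"
      unfolding W_def
    proof (rule mean_excursion_volume_le_cells)
      show "exceed_prob (gamma_level b) t \<le> C2 * exceed_prob b c"
        if "c \<in> N" "t \<in> T" "dist c t \<le> \<rho>" for c t
        using cell bb \<rho> reg that N by auto
    qed (use N \<rho> C2 in auto)
    also have "\<dots> = (C2 * W) * (\<Sum>c\<in>N. exceed_prob b c) * \<rho> ^ ?d"
      by (simp add: sum_distrib_left[symmetric] mult_ac)
    also have "\<dots> \<le> C * (\<Sum>c\<in>N. exceed_prob b c) * \<rho> ^ ?d"
      using C \<rho> by (intro mult_right_mono sum_nonneg) auto
    finally show ?thesis using 1 by blast
  qed
  then show ?thesis using C(1) b1 by (intro exI[of _ C] conjI exI[of _ "max b1 b2"]) auto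
qed

text \<open>For levels below \<open>b1\<close> the gap between \<open>b\<close> and \<open>\<gamma>\<close> is at least \<open>1 / b1\<close>, so the tolerance and the
scale of the fixed level \<open>b1\<close> serve for all of them.\<close>

lemma inverse_volume_moment_bounded:
  assumes \<kappa>: "0 < \<kappa>"
    and dens: "ball_volume_bound T \<kappa> \<epsilon>0"
    and K: "0 \<le> K" and \<theta>: "0 < \<theta>" "\<theta> \<le> 1"
    and b1: "0 < b1" and \<rho>: "0 < \<rho>" "\<rho> < \<epsilon>0" and reg: "scale_regular K \<theta> b1 \<rho>"
  shows "\<exists>C>0. \<forall>b. 0 < b \<longrightarrow> b \<le> b1 \<longrightarrow> inverse_volume_moment b (gamma_level b) \<le> ennreal C"
proof -
  let ?d = "DIM('a)"
  from increment_tail[OF K \<theta>]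
  obtain a C1 where a: "0 < a" and C1: "0 < C1"
    and inc: "\<forall>b>0. \<forall>\<rho>>0. \<forall>c\<in>T. \<forall>j n. \<forall>p\<in>T \<inter> cball c (2 * \<rho>). \<forall>q\<in>T \<inter> cball c (2 * \<rho>).
    scale_regular K \<theta> b \<rho> \<longrightarrow> dist p q \<le> 6 * \<rho> / 2 ^ n \<longrightarrow>
    measure P {\<omega> \<in> space P. real (Suc j) * (1 / b) * chain_tol \<theta> n < f p \<omega> - f q \<omega>}
      \<le> C1 * chain_weight a \<theta> (Suc j) n"
    by (elim exE conjE)
  from local_excursion_bound[OF \<kappa> dens \<theta>(1) a]
  obtain C3 where C3: "0 < C3" and loc: "\<forall>\<rho> c \<epsilon> \<beta> x B E. 0 < \<rho> \<longrightarrow> \<rho> < \<epsilon>0 \<longrightarrow> c \<in> T \<longrightarrow> 0 < \<epsilon> \<longrightarrow> x \<le> \<beta> - \<epsilon> \<longrightarrow> 0 \<le> B \<longrightarrow>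
    (\<forall>j. \<forall>\<omega>\<in>space P. \<beta> - real (Suc j) * \<epsilon> < f c \<omega> \<longrightarrow> \<omega> \<in> E j) \<longrightarrow>
    dominated_increments a \<theta> \<rho> c \<epsilon> B E \<longrightarrow>
    cell_volume_moment c \<rho> \<beta> x \<le> ennreal (C3 * B / \<rho> ^ DIM('a))"
    by (elim exE conjE)
  obtain N where N: "finite N" "N \<subseteq> T" "\<And>x. x \<in> T \<Longrightarrow> \<exists>c\<in>N. dist x c \<le> \<rho>"
    using compact_separated_net[OF compact_T \<rho>(1)] by metis
  define B where "B = max 1 C1"
  define C where "C = 1 + real (card N) * (C3 * B / \<rho> ^ ?d)"
  have "inverse_volume_moment b (gamma_level b) \<le> ennreal C" if b: "0 < b" "b \<le> b1" for b
  proof -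
    have "cell_volume_moment c \<rho> b (gamma_level b) \<le> ennreal (C3 * B / \<rho> ^ ?d)"
      if "c \<in> N" for c
    proof -
      have c: "c \<in> T" using that N by auto
      have pr: "measure P {\<omega> \<in> space P. real (Suc j) * (1 / b1) * chain_tol \<theta> n < f p \<omega> - f q \<omega>}
        \<le> B * chain_weight a \<theta> (Suc j) n"
        if pq: "p \<in> T \<inter> cball c (2 * \<rho>)" "q \<in> T \<inter> cball c (2 * \<rho>)" "dist p q \<le> 6 * \<rho> / 2 ^ n" for j n p q
        using inc[rule_format, OF b1 \<rho>(1) c pq(1,2) reg pq(3), of j]
        by (rule order_trans) (auto simp: B_def chain_weight_def intro!: mult_right_mono)
      have "1 / b1 \<le> 1 / b" using b by (intro divide_left_mono) auto
      then show ?thesis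
        by (intro loc[rule_format, where \<epsilon>="1 / b1" and E="\<lambda>_. space P", OF \<rho> c])
          (use b1 pr in \<open>auto simp: gamma_level_def B_def prob_space dominated_increments_def\<close>)
    qed
    then have "inverse_volume_moment b (gamma_level b) \<le> (\<Sum>c\<in>N. ennreal (C3 * B / \<rho> ^ ?d))"
      using N by (intro order_trans[OF inverse_volume_moment_le_cells[of N \<rho>]] sum_mono) auto
    also have "\<dots> = ennreal (real (card N) * (C3 * B / \<rho> ^ ?d))"
      using C3 \<rho> by (subst sum_ennreal) (auto simp: B_def)
    also have "\<dots> \<le> ennreal C" by (intro ennreal_leI) (simp add: C_def)
    finally show ?thesis .
  qed
  moreover have "0 < C" unfolding C_def B_def using C3 \<rho> by (intro add_pos_nonneg mult_nonneg_nonneg divide_nonneg_nonneg) auto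
  ultimately show ?thesis by blast
qed

end

section \<open>The scale at which the field is regular\<close>

lemma slowly_varying_mult_powr_bounded:
  assumes sv: "slowly_varying_at_zero L" and "0 < \<alpha>"
  obtains M where "0 < M" "\<And>x. 0 < x \<Longrightarrow> x \<le> D \<Longrightarrow> L x * x powr \<alpha> \<le> M"
proof -
  obtain x0 A where x0: "0 < x0" and A: "0 < A" and P: "\<And>x. 0 < x \<Longrightarrow> x \<le> x0 \<Longrightarrow> L x * x powr \<alpha> \<le> A * x powr (\<alpha> / 2)"
    using slowly_varying_mult_powr_tendsto[OF sv assms(2)] by blast
  have "continuous_on {x0..D} (\<lambda>x. L x * x powr \<alpha>)"
    using x0 by (intro continuous_intros continuous_on_subset[OF slowly_varying_continuous[OF sv]]) auto
  then have "bounded ((\<lambda>x. L x * x powr \<alpha>) ` {x0..D})"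
    by (intro compact_imp_bounded compact_continuous_image) auto
  then obtain B where "\<forall>y\<in>(\<lambda>x. L x * x powr \<alpha>) ` {x0..D}. norm y \<le> B"
    unfolding bounded_iff by blast
  then have B: "\<bar>L x * x powr \<alpha>\<bar> \<le> B" if "x \<in> {x0..D}" for x
  proof -
    have "L x * x powr \<alpha> \<in> (\<lambda>x. L x * x powr \<alpha>) ` {x0..D}" using that by (rule imageI)
    with \<open>\<forall>y\<in>_. norm y \<le> B\<close> have "norm (L x * x powr \<alpha>) \<le> B" by blast
    then show ?thesis by simp
  qed
  define M where "M = max (A * x0 powr (\<alpha> / 2)) B"
  have "L x * x powr \<alpha> \<le> M" if "0 < x" "x \<le> D" for x
  proof (cases "x \<le> x0")
    case True
    have "L x * x powr \<alpha> \<le> A * x powr (\<alpha> / 2)" using P that True by blast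
    also have "\<dots> \<le> A * x0 powr (\<alpha> / 2)" using A True that assms by (intro mult_left_mono powr_mono2) auto
    also have "\<dots> \<le> M" by (simp add: M_def)
    finally show ?thesis .
  next
    case False
    then have "\<bar>L x * x powr \<alpha>\<bar> \<le> B" using that by (intro B) auto
    then show ?thesis by (simp add: M_def)
  qed
  moreover have "0 < M" using A x0 by (simp add: M_def less_max_iff_disj)
  ultimately show thesis using that by blast
qed

text \<open>The form of the regularity bound on the correlation, at a critical scale. Half of the exponent
\<open>\<beta>1\<close> is spent on the slowly varying factor, for \<open>x\<close> may be much smaller than \<open>u\<close>, but not than \<open>y\<close>.\<close>

lemma scaled_increment_bound:
  assumes sv: "slowly_varying_at_zero L" and \<beta>: "0 \<le> \<beta>0" "0 < \<beta>1" "\<alpha> \<le> \<beta>0 + \<beta>1"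
  obtains x1 A where "0 < x1" "0 < A"
    "\<And>b u x y. 0 < u \<Longrightarrow> u \<le> x1 \<Longrightarrow> critical_scale L \<alpha> b u \<Longrightarrow> 0 < y \<Longrightarrow> y \<le> 2 * x \<Longrightarrow> x \<le> 8 * u \<Longrightarrow>
      b\<^sup>2 * (L x * x powr \<beta>0 * y powr \<beta>1) \<le> A * (y / u) powr (\<beta>1 / 2)"
proof -
  have e: "0 < \<beta>1 / 2" using \<beta> by simp
  obtain x0 A0 where x0: "0 < x0" and A0: "1 \<le> A0"
    and up: "\<And>u x. 0 < u \<Longrightarrow> 8 * u \<le> x0 \<Longrightarrow> 0 < x \<Longrightarrow> x \<le> 8 * u \<Longrightarrow> L x \<le> A0 * (x / u) powr (- (\<beta>1 / 2)) * L u"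
    using slowly_varying_upper_near[OF sv e, of 8] by auto
  define A where "A = A0 * 2 powr (\<beta>1 / 2) * 8 powr \<beta>0"
  have A: "0 < A" using A0 by (simp add: A_def)
  have "b\<^sup>2 * (L x * x powr \<beta>0 * y powr \<beta>1) \<le> A * (y / u) powr (\<beta>1 / 2)"
    if u: "0 < u" "u \<le> min 1 (x0 / 8)" and eq: "critical_scale L \<alpha> b u"
      and y: "0 < y" "y \<le> 2 * x" and x: "x \<le> 8 * u" for b u x y
  proof -
    have x0': "0 < x" using y by linarith
    have Lu: "0 < L u" using slowly_varying_pos[OF sv] u by blast
    have b2: "b\<^sup>2 * L u = u powr (- \<alpha>)"
      using eq u by (simp add: critical_scale_def powr_minus field_simps)
    have "b\<^sup>2 * (L x * x powr \<beta>0 * y powr \<beta>1) \<le> b\<^sup>2 * ((A0 * (x / u) powr (- (\<beta>1 / 2)) * L u) * x powr \<beta>0 * y powr \<beta>1)"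
      using up[of u x] u x x0' by (intro mult_left_mono mult_right_mono) auto
    also have "\<dots> = A0 * (x / u) powr (- (\<beta>1 / 2)) * (b\<^sup>2 * L u) * x powr \<beta>0 * y powr \<beta>1" by (simp add: mult_ac)
    also have "\<dots> \<le> A0 * (x / u) powr (- (\<beta>1 / 2)) * u powr (- (\<beta>0 + \<beta>1)) * x powr \<beta>0 * y powr \<beta>1"
      unfolding b2 using u \<beta> A0 by (intro mult_right_mono mult_left_mono powr_mono') auto
    also have "\<dots> = A0 * (x / u) powr (- (\<beta>1 / 2)) * (x / u) powr \<beta>0 * (y / u) powr \<beta>1"
    proof -
      have "(z / u) powr e = z powr e * u powr (- e)" if "0 < z" for z e
        using u that by (simp add: powr_divide powr_minus_divide)
      then have "(x / u) powr \<beta>0 = x powr \<beta>0 * u powr (- \<beta>0)" "(y / u) powr \<beta>1 = y powr \<beta>1 * u powr (- \<beta>1)"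
        using x0' y by auto
      moreover have "u powr (- (\<beta>0 + \<beta>1)) = u powr (- \<beta>0) * u powr (- \<beta>1)"
        by (simp add: powr_add[symmetric])
      ultimately show ?thesis by (simp only: mult_ac)
    qed
    also have "\<dots> \<le> A0 * ((y / u) / 2) powr (- (\<beta>1 / 2)) * 8 powr \<beta>0 * (y / u) powr \<beta>1"
      using u x0' y x \<beta> A0
      by (intro mult_right_mono mult_mono mult_left_mono powr_mono2 powr_mono2') (auto simp: field_simps)
    also have "\<dots> = A * ((y / u) powr (- (\<beta>1 / 2)) * (y / u) powr \<beta>1)"
    proof -
      have "((y / u) / 2) powr (- (\<beta>1 / 2)) = 2 powr (\<beta>1 / 2) * (y / u) powr (- (\<beta>1 / 2))"
        using u y by (subst powr_divide) (auto simp: powr_minus_divide)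
      then show ?thesis by (simp add: A_def mult_ac)
    qed
    also have "(y / u) powr (- (\<beta>1 / 2)) * (y / u) powr \<beta>1 = (y / u) powr (\<beta>1 / 2)"
      by (simp add: powr_add[symmetric])
    finally show ?thesis .
  qed
  then show thesis using that[of "min 1 (x0 / 8)" A] x0 A by auto
qed

lemma scaled_increment_bound_simple:
  assumes sv: "slowly_varying_at_zero L" and \<alpha>: "0 < \<alpha>"
  obtains x1 A where "0 < x1" "0 < A"
    "\<And>b u y. 0 < u \<Longrightarrow> u \<le> x1 \<Longrightarrow> critical_scale L \<alpha> b u \<Longrightarrow> 0 < y \<Longrightarrow> y \<le> 8 * u \<Longrightarrow>
      b\<^sup>2 * (L y * y powr \<alpha>) \<le> A * (y / u) powr (\<alpha> / 2)"
proof -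
  obtain x1 A where x1: "0 < x1" and A: "0 < A" and inc: "\<And>b u x y. 0 < u \<Longrightarrow> u \<le> x1 \<Longrightarrow> critical_scale L \<alpha> b u \<Longrightarrow> 0 < y \<Longrightarrow> y \<le> 2 * x \<Longrightarrow> x \<le> 8 * u \<Longrightarrow>
      b\<^sup>2 * (L x * x powr 0 * y powr \<alpha>) \<le> A * (y / u) powr (\<alpha> / 2)"
    using scaled_increment_bound[OF sv order_refl \<alpha>, of \<alpha>] by auto
  show thesis
  proof (rule that[OF x1 A])
    fix b u y assume "0 < u" "u \<le> x1" "critical_scale L \<alpha> b u" "0 < y" "y \<le> 8 * u"
    then show "b\<^sup>2 * (L y * y powr \<alpha>) \<le> A * (y / u) powr (\<alpha> / 2)"
      using inc[of u b y y] by simp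
  qed
qed

text \<open>Exponents of the form \<open>b\<^sup>2 L(h) h\<^sup>\<alpha>\<close> grow at least like a power of \<open>h / u\<close>, where \<open>u\<close> is the critical
scale. For distances \<open>h\<close> bounded away from zero the exponent is of the order \<open>b\<^sup>2\<close>, and decay in
\<open>h / u\<close> follows because \<open>1 / u\<close> is at most a power of \<open>b\<close>. Both are turned into the polynomial decay
that can be summed over a net.\<close>

lemma scaled_exp_decay:
  assumes sv: "slowly_varying_at_zero L" and \<alpha>: "0 < \<alpha>" and a: "0 < a" and q: "0 \<le> q" and D: "0 \<le> D"
  obtains x1 A where "0 < x1" "1 \<le> A"
    "\<And>b u h. 1 \<le> b \<Longrightarrow> 0 < u \<Longrightarrow> u \<le> x1 \<Longrightarrow> critical_scale L \<alpha> b u \<Longrightarrow> u \<le> h \<Longrightarrow> h \<le> x1 \<Longrightarrow>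
      exp (- a * (b\<^sup>2 * (L h * h powr \<alpha>))) \<le> A * (1 + h / u) powr (- q)"
    "\<And>b u h. 1 \<le> b \<Longrightarrow> 0 < u \<Longrightarrow> u \<le> x1 \<Longrightarrow> critical_scale L \<alpha> b u \<Longrightarrow> 0 \<le> h \<Longrightarrow> h \<le> D \<Longrightarrow>
      exp (- a * b\<^sup>2) \<le> A * (1 + h / u) powr (- q)"
proof -
  have \<alpha>2: "0 < \<alpha> / 2" using \<alpha> by simp
  obtain x0 A' where x0: "0 < x0" and A': "1 \<le> A'"
    and pot: "\<And>x y. 0 < x \<Longrightarrow> x \<le> y \<Longrightarrow> y \<le> x0 \<Longrightarrow> L x \<le> A' * (y / x) powr (\<alpha> / 2) * L y"
    by (rule potter_bounds[OF sv \<alpha>2]) blast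
  have aA: "0 < a / A'" using a A' by simp
  obtain A1 where A1: "1 \<le> A1" "\<And>y. 1 \<le> y \<Longrightarrow> exp (- (a / A') * y powr (\<alpha> / 2)) \<le> A1 * (1 + y) powr (- q)"
    using exp_neg_powr_le[OF aA q \<alpha>2] by blast
  obtain x2 B where x2: "0 < x2" and B: "0 < B"
    and low: "\<And>b u. 0 < u \<Longrightarrow> u \<le> x2 \<Longrightarrow> critical_scale L \<alpha> b u \<Longrightarrow> 1 / u \<le> (B * b\<^sup>2) powr (2 / \<alpha>)"
    using scale_lower_bound[OF sv \<alpha>] by blast
  have q2: "0 \<le> 2 / \<alpha> * q" using \<alpha> q by simp
  obtain A2 where A2: "0 < A2" "\<And>z. 1 \<le> z \<Longrightarrow> exp (- a * z) \<le> A2 * z powr (- (2 / \<alpha> * q))"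
    using exp_neg_le_powr[OF a q2] by blast
  define A3 where "A3 = A2 * ((1 + D) powr q * B powr (2 / \<alpha> * q))"
  define A where "A = max A1 A3"
  define x1 where "x1 = min 1 (min x0 x2)"
  show thesis
  proof (rule that[of x1 A])
    show "0 < x1" using x0 x2 by (simp add: x1_def)
    show "1 \<le> A" using A1 by (simp add: A_def)
    fix b u h :: real
    assume b: "1 \<le> b" and u: "0 < u" "u \<le> x1" and eq: "critical_scale L \<alpha> b u"
    {
      assume h: "u \<le> h" "h \<le> x1"
      have h0: "0 < h" using u h by linarith
      have "1 = b\<^sup>2 * (L u * u powr \<alpha>)" using eq by (simp add: critical_scale_def)
      also have "\<dots> \<le> b\<^sup>2 * ((A' * (h / u) powr (\<alpha> / 2) * L h) * u powr \<alpha>)"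
        using pot[of u h] u h by (intro mult_left_mono mult_right_mono) (auto simp: x1_def)
      also have "\<dots> = (b\<^sup>2 * (L h * h powr \<alpha>)) * A' * ((h / u) powr (\<alpha> / 2) * (u / h) powr \<alpha>)"
        using u h0 by (simp add: powr_divide mult_ac)
      also have "(h / u) powr (\<alpha> / 2) * (u / h) powr \<alpha> = (h / u) powr (- (\<alpha> / 2))"
      proof -
        have "(u / h) powr \<alpha> = (h / u) powr (- \<alpha>)" using u h0 by (simp add: powr_divide powr_minus_divide)
        then show ?thesis by (simp add: powr_add[symmetric])
      qed
      finally have "1 \<le> (b\<^sup>2 * (L h * h powr \<alpha>)) * A' * (h / u) powr (- (\<alpha> / 2))" .
      then have "(h / u) powr (\<alpha> / 2) \<le> (b\<^sup>2 * (L h * h powr \<alpha>)) * A'"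
        using u h0 by (simp add: powr_minus field_simps)
      then have "a / A' * (h / u) powr (\<alpha> / 2) \<le> a * (b\<^sup>2 * (L h * h powr \<alpha>))"
        using a A' by (simp add: field_simps)
      then have "exp (- a * (b\<^sup>2 * (L h * h powr \<alpha>))) \<le> exp (- (a / A') * (h / u) powr (\<alpha> / 2))"
        by simp
      also have "\<dots> \<le> A1 * (1 + h / u) powr (- q)" using u h by (intro A1) auto
      also have "\<dots> \<le> A * (1 + h / u) powr (- q)" by (intro mult_right_mono) (auto simp: A_def)
      finally show "exp (- a * (b\<^sup>2 * (L h * h powr \<alpha>))) \<le> A * (1 + h / u) powr (- q)" .
    }
    {
      assume h: "0 \<le> h" "h \<le> D"
      have b2: "1 \<le> b\<^sup>2" using b by simp
      have "1 + h / u \<le> 1 / u + D / u" using u h by (intro add_mono divide_right_mono) (auto simp: x1_def)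
      then have "1 + h / u \<le> (1 + D) * (1 / u)" by (simp add: add_divide_distrib)
      also have "\<dots> \<le> (1 + D) * (B * b\<^sup>2) powr (2 / \<alpha>)"
        using low[of u b] u eq D by (intro mult_left_mono) (auto simp: x1_def)
      finally have le: "1 + h / u \<le> (1 + D) * (B * b\<^sup>2) powr (2 / \<alpha>)" .
      have pos: "0 < 1 + h / u" using u h by (simp add: add_pos_nonneg)
      have "(1 + h / u) powr q \<le> ((1 + D) * (B * b\<^sup>2) powr (2 / \<alpha>)) powr q"
        using le pos q by (intro powr_mono2) auto
      also have "\<dots> = (1 + D) powr q * B powr (2 / \<alpha> * q) * (b\<^sup>2) powr (2 / \<alpha> * q)"
        using D B b by (simp add: powr_mult powr_powr)
      finally have pq: "(1 + h / u) powr q \<le> (1 + D) powr q * B powr (2 / \<alpha> * q) * (b\<^sup>2) powr (2 / \<alpha> * q)" .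
      have "exp (- a * b\<^sup>2) \<le> A2 * (b\<^sup>2) powr (- (2 / \<alpha> * q))" using A2(2)[OF b2] .
      also have "\<dots> = A2 * (b\<^sup>2) powr (- (2 / \<alpha> * q)) * ((1 + h / u) powr q * (1 + h / u) powr (- q))"
        using pos by (simp add: powr_minus)
      also have "\<dots> \<le> A2 * (b\<^sup>2) powr (- (2 / \<alpha> * q)) * (((1 + D) powr q * B powr (2 / \<alpha> * q) * (b\<^sup>2) powr (2 / \<alpha> * q)) * (1 + h / u) powr (- q))"
        using pq A2(1) by (intro mult_left_mono mult_right_mono) auto
      also have "\<dots> = A3 * (1 + h / u) powr (- q) * ((b\<^sup>2) powr (- (2 / \<alpha> * q)) * (b\<^sup>2) powr (2 / \<alpha> * q))"
        by (simp add: A3_def mult_ac)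
      also have "(b\<^sup>2) powr (- (2 / \<alpha> * q)) * (b\<^sup>2) powr (2 / \<alpha> * q) = 1"
        using b by (simp add: powr_add[symmetric])
      also have "A3 * (1 + h / u) powr (- q) * 1 \<le> A * (1 + h / u) powr (- q)"
        by (simp add: A_def mult_right_mono)
      finally show "exp (- a * b\<^sup>2) \<le> A * (1 + h / u) powr (- q)" .
    }
  qed
qed

lemma powr_le_powr_bounded:
  fixes h :: real
  assumes "0 \<le> h" "h \<le> 8" "0 < e'" "e' \<le> e"
  shows "h powr e \<le> 8 powr e * h powr e'"
proof -
  have "h powr e = h powr (e - e') * h powr e'" by (simp add: powr_add[symmetric])
  also have "\<dots> \<le> 8 powr (e - e') * h powr e'" using assms by (intro mult_right_mono powr_mono2) auto
  also have "\<dots> \<le> 8 powr e * h powr e'" using assms by (intro mult_right_mono powr_mono) auto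
  finally show ?thesis .
qed

text \<open>The regularity bound is asymmetric in the two increments; it is applied with the longer one first.\<close>

lemma corr_regularity_at_scale:
  fixes r :: "'a::euclidean_space \<Rightarrow> 'a \<Rightarrow> real"
  assumes sv: "slowly_varying_at_zero L" and reg: "corr_regularity r T \<alpha> L"
  obtains x1 A e where "0 < x1" "0 < A" "0 < e"
    "\<And>b u c s t. 0 < u \<Longrightarrow> u \<le> x1 \<Longrightarrow> critical_scale L \<alpha> b u \<Longrightarrow> c \<in> T \<Longrightarrow> s \<in> T \<Longrightarrow> t \<in> T \<Longrightarrow>
      dist c s \<le> 4 * u \<Longrightarrow> dist c t \<le> 4 * u \<Longrightarrow> b\<^sup>2 * \<bar>r c s - r c t\<bar> \<le> A * (dist s t / u) powr e"
proof -
  obtain \<kappa> \<beta>0 \<beta>1 where \<kappa>: "0 \<le> \<kappa>" and \<beta>: "0 \<le> \<beta>0" "0 < \<beta>1" "\<alpha> \<le> \<beta>0 + \<beta>1"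
    and R: "\<forall>t s1 s2. t \<in> T \<longrightarrow> t + s1 \<in> T \<longrightarrow> t + s2 \<in> T \<longrightarrow> norm s2 \<le> norm s1 \<longrightarrow>
      \<bar>r t (t + s1) - r t (t + s2)\<bar> \<le> \<kappa> * L (norm s1) * norm s1 powr \<beta>0 * norm (s1 - s2) powr \<beta>1"
    using reg unfolding corr_regularity_def by blast
  obtain x1 A where x1: "0 < x1" and A: "0 < A" and inc: "\<And>b u x y. 0 < u \<Longrightarrow> u \<le> x1 \<Longrightarrow> critical_scale L \<alpha> b u \<Longrightarrow> 0 < y \<Longrightarrow> y \<le> 2 * x \<Longrightarrow> x \<le> 8 * u \<Longrightarrow>
      b\<^sup>2 * (L x * x powr \<beta>0 * y powr \<beta>1) \<le> A * (y / u) powr (\<beta>1 / 2)"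
    using scaled_increment_bound[OF sv \<beta>] by blast
  have main: "b\<^sup>2 * \<bar>r c s - r c t\<bar> \<le> (\<kappa> * A) * (dist s t / u) powr (\<beta>1 / 2)"
    if u: "0 < u" "u \<le> x1" and eq: "critical_scale L \<alpha> b u" and c: "c \<in> T" "s \<in> T" "t \<in> T"
      and d: "dist c s \<le> 4 * u" "dist c t \<le> dist c s" for b u c s t
  proof (cases "s = t")
    case False
    define x where "x = norm (s - c)"
    define y where "y = dist s t"
    have xd: "x = dist c s" by (simp add: x_def dist_norm norm_minus_commute)
    have y: "0 < y" "y \<le> 2 * x" using False d(2) dist_triangle3[of s t c] by (auto simp: y_def xd)
    have "\<bar>r c (c + (s - c)) - r c (c + (t - c))\<bar> \<le> \<kappa> * L (norm (s - c)) * norm (s - c) powr \<beta>0 * norm ((s - c) - (t - c)) powr \<beta>1"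
      using R[rule_format, of c "s - c" "t - c"] c d(2) by (simp add: dist_norm norm_minus_commute)
    then have "\<bar>r c s - r c t\<bar> \<le> \<kappa> * (L x * x powr \<beta>0 * y powr \<beta>1)"
      by (simp add: x_def y_def dist_norm mult.assoc)
    then have "b\<^sup>2 * \<bar>r c s - r c t\<bar> \<le> b\<^sup>2 * (\<kappa> * (L x * x powr \<beta>0 * y powr \<beta>1))" by (intro mult_left_mono) auto
    also have "\<dots> = \<kappa> * (b\<^sup>2 * (L x * x powr \<beta>0 * y powr \<beta>1))" by simp
    also have "\<dots> \<le> \<kappa> * (A * (y / u) powr (\<beta>1 / 2))"
      using d u by (intro mult_left_mono inc[OF u eq y] \<kappa>) (simp add: xd)
    finally show ?thesis by (simp add: y_def mult.assoc)
  qed simp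
  show thesis
  proof (rule that[of x1 "\<kappa> * A + 1" "\<beta>1 / 2"])
    fix b u c s t
    assume u: "0 < u" "u \<le> x1" and eq: "critical_scale L \<alpha> b u" and c: "c \<in> T" "s \<in> T" "t \<in> T"
      and d: "dist c s \<le> 4 * u" "dist c t \<le> 4 * u"
    have "b\<^sup>2 * \<bar>r c s - r c t\<bar> \<le> (\<kappa> * A) * (dist s t / u) powr (\<beta>1 / 2)"
    proof (cases "dist c t \<le> dist c s")
      case True then show ?thesis using main[OF u eq c d(1)] by simp
    next
      case False
      then have "b\<^sup>2 * \<bar>r c t - r c s\<bar> \<le> (\<kappa> * A) * (dist t s / u) powr (\<beta>1 / 2)"
        using main[OF u eq c(1) c(3) c(2) d(2)] by simp
      then show ?thesis by (simp add: dist_commute abs_minus_commute)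
    qed
    also have "\<dots> \<le> (\<kappa> * A + 1) * (dist s t / u) powr (\<beta>1 / 2)" by (intro mult_right_mono) auto
    finally show "b\<^sup>2 * \<bar>r c s - r c t\<bar> \<le> (\<kappa> * A + 1) * (dist s t / u) powr (\<beta>1 / 2)" .
  qed (use x1 \<kappa> A \<beta> in \<open>auto simp: add_nonneg_pos\<close>)
qed

lemma sd_regularity_at_scale:
  fixes \<sigma> :: "'a::euclidean_space \<Rightarrow> real"
  assumes sv: "slowly_varying_at_zero L" and \<alpha>: "0 < \<alpha>" and \<kappa>: "0 < \<kappa>"
    and reg: "\<forall>s\<in>T. \<forall>t\<in>T. \<bar>\<sigma> t - \<sigma> s\<bar> \<le> \<kappa> * L (norm (t - s)) * norm (t - s) powr \<alpha>"
  obtains x1 A where "0 < x1" "0 < A"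
    "\<And>b u s t. 0 < u \<Longrightarrow> u \<le> x1 \<Longrightarrow> critical_scale L \<alpha> b u \<Longrightarrow> s \<in> T \<Longrightarrow> t \<in> T \<Longrightarrow>
      dist s t \<le> 8 * u \<Longrightarrow> b\<^sup>2 * \<bar>\<sigma> s - \<sigma> t\<bar> \<le> A * (dist s t / u) powr (\<alpha> / 2)"
proof -
  obtain x1 A where x1: "0 < x1" and A: "0 < A" and inc: "\<And>b u y. 0 < u \<Longrightarrow> u \<le> x1 \<Longrightarrow> critical_scale L \<alpha> b u \<Longrightarrow> 0 < y \<Longrightarrow> y \<le> 8 * u \<Longrightarrow>
      b\<^sup>2 * (L y * y powr \<alpha>) \<le> A * (y / u) powr (\<alpha> / 2)"
    using scaled_increment_bound_simple[OF sv \<alpha>] by blast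
  show thesis
  proof (rule that[of x1 "\<kappa> * A"])
    fix b u s t
    assume u: "0 < u" "u \<le> x1" and eq: "critical_scale L \<alpha> b u" and s: "s \<in> T" "t \<in> T" and d: "dist s t \<le> 8 * u"
    show "b\<^sup>2 * \<bar>\<sigma> s - \<sigma> t\<bar> \<le> (\<kappa> * A) * (dist s t / u) powr (\<alpha> / 2)"
    proof (cases "s = t")
      case False
      define y where "y = dist s t"
      have y: "0 < y" "y \<le> 8 * u" using False d by (auto simp: y_def)
      have "\<bar>\<sigma> s - \<sigma> t\<bar> \<le> \<kappa> * (L y * y powr \<alpha>)"
        using reg s by (auto simp: y_def dist_norm mult.assoc)
      then have "b\<^sup>2 * \<bar>\<sigma> s - \<sigma> t\<bar> \<le> b\<^sup>2 * (\<kappa> * (L y * y powr \<alpha>))" by (intro mult_left_mono) auto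
      also have "\<dots> = \<kappa> * (b\<^sup>2 * (L y * y powr \<alpha>))" by simp
      also have "\<dots> \<le> \<kappa> * (A * (y / u) powr (\<alpha> / 2))" using inc[OF u eq y] \<kappa> by (intro mult_left_mono) auto
      finally show ?thesis by (simp add: y_def mult.assoc)
    qed simp
  qed (use x1 \<kappa> A in auto)
qed

lemma mean_regularity_at_scale:
  fixes \<mu> :: "'a::euclidean_space \<Rightarrow> real"
  assumes sv: "slowly_varying_at_zero L" and \<alpha>: "0 < \<alpha>" and reg: "mean_regularity \<mu> T \<alpha> L"
  obtains x1 A where "0 < x1" "0 < A"
    "\<And>b u s t. 0 < b \<Longrightarrow> 0 < u \<Longrightarrow> u \<le> x1 \<Longrightarrow> critical_scale L \<alpha> b u \<Longrightarrow> s \<in> T \<Longrightarrow> t \<in> T \<Longrightarrow>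
      dist s t \<le> 8 * u \<Longrightarrow> b * \<bar>\<mu> s - \<mu> t\<bar> \<le> A * (dist s t / u) powr (\<alpha> / 4)"
proof -
  obtain \<kappa> where \<kappa>: "0 < \<kappa>" and R: "\<forall>s t. s \<in> T \<longrightarrow> s + t \<in> T \<longrightarrow> \<bar>\<mu> s - \<mu> (s + t)\<bar> \<le> \<kappa> * sqrt (L (norm t)) * norm t powr (\<alpha> / 2)"
    using reg unfolding mean_regularity_def by blast
  obtain x1 A where x1: "0 < x1" and A: "0 < A" and inc: "\<And>b u y. 0 < u \<Longrightarrow> u \<le> x1 \<Longrightarrow> critical_scale L \<alpha> b u \<Longrightarrow> 0 < y \<Longrightarrow> y \<le> 8 * u \<Longrightarrow>
      b\<^sup>2 * (L y * y powr \<alpha>) \<le> A * (y / u) powr (\<alpha> / 2)"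
    using scaled_increment_bound_simple[OF sv \<alpha>] by blast
  show thesis
  proof (rule that[of x1 "\<kappa> * sqrt A"])
    fix b u s t
    assume b: "0 < b" and u: "0 < u" "u \<le> x1" and eq: "critical_scale L \<alpha> b u" and s: "s \<in> T" "t \<in> T" and d: "dist s t \<le> 8 * u"
    show "b * \<bar>\<mu> s - \<mu> t\<bar> \<le> (\<kappa> * sqrt A) * (dist s t / u) powr (\<alpha> / 4)"
    proof (cases "s = t")
      case False
      define y where "y = dist s t"
      have y: "0 < y" "y \<le> 8 * u" using False d by (auto simp: y_def)
      have "\<bar>\<mu> s - \<mu> (s + (t - s))\<bar> \<le> \<kappa> * sqrt (L (norm (t - s))) * norm (t - s) powr (\<alpha> / 2)"
        using R[rule_format, of s "t - s"] s by simp
      then have "\<bar>\<mu> s - \<mu> t\<bar> \<le> \<kappa> * (sqrt (L y) * y powr (\<alpha> / 2))"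
        by (simp add: y_def dist_norm norm_minus_commute mult.assoc)
      also have "sqrt (L y) * y powr (\<alpha> / 2) = sqrt (L y * y powr \<alpha>)"
        using y by (simp add: real_sqrt_mult powr_half_sqrt[symmetric] powr_powr)
      finally have "b * \<bar>\<mu> s - \<mu> t\<bar> \<le> b * (\<kappa> * sqrt (L y * y powr \<alpha>))" using b by (intro mult_left_mono) auto
      also have "\<dots> = \<kappa> * sqrt (b\<^sup>2 * (L y * y powr \<alpha>))" using b by (simp add: real_sqrt_mult)
      also have "\<dots> \<le> \<kappa> * sqrt (A * (y / u) powr (\<alpha> / 2))"
        using inc[OF u eq y] \<kappa> by (intro mult_left_mono real_sqrt_le_mono) auto
      also have "\<dots> = (\<kappa> * sqrt A) * (y / u) powr (\<alpha> / 4)"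
        using y u by (simp add: real_sqrt_mult powr_half_sqrt[symmetric] powr_powr)
      finally show ?thesis by (simp add: y_def)
    qed simp
  qed (use x1 \<kappa> A in auto)
qed

section \<open>The supremum against a net: correlations\<close>

text \<open>A second moment bound in a linear form: with \<open>X\<close> the number of events that occur, \<open>2 X / C - X\<^sup>2 / C\<^sup>2\<close>
is at most one, and is zero when none occurs.\<close>

lemma (in prob_space) sum_prob_le_prob_Union:
  assumes N: "finite N" and A: "\<And>s. s \<in> N \<Longrightarrow> A s \<in> sets M" and C: "0 < C"
    and pairs: "(\<Sum>s\<in>N. \<Sum>t\<in>N. prob (A s \<inter> A t)) \<le> C * (\<Sum>s\<in>N. prob (A s))"
  shows "(\<Sum>s\<in>N. prob (A s)) \<le> C * prob (\<Union>s\<in>N. A s)"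
proof -
  define X where "X \<omega> = (\<Sum>s\<in>N. indicator (A s) \<omega> :: real)" for \<omega>
  have iA: "integrable M (indicator (A s) :: 'a \<Rightarrow> real)" if "s \<in> N" for s
    using A[OF that] by (intro integrable_real_indicator) (auto simp: emeasure_eq_measure)
  have iAA: "integrable M (indicator (A s \<inter> A t) :: 'a \<Rightarrow> real)" if "s \<in> N" "t \<in> N" for s t
    using A that by (intro integrable_real_indicator) (auto simp: emeasure_eq_measure)
  have X2: "(X \<omega>)\<^sup>2 = (\<Sum>s\<in>N. \<Sum>t\<in>N. indicator (A s \<inter> A t) \<omega>)" for \<omega>
    by (simp add: X_def power2_eq_square sum_product indicator_inter_arith)
  have iX: "integrable M X" unfolding X_def using iA by auto
  have iX2: "integrable M (\<lambda>\<omega>. (X \<omega>)\<^sup>2)" unfolding X2 using iAA by auto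
  have eX: "expectation X = (\<Sum>s\<in>N. prob (A s))"
    unfolding X_def using iA A by (subst Bochner_Integration.integral_sum) (auto simp: Int_absorb2 sets.sets_into_space intro!: sum.cong)
  have eX2: "expectation (\<lambda>\<omega>. (X \<omega>)\<^sup>2) = (\<Sum>s\<in>N. \<Sum>t\<in>N. prob (A s \<inter> A t))"
    unfolding X2 using iAA A
    by (subst Bochner_Integration.integral_sum)
      (auto simp: Bochner_Integration.integral_sum Int_absorb2 sets.sets_into_space le_infI1 intro!: sum.cong)
  have U: "(\<Union>s\<in>N. A s) \<in> sets M" using N A by auto
  have "expectation (\<lambda>\<omega>. 2 / C * X \<omega> - 1 / C\<^sup>2 * (X \<omega>)\<^sup>2) \<le> expectation (indicator (\<Union>s\<in>N. A s))"
  proof (rule integral_mono)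
    show "integrable M (\<lambda>\<omega>. 2 / C * X \<omega> - 1 / C\<^sup>2 * (X \<omega>)\<^sup>2)"
      using iX iX2 by (intro Bochner_Integration.integrable_diff integrable_mult_right)
    show "integrable M (indicator (\<Union>s\<in>N. A s) :: 'a \<Rightarrow> real)"
      using U by (intro integrable_real_indicator) (auto simp: emeasure_eq_measure)
    fix \<omega>
    show "2 / C * X \<omega> - 1 / C\<^sup>2 * (X \<omega>)\<^sup>2 \<le> indicator (\<Union>s\<in>N. A s) \<omega>"
    proof (cases "\<omega> \<in> (\<Union>s\<in>N. A s)")
      case True
      have "0 \<le> (1 - X \<omega> / C)\<^sup>2" by simp
      then have "2 / C * X \<omega> - 1 / C\<^sup>2 * (X \<omega>)\<^sup>2 \<le> 1"
        by (simp add: power2_diff power_divide)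
      then show ?thesis using True by simp
    next
      case False
      then have "X \<omega> = 0" by (auto simp: X_def intro!: sum.neutral)
      then show ?thesis by simp
    qed
  qed
  also have "expectation (indicator (\<Union>s\<in>N. A s)) = prob (\<Union>s\<in>N. A s)"
    using U by (simp add: Int_absorb2 sets.sets_into_space)
  also have "expectation (\<lambda>\<omega>. 2 / C * X \<omega> - 1 / C\<^sup>2 * (X \<omega>)\<^sup>2)
      = 2 / C * expectation X - 1 / C\<^sup>2 * expectation (\<lambda>\<omega>. (X \<omega>)\<^sup>2)"
    using iX iX2 by (subst Bochner_Integration.integral_diff) (auto intro!: integrable_mult_right integrable_divide)
  finally have "2 / C * (\<Sum>s\<in>N. prob (A s)) - 1 / C\<^sup>2 * (\<Sum>s\<in>N. \<Sum>t\<in>N. prob (A s \<inter> A t)) \<le> prob (\<Union>s\<in>N. A s)"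
    unfolding eX eX2 .
  moreover have "1 / C\<^sup>2 * (\<Sum>s\<in>N. \<Sum>t\<in>N. prob (A s \<inter> A t)) \<le> 1 / C\<^sup>2 * (C * (\<Sum>s\<in>N. prob (A s)))"
    using pairs by (intro mult_left_mono) auto
  moreover have "1 / C\<^sup>2 * (C * (\<Sum>s\<in>N. prob (A s))) = 1 / C * (\<Sum>s\<in>N. prob (A s))"
    using C by (simp add: power2_eq_square)
  ultimately have "1 / C * (\<Sum>s\<in>N. prob (A s)) \<le> prob (\<Union>s\<in>N. A s)" by argo
  then show ?thesis using C by (simp add: field_simps)
qed

text \<open>The uniform expansion near the diagonal, reduced to bounds with constants, which exist because
the continuous positive coefficient has a positive minimum and a finite maximum on the compact \<open>T\<close>.\<close>

lemma corr_expansion_bounds: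
  fixes r :: "'a::euclidean_space \<Rightarrow> 'a \<Rightarrow> real"
  assumes T: "compact T" and e: "corr_expansion r T \<alpha> L" and sv: "slowly_varying_at_zero L"
  obtains \<eta> d0 d1 where "0 < \<eta>" "0 < d0" "0 < d1"
    "\<And>s t. s \<in> T \<Longrightarrow> t \<in> T \<Longrightarrow> s \<noteq> t \<Longrightarrow> dist s t < \<eta> \<Longrightarrow>
      d0 * (L (dist s t) * dist s t powr \<alpha>) \<le> 1 - r s t \<and> 1 - r s t \<le> d1 * (L (dist s t) * dist s t powr \<alpha>)"
proof (cases "T = {}")
  case True
  then show thesis using that[of 1 1 1] by simp
next
  case False
  obtain \<Delta> where cont: "continuous_on T \<Delta>" and pos: "\<forall>s\<in>T. 0 < \<Delta> s"
    and asym: "(\<lambda>(s, t). 1 - r s t) \<sim>[near_diagonal T] (\<lambda>(s, t). \<Delta> s * L (norm (t - s)) * norm (t - s) powr \<alpha>)"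
    using e unfolding corr_expansion_def by blast
  obtain s1 where s1: "s1 \<in> T" "\<And>s. s \<in> T \<Longrightarrow> \<Delta> s1 \<le> \<Delta> s"
    using continuous_attains_inf[OF T False cont] by blast
  obtain s2 where s2: "s2 \<in> T" "\<And>s. s \<in> T \<Longrightarrow> \<Delta> s \<le> \<Delta> s2"
    using continuous_attains_sup[OF T False cont] by blast
  define F where "F = (\<lambda>z. case z of (s, t) \<Rightarrow> 1 - r s t)"
  define G where "G = (\<lambda>z. case z of (s, t) \<Rightarrow> \<Delta> s * L (norm (t - s)) * norm (t - s) powr \<alpha>)"
  have "((\<lambda>z. if F z = 0 \<and> G z = 0 then 1 else F z / G z) \<longlongrightarrow> 1) (near_diagonal T)"
    using asym unfolding asymp_equiv_def F_def G_def .
  then have "\<forall>\<^sub>F z in near_diagonal T. dist (if F z = 0 \<and> G z = 0 then 1 else F z / G z) 1 < 1 / 2"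
    by (rule tendstoD) simp
  then have "\<forall>\<^sub>F z in filtercomap (\<lambda>(s, t). dist s t) (at_right 0).
      z \<in> T \<times> T \<longrightarrow> dist (if F z = 0 \<and> G z = 0 then 1 else F z / G z) 1 < 1 / 2"
    unfolding near_diagonal_def eventually_inf_principal .
  then obtain Q where Q: "eventually Q (at_right (0::real))"
    "\<And>z. Q (case z of (s, t) \<Rightarrow> dist s t) \<Longrightarrow> z \<in> T \<times> T \<Longrightarrow> dist (if F z = 0 \<and> G z = 0 then 1 else F z / G z) 1 < 1 / 2"
    unfolding eventually_filtercomap by blast
  obtain \<eta> where \<eta>: "0 < \<eta>" "\<And>y. 0 < y \<Longrightarrow> y < \<eta> \<Longrightarrow> Q y"
    using Q(1) unfolding eventually_at_right_field by auto
  show thesis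
  proof (rule that[of \<eta> "\<Delta> s1 / 2" "3 / 2 * \<Delta> s2"])
    fix s t assume st: "s \<in> T" "t \<in> T" "s \<noteq> t" "dist s t < \<eta>"
    define g where "g = L (dist s t) * dist s t powr \<alpha>"
    have g: "0 < g" using slowly_varying_pos[OF sv, of "dist s t"] st by (simp add: g_def)
    have Gst: "G (s, t) = \<Delta> s * g" by (simp add: G_def g_def dist_norm norm_minus_commute mult.assoc)
    have Gp: "0 < G (s, t)" using g pos st by (simp add: Gst)
    have "Q (dist s t)" using \<eta> st by simp
    then have "dist (if F (s, t) = 0 \<and> G (s, t) = 0 then 1 else F (s, t) / G (s, t)) 1 < 1 / 2"
      using Q(2)[of "(s, t)"] st by simp
    then have "\<bar>F (s, t) / G (s, t) - 1\<bar> < 1 / 2" using Gp by (auto simp: dist_real_def split: if_splits)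
    then have "1 / 2 < F (s, t) / G (s, t)" "F (s, t) / G (s, t) < 3 / 2" unfolding abs_less_iff by linarith+
    then have b: "1 / 2 * G (s, t) \<le> F (s, t)" "F (s, t) \<le> 3 / 2 * G (s, t)"
      using Gp by (auto simp: field_simps)
    have "\<Delta> s1 / 2 * g \<le> 1 / 2 * G (s, t)" "3 / 2 * G (s, t) \<le> 3 / 2 * \<Delta> s2 * g"
      using s1(2)[OF st(1)] s2(2)[OF st(1)] g unfolding Gst by (auto intro: mult_right_mono)
    then show "\<Delta> s1 / 2 * (L (dist s t) * dist s t powr \<alpha>) \<le> 1 - r s t \<and>
      1 - r s t \<le> 3 / 2 * \<Delta> s2 * (L (dist s t) * dist s t powr \<alpha>)"
      using b unfolding g_def[symmetric] by (simp add: F_def)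
  qed (use \<eta> s1 s2 pos in auto)
qed

context continuous_gaussian_field
begin

abbreviation "corr s t \<equiv> corr_fun P f s t"

lemma combination_variance_nonneg:
  assumes "c \<in> T" "s \<in> T" "t \<in> T"
  shows "0 \<le> a\<^sup>2 * cov c c + p\<^sup>2 * cov s s + q\<^sup>2 * cov t t
      + 2 * a * p * cov c s + 2 * a * q * cov c t + 2 * p * q * cov s t"
  unfolding combination_variance[OF assms, symmetric] by (intro integral_nonneg_AE) auto

lemma corr_commute: "corr s t = corr t s"
  by (simp add: corr_fun_def cov_commute[of s t] mult.commute)

lemma cov_eq_corr: "0 < sd s \<Longrightarrow> 0 < sd t \<Longrightarrow> cov s t = sd s * sd t * corr s t"
  by (simp add: corr_fun_def)

lemma corr_self: "0 < sd t \<Longrightarrow> corr t t = 1"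
  by (simp add: corr_fun_def sd_power2[symmetric] power2_eq_square)

lemma corr_bounds:
  assumes "s \<in> T" "t \<in> T" "0 < sd s" "0 < sd t"
  shows "corr s t \<le> 1" "- 1 \<le> corr s t"
proof -
  have e: "cov s s = sd s * sd s" "cov t t = sd t * sd t" by (simp_all add: sd_power2[symmetric] power2_eq_square)
  have "0 \<le> 2 + 2 * \<epsilon> * corr s t" if "\<epsilon>\<^sup>2 = 1" for \<epsilon>
    using combination_variance_nonneg[OF assms(1,1,2), of 0 "1 / sd s" "\<epsilon> / sd t"] assms that
    by (simp add: e cov_eq_corr power_divide power2_eq_square)
  from this[of 1] this[of "-1"] show "corr s t \<le> 1" "- 1 \<le> corr s t" by auto
qed

text \<open>A discriminant argument: the variance of \<open>\<nu> f(s) / \<sigma>(s) + f(t) / \<sigma>(t) - f(t') / \<sigma>(t')\<close> is nonnegative for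
the value of \<open>\<nu>\<close> that minimises it.\<close>

lemma corr_increment_power2_le:
  assumes "s \<in> T" "t \<in> T" "t' \<in> T" "0 < sd s" "0 < sd t" "0 < sd t'"
  shows "(corr s t - corr s t')\<^sup>2 \<le> 2 * (1 - corr t t')"
proof -
  define \<nu> where "\<nu> = corr s t' - corr s t"
  have e: "cov s s = sd s * sd s" "cov t t = sd t * sd t" "cov t' t' = sd t' * sd t'"
    by (simp_all add: sd_power2[symmetric] power2_eq_square)
  have "0 \<le> \<nu>\<^sup>2 + 2 - 2 * corr t t' + 2 * \<nu> * corr s t - 2 * \<nu> * corr s t'"
    using combination_variance_nonneg[OF assms(1-3), of "\<nu> / sd s" "1 / sd t" "- 1 / sd t'"] assms
    by (simp add: e cov_eq_corr power_divide power2_eq_square)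
  then show ?thesis by (simp add: \<nu>_def power2_eq_square algebra_simps)
qed

text \<open>The correlation is continuous on \<open>T \<times> T\<close>, because by the previous lemma its increments are controlled
by its values near the diagonal, and so its maximum away from the diagonal is attained and less
than one.\<close>

lemma corr_gap:
  assumes sd: "\<And>t. t \<in> T \<Longrightarrow> 0 < sd t" and lt: "\<And>s t. s \<in> T \<Longrightarrow> t \<in> T \<Longrightarrow> s \<noteq> t \<Longrightarrow> corr s t < 1"
    and e: "corr_expansion (\<lambda>s t. corr s t) T \<alpha> L" and sv: "slowly_varying_at_zero L" and \<alpha>: "0 < \<alpha>"
    and \<eta>: "0 < \<eta>"
  obtains \<epsilon> where "0 < \<epsilon>" "\<And>s t. s \<in> T \<Longrightarrow> t \<in> T \<Longrightarrow> \<eta> \<le> dist s t \<Longrightarrow> \<epsilon> \<le> 1 - corr s t"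
proof -
  obtain \<eta>' d0 d1 where d: "0 < \<eta>'" "0 < d0" "0 < d1"
    "\<And>s t. s \<in> T \<Longrightarrow> t \<in> T \<Longrightarrow> s \<noteq> t \<Longrightarrow> dist s t < \<eta>' \<Longrightarrow>
      d0 * (L (dist s t) * dist s t powr \<alpha>) \<le> 1 - corr s t \<and> 1 - corr s t \<le> d1 * (L (dist s t) * dist s t powr \<alpha>)"
    using corr_expansion_bounds[OF compact_T e sv] by blast
  obtain x0 A where x0: "0 < x0" and A: "0 < A" and P: "\<And>x. 0 < x \<Longrightarrow> x \<le> x0 \<Longrightarrow> L x * x powr \<alpha> \<le> A * x powr (\<alpha> / 2)"
    using slowly_varying_mult_powr_tendsto[OF sv \<alpha>] by blast
  have near: "\<exists>\<delta>>0. \<forall>s\<in>T. \<forall>t\<in>T. dist s t < \<delta> \<longrightarrow> 1 - corr s t \<le> \<epsilon>" if \<epsilon>: "0 < \<epsilon>" for \<epsilon>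
  proof -
    \<comment> \<open>The last term solves \<open>d1 A \<delta> powr (\<alpha> / 2) = \<epsilon>\<close>.\<close>
    define \<delta> where "\<delta> = min \<eta>' (min x0 ((\<epsilon> / (d1 * A)) powr (2 / \<alpha>)))"
    have "0 < \<delta>" using d x0 A \<epsilon> by (simp add: \<delta>_def)
    moreover have "1 - corr s t \<le> \<epsilon>" if st: "s \<in> T" "t \<in> T" "dist s t < \<delta>" for s t
    proof (cases "s = t")
      case True then show ?thesis using corr_self[OF sd] st \<epsilon> by simp
    next
      case False
      define y where "y = dist s t"
      have y: "0 < y" "y \<le> x0" "y \<le> (\<epsilon> / (d1 * A)) powr (2 / \<alpha>)" using False st by (auto simp: y_def \<delta>_def)
      have "1 - corr s t \<le> d1 * (L y * y powr \<alpha>)" using d(4)[OF st(1,2) False] st by (simp add: y_def \<delta>_def)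
      also have "\<dots> \<le> d1 * (A * y powr (\<alpha> / 2))" using d P y by (intro mult_left_mono) auto
      also have "\<dots> \<le> d1 * (A * ((\<epsilon> / (d1 * A)) powr (2 / \<alpha>)) powr (\<alpha> / 2))"
        using d A y \<alpha> by (intro mult_left_mono powr_mono2) auto
      also have "\<dots> = \<epsilon>" using d A \<epsilon> \<alpha> by (simp add: powr_powr)
      finally show ?thesis .
    qed
    ultimately show ?thesis by blast
  qed
  define g where "g = (\<lambda>z. corr (fst z) (snd z))"
  have cont: "continuous_on (T \<times> T) g"
    unfolding continuous_on_iff
  proof (intro ballI allI impI)
    fix z :: "'a \<times> 'a" and e :: real assume z: "z \<in> T \<times> T" and "0 < e"
    then have "0 < (e / 3)\<^sup>2 / 2" by simp
    then obtain \<delta> where \<delta>: "0 < \<delta>" "\<forall>s\<in>T. \<forall>t\<in>T. dist s t < \<delta> \<longrightarrow> 1 - corr s t \<le> (e / 3)\<^sup>2 / 2"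
      using near by blast
    have small: "\<bar>corr u s - corr u t\<bar> \<le> e / 3" if "u \<in> T" "s \<in> T" "t \<in> T" "dist s t < \<delta>" for u s t
    proof -
      have "(corr u s - corr u t)\<^sup>2 \<le> 2 * (1 - corr s t)"
        using that sd by (intro corr_increment_power2_le) auto
      also have "\<dots> \<le> (e / 3)\<^sup>2" using \<delta>(2)[rule_format, OF that(2-4)] by simp
      finally have "\<bar>corr u s - corr u t\<bar> \<le> \<bar>e / 3\<bar>" by (simp only: abs_le_square_iff)
      then show ?thesis using \<open>0 < e\<close> by simp
    qed
    show "\<exists>d>0. \<forall>z'\<in>T \<times> T. dist z' z < d \<longrightarrow> dist (g z') (g z) < e"
    proof (intro exI[of _ \<delta>] conjI ballI impI)
      fix z' assume z': "z' \<in> T \<times> T" "dist z' z < \<delta>"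
      have "dist (fst z') (fst z) < \<delta>" "dist (snd z') (snd z) < \<delta>"
        using z'(2) dist_fst_le[of z' z] dist_snd_le[of z' z] by linarith+
      then have "\<bar>corr (fst z') (snd z') - corr (fst z') (snd z)\<bar> \<le> e / 3"
        "\<bar>corr (snd z) (fst z') - corr (snd z) (fst z)\<bar> \<le> e / 3"
        using z z'(1) by (intro small; auto)+
      then show "dist (g z') (g z) < e"
        using \<open>0 < e\<close> unfolding g_def dist_real_def corr_commute[of "snd z"] by linarith
    qed fact
  qed
  define S where "S = {z \<in> T \<times> T. \<eta> \<le> dist (fst z) (snd z)}"
  have "S = (T \<times> T) \<inter> {z. \<eta> \<le> dist (fst z) (snd z)}" by (auto simp: S_def)
  moreover have "closed {z :: 'a \<times> 'a. \<eta> \<le> dist (fst z) (snd z)}"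
    by (intro closed_Collect_le continuous_intros)
  ultimately have S: "compact S" using compact_T by (simp add: compact_Int_closed compact_Times)
  have contS: "continuous_on S g" using cont by (rule continuous_on_subset) (auto simp: S_def)
  show thesis
  proof (cases "S = {}")
    case True
    then show thesis using that[of 1] by (auto simp: S_def)
  next
    case False
    obtain z where z: "z \<in> S" "\<And>w. w \<in> S \<Longrightarrow> g w \<le> g z"
      using continuous_attains_sup[OF S False contS] by blast
    have "fst z \<noteq> snd z" using z(1) \<eta> by (auto simp: S_def)
    then have "0 < 1 - g z" using z(1) lt by (auto simp: S_def g_def)
    then show thesis
    proof (rule that)
      fix s t assume "s \<in> T" "t \<in> T" "\<eta> \<le> dist s t"
      then show "1 - g z \<le> 1 - corr s t" using z(2)[of "(s, t)"] by (simp add: S_def g_def)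
    qed
  qed
qed

text \<open>If both standardised values exceed the smaller level \<open>x\<close>, their sum exceeds \<open>2 x\<close>. Its variance is
\<open>2 + 2 r\<close> instead of \<open>4\<close>, and the reduction is felt as the exponential factor.\<close>

lemma joint_exceed_prob_le:
  assumes s: "s \<in> T" "0 < sd s" and t: "t \<in> T" "0 < sd t"
    and le: "(b - mn s) / sd s \<le> (b - mn t) / sd t" and x0: "0 \<le> (b - mn s) / sd s"
  shows "measure P ({\<omega> \<in> space P. b < f s \<omega>} \<inter> {\<omega> \<in> space P. b < f t \<omega>})
    \<le> exceed_prob b s * exp (- ((b - mn s) / sd s)\<^sup>2 * (1 - corr s t) / 4)"
proof -
  define x where "x = (b - mn s) / sd s"
  define r where "r = corr s t"
  have r: "r \<le> 1" "- 1 \<le> r" using corr_bounds[OF s(1) t(1) s(2) t(2)] by (auto simp: r_def)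
  \<comment> \<open>An upper bound of the variance \<open>2 + 2 r\<close> that is tangent at \<open>r = 1\<close> and stays positive at \<open>r = - 1\<close>.\<close>
  define V where "V = 8 / (3 - r)"
  have V: "0 < V" using r by (simp add: V_def)
  define m where "m = mn s / sd s + mn t / sd t"
  have e: "cov s s = sd s * sd s" "cov t t = sd t * sd t" by (simp_all add: sd_power2[symmetric] power2_eq_square)
  have "0\<^sup>2 * cov s s + (1 / sd s)\<^sup>2 * cov s s + (1 / sd t)\<^sup>2 * cov t t
      + 2 * 0 * (1 / sd s) * cov s s + 2 * 0 * (1 / sd t) * cov s t + 2 * (1 / sd s) * (1 / sd t) * cov s t = 2 + 2 * r"
    using s t by (simp add: e cov_eq_corr r_def power_divide power2_eq_square)
  also have "\<dots> \<le> V"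
  proof -
    have "0 \<le> (r - 1)\<^sup>2" by simp
    then have "(2 + 2 * r) * (3 - r) \<le> 8" by (simp add: power2_eq_square algebra_simps)
    then show ?thesis using r by (simp add: V_def le_divide_eq)
  qed
  finally have var: "0\<^sup>2 * cov s s + (1 / sd s)\<^sup>2 * cov s s + (1 / sd t)\<^sup>2 * cov t t
      + 2 * 0 * (1 / sd s) * cov s s + 2 * 0 * (1 / sd t) * cov s t + 2 * (1 / sd s) * (1 / sd t) * cov s t \<le> V" .
  have x: "0 \<le> x" using x0 by (simp add: x_def)
  have "measure P ({\<omega> \<in> space P. b < f s \<omega>} \<inter> {\<omega> \<in> space P. b < f t \<omega>})
    \<le> measure P {\<omega> \<in> space P. m + 2 * x < 0 * f s \<omega> + (1 / sd s) * f s \<omega> + (1 / sd t) * f t \<omega>}"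
  proof (rule finite_measure_mono)
    have [measurable]: "f s \<in> borel_measurable P" "f t \<in> borel_measurable P" using s t measurable_value by auto
    show "{\<omega> \<in> space P. m + 2 * x < 0 * f s \<omega> + (1 / sd s) * f s \<omega> + (1 / sd t) * f t \<omega>} \<in> sets P" by measurable
    show "{\<omega> \<in> space P. b < f s \<omega>} \<inter> {\<omega> \<in> space P. b < f t \<omega>}
      \<subseteq> {\<omega> \<in> space P. m + 2 * x < 0 * f s \<omega> + (1 / sd s) * f s \<omega> + (1 / sd t) * f t \<omega>}"
    proof safe
      fix \<omega> assume "b < f s \<omega>" "b < f t \<omega>"
      then have "(b - mn s) / sd s < (f s \<omega> - mn s) / sd s" "(b - mn t) / sd t < (f t \<omega> - mn t) / sd t"
        using s t by (auto intro!: divide_strict_right_mono)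
      then show "m + 2 * x < 0 * f s \<omega> + (1 / sd s) * f s \<omega> + (1 / sd t) * f t \<omega>"
        using le unfolding m_def x_def by (simp add: diff_divide_distrib)
    qed
  qed
  also have "\<dots> \<le> gauss_tail ((m + 2 * x - m) / sqrt V)"
    using s t x by (intro combination_tail_le var V) (auto simp: m_def)
  also have "(m + 2 * x - m) / sqrt V = x * sqrt ((3 - r) / 2)"
  proof -
    have "sqrt V = 2 / sqrt ((3 - r) / 2)"
    proof -
      have "V = 4 / ((3 - r) / 2)" using r by (simp add: V_def)
      then show ?thesis by (simp only: real_sqrt_divide real_sqrt_four)
    qed
    then show ?thesis using r by simp
  qed
  also have "gauss_tail (x * sqrt ((3 - r) / 2)) \<le> exp ((x\<^sup>2 - (x * sqrt ((3 - r) / 2))\<^sup>2) / 2) * gauss_tail x"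
  proof (rule gauss_tail_decay[OF _ x])
    have "1 \<le> sqrt ((3 - r) / 2)" using r by simp
    then show "x \<le> x * sqrt ((3 - r) / 2)" using x by (simp add: mult_le_cancel_left1)
  qed
  also have "(x\<^sup>2 - (x * sqrt ((3 - r) / 2))\<^sup>2) / 2 = - x\<^sup>2 * (1 - r) / 4"
    using r by (simp add: power_mult_distrib field_simps)
  also have "gauss_tail x = exceed_prob b s" using s by (simp add: x_def exceed_prob_eq)
  finally show ?thesis by (simp add: x_def r_def mult.commute)
qed

end

section \<open>The supremum against a net: two mechanisms\<close>

context continuous_gaussian_field
begin

lemma prob_Union_le_tail_prob:
  assumes "finite N" "N \<subseteq> T"
  shows "measure P (\<Union>t\<in>N. {\<omega> \<in> space P. b < f t \<omega>}) \<le> tail_prob P T f b"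
proof -
  interpret C: prob_space "completion P" by (rule prob_space_completion)
  have "{\<omega> \<in> space P. b < f t \<omega>} \<in> sets P" if "t \<in> N" for t
  proof -
    have [measurable]: "f t \<in> borel_measurable P" using that assms measurable_value by auto
    show ?thesis by measurable
  qed
  then have s: "(\<Union>t\<in>N. {\<omega> \<in> space P. b < f t \<omega>}) \<in> sets P" using assms by auto
  have "measure P (\<Union>t\<in>N. {\<omega> \<in> space P. b < f t \<omega>}) = measure (completion P) (\<Union>t\<in>N. {\<omega> \<in> space P. b < f t \<omega>})"
    using s by simp
  also have "\<dots> \<le> measure (completion P) {\<omega> \<in> space P. ereal b < field_sup T f \<omega>}"
    using assms by (intro C.finite_measure_mono exceeds_event_sets) (auto simp: exceeds_event_eq)
  finally show ?thesis by (simp add: tail_prob_def)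
qed

definition net_controlled :: "real \<Rightarrow> real \<Rightarrow> real \<Rightarrow> bool" where
  "net_controlled C b \<rho> \<longleftrightarrow> (\<forall>N. finite N \<longrightarrow> N \<subseteq> T \<longrightarrow> separated \<rho> N \<longrightarrow>
     (\<Sum>c\<in>N. exceed_prob b c) \<le> C * tail_prob P T f b)"

lemma tail_prob_nonneg: "0 \<le> tail_prob P T f b"
  by (simp add: tail_prob_def)

end

context bounded_gaussian_field
begin

lemma standardized_level_ge:
  assumes "t \<in> T" "2 * m0 \<le> b" "0 \<le> b"
  shows "b / (2 * s1) \<le> (b - mn t) / sd t"
proof -
  have "(b / 2) / s1 \<le> (b - mn t) / sd t"
    using mn_le[OF assms(1)] sd_pos[OF assms(1)] sd_le[OF assms(1)] assms
    by (intro frac_le) auto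
  then show ?thesis by simp
qed

text \<open>At the scale of the correlation, \<open>b\<^sup>2 (1 - r(s,t))\<close> grows like a power of \<open>dist s t / u\<close>. Hence each point
of a \<open>u\<close>-separated set has, given an exceedance there, only a bounded expected number of companions, and
the second moment method applies.\<close>

lemma net_sum_le_tail_prob_corr:
  assumes corr_lt: "\<forall>s\<in>T. \<forall>t\<in>T. s \<noteq> t \<longrightarrow> corr s t < 1"
    and e: "corr_expansion (\<lambda>s t. corr s t) T \<alpha> L" and sv: "slowly_varying_at_zero L" and \<alpha>: "0 < \<alpha>"
    and s1: "0 < s1"
  shows "\<exists>C>0. \<exists>b0\<ge>1. \<exists>x1>0. \<forall>b\<ge>b0. \<forall>u. 0 < u \<longrightarrow> u \<le> x1 \<longrightarrow> critical_scale L \<alpha> b u \<longrightarrow>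
    net_controlled C b u"
proof -
  have lt: "corr s t < 1" if "s \<in> T" "t \<in> T" "s \<noteq> t" for s t using corr_lt that by blast
  define q where "q = real DIM('a) + 2"
  have q: "0 \<le> q" by (simp add: q_def)
  define D where "D = diameter T"
  have bT: "bounded T" using compact_T by (rule compact_imp_bounded)
  have D: "0 \<le> D" unfolding D_def using bT by (rule diameter_ge_0)
  have dD: "dist s t \<le> D" if "s \<in> T" "t \<in> T" for s t
    unfolding D_def using bT that by (rule diameter_bounded_bound)
  define a where "a = 1 / (16 * s1\<^sup>2)"
  have a: "0 < a" using s1 by (simp add: a_def)
  obtain \<eta> d0 d1 where \<eta>: "0 < \<eta>" and d0: "0 < d0" and d1: "0 < d1"
    and near: "\<And>s t. s \<in> T \<Longrightarrow> t \<in> T \<Longrightarrow> s \<noteq> t \<Longrightarrow> dist s t < \<eta> \<Longrightarrow>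
      d0 * (L (dist s t) * dist s t powr \<alpha>) \<le> 1 - corr s t \<and> 1 - corr s t \<le> d1 * (L (dist s t) * dist s t powr \<alpha>)"
    using corr_expansion_bounds[OF compact_T e sv] by blast
  have ad: "0 < a * d0" using a d0 by simp
  obtain x1 A1 where x1: "0 < x1" and A1: "1 \<le> A1"
    and dec1: "\<And>b u h. 1 \<le> b \<Longrightarrow> 0 < u \<Longrightarrow> u \<le> x1 \<Longrightarrow> critical_scale L \<alpha> b u \<Longrightarrow> u \<le> h \<Longrightarrow> h \<le> x1 \<Longrightarrow>
      exp (- (a * d0) * (b\<^sup>2 * (L h * h powr \<alpha>))) \<le> A1 * (1 + h / u) powr (- q)"
    by (rule scaled_exp_decay[OF sv \<alpha> ad q D]) blast
  define \<eta>' where "\<eta>' = min x1 (\<eta> / 2)"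
  have \<eta>': "0 < \<eta>'" using x1 \<eta> by (simp add: \<eta>'_def)
  obtain \<epsilon> where \<epsilon>: "0 < \<epsilon>" and far: "\<And>s t. s \<in> T \<Longrightarrow> t \<in> T \<Longrightarrow> \<eta>' \<le> dist s t \<Longrightarrow> \<epsilon> \<le> 1 - corr s t"
    using corr_gap[OF sd_pos lt e sv \<alpha> \<eta>'] by blast
  have a\<epsilon>: "0 < a * \<epsilon>" using a \<epsilon> by simp
  obtain x2 A2 where x2: "0 < x2" and A2: "1 \<le> A2"
    and dec2: "\<And>b u h. 1 \<le> b \<Longrightarrow> 0 < u \<Longrightarrow> u \<le> x2 \<Longrightarrow> critical_scale L \<alpha> b u \<Longrightarrow> 0 \<le> h \<Longrightarrow> h \<le> D \<Longrightarrow>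
      exp (- (a * \<epsilon>) * b\<^sup>2) \<le> A2 * (1 + h / u) powr (- q)"
    by (rule scaled_exp_decay[OF sv \<alpha> a\<epsilon> q D]) blast
  define A where "A = max A1 A2"
  have A: "1 \<le> A" "A1 \<le> A" "A2 \<le> A" using A1 by (auto simp: A_def)
  define C where "C = 2 * A * net_sum_const DIM('a) + 1"
  have C: "0 < C" using A net_sum_const_nonneg unfolding C_def by (intro add_nonneg_pos mult_nonneg_nonneg) auto
  define b0 where "b0 = max 1 (2 * m0)"
  have "(\<Sum>c\<in>N. exceed_prob b c) \<le> C * tail_prob P T f b"
    if b: "b0 \<le> b" and u: "0 < u" "u \<le> min x1 x2" and eq: "critical_scale L \<alpha> b u"
      and N: "finite N" "N \<subseteq> T" and sep: "separated u N" for b u N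
  proof -
    have b1: "1 \<le> b" "2 * m0 \<le> b" using b by (auto simp: b0_def)
    define x where "x t = (b - mn t) / sd t" for t
    have xlow: "b / (2 * s1) \<le> x t" if "t \<in> T" for t
      unfolding x_def using that b1 by (intro standardized_level_ge) auto
    have x0: "0 \<le> x t" if "t \<in> T" for t
      using xlow[OF that] b1 s1 by (meson divide_nonneg_pos order_trans zero_le_one mult_pos_pos zero_less_numeral)
    define ev where "ev s = {\<omega> \<in> space P. b < f s \<omega>}" for s
    have evs: "ev s \<in> sets P" if "s \<in> N" for s
    proof -
      have [measurable]: "f s \<in> borel_measurable P" using that N measurable_value by auto
      show ?thesis unfolding ev_def by measurable
    qed
    define k where "k s t = (1 + dist s t / u) powr (- q)" for s t :: 'a
    have kc: "k s t = k t s" for s t by (simp add: k_def dist_commute)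
    have k0: "0 \<le> k s t" for s t by (simp add: k_def)
    have expk: "exp (- (x s)\<^sup>2 * (1 - corr s t) / 4) \<le> A * k s t" if st: "s \<in> N" "t \<in> N" "s \<noteq> t" for s t
    proof -
      have T: "s \<in> T" "t \<in> T" using st N by auto
      have uh: "u \<le> dist s t" using sep st by (simp add: separated_def)
      have c1: "0 \<le> 1 - corr s t" using lt[OF T st(3)] by simp
      have "(b / (2 * s1))\<^sup>2 \<le> (x s)\<^sup>2" using xlow[OF T(1)] b1 s1 by (intro power_mono) auto
      then have "4 * a * b\<^sup>2 \<le> (x s)\<^sup>2" by (simp add: a_def power_divide power_mult_distrib)
      then have "4 * a * b\<^sup>2 * (1 - corr s t) \<le> (x s)\<^sup>2 * (1 - corr s t)" using c1 by (rule mult_right_mono)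
      then have le: "exp (- (x s)\<^sup>2 * (1 - corr s t) / 4) \<le> exp (- (a * b\<^sup>2 * (1 - corr s t)))" by simp
      show ?thesis
      proof (cases "dist s t < \<eta>'")
        case True
        then have h: "dist s t < \<eta>" "dist s t \<le> x1" using \<eta> by (auto simp: \<eta>'_def)
        have "a * b\<^sup>2 * (d0 * (L (dist s t) * dist s t powr \<alpha>)) \<le> a * b\<^sup>2 * (1 - corr s t)"
          using near[OF T st(3) h(1)] a by (intro mult_left_mono) auto
        then have "exp (- (a * b\<^sup>2 * (1 - corr s t))) \<le> exp (- (a * d0) * (b\<^sup>2 * (L (dist s t) * dist s t powr \<alpha>)))"
          by (simp add: mult_ac)
        also have "\<dots> \<le> A1 * k s t" unfolding k_def using u by (intro dec1 b1 eq uh h) auto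
        also have "\<dots> \<le> A * k s t" using A k0 by (intro mult_right_mono) auto
        finally show ?thesis using le by linarith
      next
        case False
        have "a * b\<^sup>2 * \<epsilon> \<le> a * b\<^sup>2 * (1 - corr s t)"
          using far[OF T] False a by (intro mult_left_mono) auto
        then have "exp (- (a * b\<^sup>2 * (1 - corr s t))) \<le> exp (- (a * \<epsilon>) * b\<^sup>2)" by (simp add: mult_ac)
        also have "\<dots> \<le> A2 * k s t" unfolding k_def using u by (intro dec2 b1 eq dD T) auto
        also have "\<dots> \<le> A * k s t" using A k0 by (intro mult_right_mono) auto
        finally show ?thesis using le by linarith
      qed
    qed
    have pair: "prob (ev s \<inter> ev t) \<le> (exceed_prob b s + exceed_prob b t) * (A * k s t)" if st: "s \<in> N" "t \<in> N" for s t
    proof -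
      have T: "s \<in> T" "t \<in> T" using st N by auto
      have one: "prob (ev s \<inter> ev t) \<le> (exceed_prob b s + exceed_prob b t) * (A * k s t)"
        if st: "s \<in> N" "t \<in> N" "s \<noteq> t" "x s \<le> x t" for s t
      proof -
        have T: "s \<in> T" "t \<in> T" using st N by auto
        have "prob (ev s \<inter> ev t) \<le> exceed_prob b s * exp (- (x s)\<^sup>2 * (1 - corr s t) / 4)"
          unfolding ev_def x_def using T sd_pos st(4) x0[OF T(1)] by (intro joint_exceed_prob_le) (auto simp: x_def)
        also have "\<dots> \<le> exceed_prob b s * (A * k s t)" using expk[OF st(1-3)] by (intro mult_left_mono) auto
        also have "\<dots> \<le> (exceed_prob b s + exceed_prob b t) * (A * k s t)"
          using A k0[of s t] by (intro mult_right_mono) auto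
        finally show ?thesis .
      qed
      consider "s = t" | "s \<noteq> t" "x s \<le> x t" | "s \<noteq> t" "x t \<le> x s" by linarith
      then show ?thesis
      proof cases
        case 1
        have "exceed_prob b s * 1 \<le> exceed_prob b s * (2 * A)" using A by (intro mult_left_mono) auto
        then show ?thesis using 1 by (simp add: ev_def k_def algebra_simps)
      next
        case 2 then show ?thesis using one st by blast
      next
        case 3
        then have "prob (ev t \<inter> ev s) \<le> (exceed_prob b t + exceed_prob b s) * (A * k t s)" using one st by blast
        then show ?thesis by (simp add: Int_commute add.commute kc)
      qed
    qed
    have ksum: "(\<Sum>t\<in>N. k s t) \<le> net_sum_const DIM('a)" for s
    proof -
      have "(\<Sum>t\<in>N. k s t) = (\<Sum>t\<in>N. (1 + dist t s / u) powr (- (real DIM('a) + 2)))"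
        by (simp add: k_def q_def dist_commute)
      also have "\<dots> \<le> net_sum_const DIM('a)" using sep by (intro separated_sum_le N u) auto
      finally show ?thesis .
    qed
    have "(\<Sum>s\<in>N. \<Sum>t\<in>N. prob (ev s \<inter> ev t)) \<le> (\<Sum>s\<in>N. \<Sum>t\<in>N. (exceed_prob b s + exceed_prob b t) * (A * k s t))"
      by (intro sum_mono pair)
    also have "\<dots> = (\<Sum>s\<in>N. \<Sum>t\<in>N. exceed_prob b s * (A * k s t)) + (\<Sum>s\<in>N. \<Sum>t\<in>N. exceed_prob b t * (A * k s t))"
      by (simp add: distrib_right sum.distrib)
    also have "(\<Sum>s\<in>N. \<Sum>t\<in>N. exceed_prob b t * (A * k s t)) = (\<Sum>s\<in>N. \<Sum>t\<in>N. exceed_prob b s * (A * k s t))"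
      by (subst sum.swap) (simp add: kc)
    also have "(\<Sum>s\<in>N. \<Sum>t\<in>N. exceed_prob b s * (A * k s t)) = (\<Sum>s\<in>N. exceed_prob b s * (A * (\<Sum>t\<in>N. k s t)))"
      by (simp add: sum_distrib_left)
    also have "(\<Sum>s\<in>N. exceed_prob b s * (A * (\<Sum>t\<in>N. k s t))) + (\<Sum>s\<in>N. exceed_prob b s * (A * (\<Sum>t\<in>N. k s t)))
      \<le> (\<Sum>s\<in>N. exceed_prob b s * (A * net_sum_const DIM('a))) + (\<Sum>s\<in>N. exceed_prob b s * (A * net_sum_const DIM('a)))"
      using A ksum by (intro add_mono sum_mono mult_left_mono) auto
    also have "\<dots> = 2 * A * net_sum_const DIM('a) * (\<Sum>s\<in>N. exceed_prob b s)"
      by (simp add: sum_distrib_right[symmetric])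
    also have "\<dots> \<le> C * (\<Sum>s\<in>N. exceed_prob b s)"
      unfolding C_def by (intro mult_right_mono sum_nonneg) auto
    finally have "(\<Sum>s\<in>N. \<Sum>t\<in>N. prob (ev s \<inter> ev t)) \<le> C * (\<Sum>s\<in>N. prob (ev s))" by (simp only: ev_def)
    from sum_prob_le_prob_Union[OF N(1) evs C this]
    have "(\<Sum>s\<in>N. prob (ev s)) \<le> C * prob (\<Union>s\<in>N. ev s)" .
    also have "\<dots> \<le> C * tail_prob P T f b"
      unfolding ev_def using C by (intro mult_left_mono prob_Union_le_tail_prob N) auto
    finally show ?thesis by (simp only: ev_def)
  qed
  moreover have "0 < min x1 x2" "1 \<le> b0" using x1 x2 by (auto simp: b0_def)
  ultimately show ?thesis using C unfolding net_controlled_def by blast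
qed

text \<open>At the scale of the standard deviation, exceedance probabilities decay like a power of \<open>dist c t0 / u\<close>
away from the maximum point \<open>t0\<close>, so that the sum is at most a multiple of the single
probability at \<open>t0\<close>. The variation of the mean is of the order of the square root of the
exponent gained by the decrease of the standard deviation, and hence harmless.\<close>

lemma net_sum_le_tail_prob_sd:
  assumes sv: "slowly_varying_at_zero L" and \<alpha>: "0 < \<alpha>" and s1: "0 < s1"
    and cont: "continuous_on T (\<lambda>t. sd t)" and t0: "t0 \<in> T" and sd_max: "\<forall>t\<in>T. t \<noteq> t0 \<longrightarrow> sd t < sd t0"
    and \<Lambda>: "0 < \<Lambda>"
    and asym: "(\<lambda>t. sd t0 - sd t) \<sim>[at t0 within T] (\<lambda>t. \<Lambda> * L (norm (t - t0)) * norm (t - t0) powr \<alpha>)"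
    and mean: "mean_regularity (\<lambda>t. mn t) T \<alpha> L"
  shows "\<exists>C>0. \<exists>b0\<ge>1. \<exists>x1>0. \<forall>b\<ge>b0. \<forall>u. 0 < u \<longrightarrow> u \<le> x1 \<longrightarrow> critical_scale L \<alpha> b u \<longrightarrow>
    net_controlled C b u"
proof -
  have mx: "sd t < sd t0" if "t \<in> T" "t \<noteq> t0" for t using sd_max that by blast
  define q where "q = real DIM('a) + 2"
  have q: "0 \<le> q" by (simp add: q_def)
  define D where "D = diameter T"
  have bT: "bounded T" using compact_T by (rule compact_imp_bounded)
  have D: "0 \<le> D" unfolding D_def using bT by (rule diameter_ge_0)
  have dD: "dist s t \<le> D" if "s \<in> T" "t \<in> T" for s t
    unfolding D_def using bT that by (rule diameter_bounded_bound)
  obtain \<kappa> where \<kappa>: "0 < \<kappa>" and R: "\<forall>s t. s \<in> T \<longrightarrow> s + t \<in> T \<longrightarrow> \<bar>mn s - mn (s + t)\<bar> \<le> \<kappa> * sqrt (L (norm t)) * norm t powr (\<alpha> / 2)"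
    using mean unfolding mean_regularity_def by blast
  obtain \<eta> where \<eta>: "0 < \<eta>" and near: "\<And>t. t \<in> T \<Longrightarrow> t \<noteq> t0 \<Longrightarrow> dist t t0 < \<eta> \<Longrightarrow>
      \<Lambda> / 2 * (L (dist t t0) * dist t t0 powr \<alpha>) \<le> sd t0 - sd t"
  proof -
    let ?F = "\<lambda>t. sd t0 - sd t" and ?G = "\<lambda>t. \<Lambda> * L (norm (t - t0)) * norm (t - t0) powr \<alpha>"
    have "((\<lambda>t. if ?F t = 0 \<and> ?G t = 0 then 1 else ?F t / ?G t) \<longlongrightarrow> 1) (at t0 within T)"
      using asym unfolding asymp_equiv_def .
    then have "\<forall>\<^sub>F t in at t0 within T. dist (if ?F t = 0 \<and> ?G t = 0 then 1 else ?F t / ?G t) 1 < 1 / 2"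
      by (rule tendstoD) simp
    then obtain \<eta> where \<eta>: "0 < \<eta>" "\<And>t. t \<in> T \<Longrightarrow> t \<noteq> t0 \<Longrightarrow> dist t t0 < \<eta> \<Longrightarrow>
        dist (if ?F t = 0 \<and> ?G t = 0 then 1 else ?F t / ?G t) 1 < 1 / 2"
      unfolding eventually_at by blast
    show thesis
    proof (rule that[OF \<eta>(1)])
      fix t assume t: "t \<in> T" "t \<noteq> t0" "dist t t0 < \<eta>"
      have Gp: "0 < ?G t" using \<Lambda> slowly_varying_pos[OF sv, of "norm (t - t0)"] t(2) by simp
      have "\<bar>?F t / ?G t - 1\<bar> < 1 / 2" using \<eta>(2)[OF t] Gp by (auto simp: dist_real_def split: if_splits)
      then have "1 / 2 < ?F t / ?G t" unfolding abs_less_iff by linarith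
      then have "1 / 2 * ?G t \<le> ?F t" using Gp by (simp add: field_simps)
      then show "\<Lambda> / 2 * (L (dist t t0) * dist t t0 powr \<alpha>) \<le> sd t0 - sd t" by (simp add: dist_norm mult.assoc)
    qed
  qed
  define a1 where "a1 = (\<Lambda> / (8 * s1)) / (4 * s1\<^sup>2)"
  have a1: "0 < a1" using \<Lambda> s1 by (simp add: a1_def)
  obtain x1 A1 where x1: "0 < x1" and A1: "1 \<le> A1"
    and dec1: "\<And>b u h. 1 \<le> b \<Longrightarrow> 0 < u \<Longrightarrow> u \<le> x1 \<Longrightarrow> critical_scale L \<alpha> b u \<Longrightarrow> u \<le> h \<Longrightarrow> h \<le> x1 \<Longrightarrow>
      exp (- a1 * (b\<^sup>2 * (L h * h powr \<alpha>))) \<le> A1 * (1 + h / u) powr (- q)"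
    by (rule scaled_exp_decay[OF sv \<alpha> a1 q D]) blast
  define \<eta>' where "\<eta>' = min x1 (\<eta> / 2)"
  have \<eta>': "0 < \<eta>'" using x1 \<eta> by (simp add: \<eta>'_def)
  obtain \<epsilon> where \<epsilon>: "0 < \<epsilon>" and far: "\<And>t. t \<in> T \<Longrightarrow> \<eta>' \<le> dist t t0 \<Longrightarrow> \<epsilon> \<le> sd t0 - sd t"
  proof -
    define S where "S = {t \<in> T. \<eta>' \<le> dist t t0}"
    have "S = T \<inter> {t. \<eta>' \<le> dist t t0}" by (auto simp: S_def)
    moreover have "closed {t. \<eta>' \<le> dist t t0}" by (intro closed_Collect_le continuous_intros)
    ultimately have S: "compact S" using compact_T by (simp add: compact_Int_closed)
    have cS: "continuous_on S (\<lambda>t. sd t)" using cont by (rule continuous_on_subset) (auto simp: S_def)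
    show thesis
    proof (cases "S = {}")
      case True
      then show thesis using that[of 1] by (auto simp: S_def)
    next
      case False
      obtain z where z: "z \<in> S" "\<And>w. w \<in> S \<Longrightarrow> sd w \<le> sd z"
        using continuous_attains_sup[OF S False cS] by blast
      have "z \<noteq> t0" using z(1) \<eta>' by (auto simp: S_def)
      then have "0 < sd t0 - sd z" using mx[of z] z(1) by (auto simp: S_def)
      then show thesis
      proof (rule that)
        fix t assume "t \<in> T" "\<eta>' \<le> dist t t0"
        then show "sd t0 - sd z \<le> sd t0 - sd t" using z(2)[of t] by (simp add: S_def)
      qed
    qed
  qed
  define a2 where "a2 = (\<epsilon> / (4 * s1)) / (4 * s1\<^sup>2)"
  have a2: "0 < a2" using \<epsilon> s1 by (simp add: a2_def)
  obtain x2 A2 where x2: "0 < x2" and A2: "1 \<le> A2"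
    and dec2: "\<And>b u h. 1 \<le> b \<Longrightarrow> 0 < u \<Longrightarrow> u \<le> x2 \<Longrightarrow> critical_scale L \<alpha> b u \<Longrightarrow> 0 \<le> h \<Longrightarrow> h \<le> D \<Longrightarrow>
      exp (- a2 * b\<^sup>2) \<le> A2 * (1 + h / u) powr (- q)"
    by (rule scaled_exp_decay[OF sv \<alpha> a2 q D]) blast
  define A where "A = max (2 powr q) (max A1 A2)"
  have A: "0 < A" "A1 \<le> A" "A2 \<le> A" "2 powr q \<le> A" using A1 by (auto simp: A_def less_max_iff_disj)
  define G where "G = 2 * \<kappa>\<^sup>2 * s1 / \<Lambda>"
  have G: "0 \<le> G" using \<Lambda> s1 by (simp add: G_def)
  obtain C1 where C1: "0 < C1" and tilt: "\<And>b J X V. 1 \<le> b \<Longrightarrow> 2 * m0 \<le> b \<Longrightarrow> 4 * G \<le> b \<Longrightarrow> 0 \<le> J \<Longrightarrow>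
    0 < V \<Longrightarrow> V \<le> b\<^sup>2 * (sd t0)\<^sup>2 \<Longrightarrow> b\<^sup>2 - b * mn t0 + J - G \<le> X \<Longrightarrow>
    gauss_tail (X / sqrt V) \<le> C1 * exceed_prob b t0 * exp (- J / (4 * s1\<^sup>2))"
    using exceed_prob_tilt[OF G order_refl] t0 by auto
  define C where "C = C1 * A * net_sum_const DIM('a) + 1"
  have C: "0 < C" using A C1 net_sum_const_nonneg unfolding C_def by (intro add_nonneg_pos mult_nonneg_nonneg) auto
  define b0 where "b0 = max 1 (max (2 * m0) (max (4 * G) (8 * m0 * s1 / \<epsilon>)))"
  have "(\<Sum>c\<in>N. exceed_prob b c) \<le> C * tail_prob P T f b"
    if b: "b0 \<le> b" and u: "0 < u" "u \<le> min x1 x2" and eq: "critical_scale L \<alpha> b u"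
      and N: "finite N" "N \<subseteq> T" and sep: "separated u N" for b u N
  proof -
    have b1: "1 \<le> b" "2 * m0 \<le> b" "4 * G \<le> b" "8 * m0 * s1 / \<epsilon> \<le> b" using b by (auto simp: b0_def)
    have "0 \<le> m0" using mn_le[OF t0] by linarith
    define k where "k t = (1 + dist t t0 / u) powr (- q)" for t
    have k0: "0 \<le> k t" for t by (simp add: k_def)
    have reduce: "exceed_prob b c \<le> C1 * exceed_prob b t0 * exp (- J / (4 * s1\<^sup>2))"
      if c: "c \<in> T" and J: "0 \<le> J" and JG: "J - G \<le> b\<^sup>2 * (sd t0 - sd c) / (2 * s1) - b * \<bar>mn c - mn t0\<bar>" for c J
    proof -
      \<comment> \<open>The event \<open>f(c) > b\<close>, rescaled to the standard deviation of \<open>b f(t0)\<close>.\<close>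
      define X where "X = b * (b - mn c) * sd t0 / sd c"
      have sdc: "0 < sd c" "sd c \<le> s1" "sd c \<le> sd t0" using sd_pos[OF c] sd_le[OF c] mx[OF c] by (auto intro: less_imp_le)
      have "b / 2 \<le> b - mn c" using mn_le[OF c] b1(2) by linarith
      then have "b * (b / 2) \<le> b * (b - mn c)" using b1 by (intro mult_left_mono) auto
      then have "b * (b / 2) * ((sd t0 - sd c) / s1) \<le> b * (b - mn c) * ((sd t0 - sd c) / sd c)"
        using sdc b1 \<open>b / 2 \<le> b - mn c\<close> by (intro mult_mono divide_left_mono mult_nonneg_nonneg) auto
      moreover have "X = b * (b - mn c) + b * (b - mn c) * ((sd t0 - sd c) / sd c)"
        using sdc by (simp add: X_def field_simps)
      moreover have "b * (b / 2) * ((sd t0 - sd c) / s1) = b\<^sup>2 * (sd t0 - sd c) / (2 * s1)"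
        by (simp add: power2_eq_square)
      moreover have "b * (mn c - mn t0) \<le> b * \<bar>mn c - mn t0\<bar>" using b1 by (intro mult_left_mono) auto
      moreover have "b * (b - mn c) = b\<^sup>2 - b * mn t0 - b * (mn c - mn t0)" by (simp add: power2_eq_square algebra_simps)
      ultimately have X: "b\<^sup>2 - b * mn t0 + J - G \<le> X" using JG by linarith
      have "gauss_tail (X / sqrt (b\<^sup>2 * (sd t0)\<^sup>2)) \<le> C1 * exceed_prob b t0 * exp (- J / (4 * s1\<^sup>2))"
        using b1 sd_pos[OF t0] by (intro tilt J X) auto
      moreover have "X / sqrt (b\<^sup>2 * (sd t0)\<^sup>2) = (b - mn c) / sd c"
        using b1 sd_pos[OF t0] by (simp add: X_def real_sqrt_mult)
      ultimately show ?thesis using exceed_prob_eq[OF c sdc(1)] by simp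
    qed
    have each: "exceed_prob b c \<le> C1 * exceed_prob b t0 * (A * k c)" if cN: "c \<in> N" for c
    proof -
      have c: "c \<in> T" using cN N by auto
      define h where "h = dist c t0"
      have h0: "0 \<le> h" by (simp add: h_def)
      have "\<exists>J\<ge>0. J - G \<le> b\<^sup>2 * (sd t0 - sd c) / (2 * s1) - b * \<bar>mn c - mn t0\<bar> \<and> exp (- J / (4 * s1\<^sup>2)) \<le> A * k c"
      proof (cases "h < \<eta>'")
        case False
        define J where "J = \<epsilon> * b\<^sup>2 / (4 * s1)"
        have "b\<^sup>2 * \<epsilon> \<le> b\<^sup>2 * (sd t0 - sd c)" using far[OF c] False by (intro mult_left_mono) (auto simp: h_def)
        then have "b\<^sup>2 * \<epsilon> / (2 * s1) \<le> b\<^sup>2 * (sd t0 - sd c) / (2 * s1)" using s1 by (intro divide_right_mono) auto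
        moreover have "b * \<bar>mn c - mn t0\<bar> \<le> b * (2 * m0)"
          using mn_le[OF c] mn_le[OF t0] b1 by (intro mult_left_mono) auto
        moreover have "b * (2 * m0) \<le> J"
        proof -
          have "8 * m0 * s1 \<le> b * \<epsilon>" using b1(4) \<epsilon> by (simp add: divide_le_eq)
          then have "2 * m0 \<le> b * \<epsilon> / (4 * s1)" using s1 by (simp add: le_divide_eq mult_ac)
          then have "b * (2 * m0) \<le> b * (b * \<epsilon> / (4 * s1))" using b1 by (intro mult_left_mono) auto
          then show ?thesis by (simp add: J_def power2_eq_square mult_ac)
        qed
        moreover have "b\<^sup>2 * \<epsilon> / (2 * s1) = 2 * J" by (simp add: J_def mult.commute)
        moreover have "exp (- J / (4 * s1\<^sup>2)) \<le> A * k c"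
        proof -
          have "exp (- J / (4 * s1\<^sup>2)) = exp (- a2 * b\<^sup>2)" by (simp add: J_def a2_def mult_ac)
          also have "\<dots> \<le> A2 * k c" unfolding k_def h_def[symmetric]
            using u dD[OF c t0] h0 by (intro dec2 b1 eq) (auto simp: h_def)
          also have "\<dots> \<le> A * k c" using A k0 by (intro mult_right_mono) auto
          finally show ?thesis .
        qed
        moreover have "0 \<le> J" using \<epsilon> s1 by (simp add: J_def)
        ultimately show ?thesis using G by (intro exI[of _ J] conjI) linarith+
      next
        case True
        show ?thesis
        proof (cases "c = t0")
          case True
          have "1 \<le> A * k c" using A(4) True ge_one_powr_ge_zero[of 2 q] q by (simp add: k_def)
          then show ?thesis using True G by (intro exI[of _ 0]) auto
        next
          case False
          have h: "0 < h" "h < \<eta>" "h \<le> x1" using False True \<eta> by (auto simp: h_def \<eta>'_def)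
          define Y where "Y = b\<^sup>2 * (L h * h powr \<alpha>)"
          have Y: "0 \<le> Y" using slowly_varying_pos[OF sv h(1)] by (simp add: Y_def)
          define J where "J = \<Lambda> / (8 * s1) * Y"
          have "b\<^sup>2 * (\<Lambda> / 2 * (L h * h powr \<alpha>)) \<le> b\<^sup>2 * (sd t0 - sd c)"
            using near[OF c False] h by (intro mult_left_mono) (auto simp: h_def)
          then have "\<Lambda> / 2 * Y / (2 * s1) \<le> b\<^sup>2 * (sd t0 - sd c) / (2 * s1)"
            using s1 by (intro divide_right_mono) (auto simp: Y_def mult_ac)
          moreover have "\<Lambda> / 2 * Y / (2 * s1) = 2 * J" by (simp add: J_def)
          moreover have "b * \<bar>mn c - mn t0\<bar> \<le> \<kappa> * sqrt Y"
          proof -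
            have "\<bar>mn c - mn (c + (t0 - c))\<bar> \<le> \<kappa> * sqrt (L (norm (t0 - c))) * norm (t0 - c) powr (\<alpha> / 2)"
              using R[rule_format, of c "t0 - c"] c t0 by simp
            then have "\<bar>mn c - mn t0\<bar> \<le> \<kappa> * (sqrt (L h) * h powr (\<alpha> / 2))"
              by (simp add: h_def dist_norm norm_minus_commute mult.assoc)
            also have "sqrt (L h) * h powr (\<alpha> / 2) = sqrt (L h * h powr \<alpha>)"
              using h by (simp add: real_sqrt_mult powr_half_sqrt[symmetric] powr_powr)
            finally have "b * \<bar>mn c - mn t0\<bar> \<le> b * (\<kappa> * sqrt (L h * h powr \<alpha>))" using b1 by (intro mult_left_mono) auto
            also have "\<dots> = \<kappa> * sqrt Y" using b1 by (simp add: Y_def real_sqrt_mult)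
            finally show ?thesis .
          qed
          moreover have "\<kappa> * sqrt Y \<le> J + G"
          proof -
            define w where "w = sqrt Y"
            have Yw: "Y = w\<^sup>2" using Y by (simp add: w_def)
            \<comment> \<open>Half of the gain \<open>2 J\<close> absorbs the mean, up to the constant \<open>G\<close>.\<close>
            have "2 * p * w * \<kappa> \<le> p\<^sup>2 * w\<^sup>2 + \<kappa>\<^sup>2" for p
            proof -
              have "0 \<le> (p * w - \<kappa>)\<^sup>2" by simp
              then show ?thesis by (simp add: power2_diff power_mult_distrib mult_ac)
            qed
            then have "2 * (\<Lambda> / (4 * s1)) * w * \<kappa> \<le> (\<Lambda> / (4 * s1))\<^sup>2 * w\<^sup>2 + \<kappa>\<^sup>2" .
            then have "(2 * s1 / \<Lambda>) * (2 * (\<Lambda> / (4 * s1)) * w * \<kappa>) \<le> (2 * s1 / \<Lambda>) * ((\<Lambda> / (4 * s1))\<^sup>2 * w\<^sup>2 + \<kappa>\<^sup>2)"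
              using s1 \<Lambda> by (intro mult_left_mono) auto
            moreover have "(2 * s1 / \<Lambda>) * (2 * (\<Lambda> / (4 * s1)) * w * \<kappa>) = \<kappa> * w" using s1 \<Lambda> by simp
            moreover have "(2 * s1 / \<Lambda>) * ((\<Lambda> / (4 * s1))\<^sup>2 * w\<^sup>2 + \<kappa>\<^sup>2) = J + G"
              using s1 \<Lambda> by (simp add: J_def G_def Yw power2_eq_square distrib_left)
            ultimately show ?thesis by (simp add: w_def)
          qed
          moreover have "exp (- J / (4 * s1\<^sup>2)) \<le> A * k c"
          proof (cases "u \<le> h")
            case True
            have "exp (- J / (4 * s1\<^sup>2)) = exp (- a1 * (b\<^sup>2 * (L h * h powr \<alpha>)))" by (simp add: J_def a1_def Y_def mult_ac)
            also have "\<dots> \<le> A1 * k c" unfolding k_def h_def[symmetric]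
              using u h True by (intro dec1 b1 eq) auto
            also have "\<dots> \<le> A * k c" using A k0 by (intro mult_right_mono) auto
            finally show ?thesis .
          next
            case False
            have hu: "0 < 1 + h / u" using u(1) h(1) by (simp add: add_pos_pos)
            have "exp (- J / (4 * s1\<^sup>2)) \<le> 1" using \<Lambda> s1 Y by (simp add: J_def)
            also have "1 = 2 powr q * 2 powr (- q)" by (simp add: powr_add[symmetric])
            also have "\<dots> \<le> A * k c"
              unfolding k_def h_def[symmetric] using A False u h q hu
              by (intro mult_mono powr_mono2') auto
            finally show ?thesis .
          qed
          moreover have "0 \<le> J" using \<Lambda> s1 Y by (simp add: J_def)
          ultimately show ?thesis by (intro exI[of _ J] conjI) linarith+
        qed
      qed
      then obtain J where J: "0 \<le> J" "J - G \<le> b\<^sup>2 * (sd t0 - sd c) / (2 * s1) - b * \<bar>mn c - mn t0\<bar>"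
        "exp (- J / (4 * s1\<^sup>2)) \<le> A * k c" by blast
      have "exceed_prob b c \<le> C1 * exceed_prob b t0 * exp (- J / (4 * s1\<^sup>2))" by (rule reduce[OF c J(1,2)])
      also have "\<dots> \<le> C1 * exceed_prob b t0 * (A * k c)" using J(3) C1 by (intro mult_left_mono) auto
      finally show ?thesis .
    qed
    have "(\<Sum>c\<in>N. exceed_prob b c) \<le> (\<Sum>c\<in>N. C1 * exceed_prob b t0 * (A * k c))" by (intro sum_mono each)
    also have "\<dots> = C1 * A * exceed_prob b t0 * (\<Sum>c\<in>N. k c)"
      unfolding sum_distrib_left by (intro sum.cong) (auto simp: mult_ac)
    also have "\<dots> \<le> C1 * A * exceed_prob b t0 * net_sum_const DIM('a)"
    proof (rule mult_left_mono)
      show "(\<Sum>c\<in>N. k c) \<le> net_sum_const DIM('a)"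
        unfolding k_def q_def using sep by (intro separated_sum_le N u) auto
    qed (use C1 A in auto)
    also have "\<dots> = (C1 * A * net_sum_const DIM('a)) * exceed_prob b t0" by simp
    also have "\<dots> \<le> C * exceed_prob b t0" unfolding C_def by (intro mult_right_mono) auto
    also have "\<dots> \<le> C * tail_prob P T f b" using C by (intro mult_left_mono exceed_prob_le_tail_prob t0) auto
    finally show ?thesis .
  qed
  moreover have "0 < min x1 x2" "1 \<le> b0" using x1 x2 by (auto simp: b0_def)
  ultimately show ?thesis using C unfolding net_controlled_def by blast
qed

text \<open>The covariance is split into correlation and standard deviations; the smallest of the three exponents
serves for all, as only distances up to eight times the scale matter.\<close>

lemma scale_regularI:
  assumes \<rho>: "0 < \<rho>" and b: "0 < b" and A: "0 \<le> A1" "0 \<le> A2" "0 \<le> A3" and e: "0 < e1" "0 < e2" "0 < e3"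
    and r: "\<And>c s t. c \<in> T \<Longrightarrow> s \<in> T \<Longrightarrow> t \<in> T \<Longrightarrow> dist c s \<le> 4 * \<rho> \<Longrightarrow> dist c t \<le> 4 * \<rho> \<Longrightarrow>
      b\<^sup>2 * \<bar>corr c s - corr c t\<bar> \<le> A1 * (dist s t / \<rho>) powr e1"
    and \<sigma>: "\<And>s t. s \<in> T \<Longrightarrow> t \<in> T \<Longrightarrow> dist s t \<le> 8 * \<rho> \<Longrightarrow> b\<^sup>2 * \<bar>sd s - sd t\<bar> \<le> A2 * (dist s t / \<rho>) powr e2"
    and \<mu>: "\<And>s t. s \<in> T \<Longrightarrow> t \<in> T \<Longrightarrow> dist s t \<le> 8 * \<rho> \<Longrightarrow> b * \<bar>mn s - mn t\<bar> \<le> A3 * (dist s t / \<rho>) powr e3"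
    and s1: "0 < s1"
  shows "scale_regular (s1 * (s1 * (A1 * 8 powr e1) + A2 * 8 powr e2) + A3 * 8 powr e3)
    (min 1 (min (e1 / 2) (min (e2 / 2) e3))) b \<rho>"
proof -
  define \<theta> where "\<theta> = min 1 (min (e1 / 2) (min (e2 / 2) e3))"
  have \<theta>: "0 < \<theta>" "2 * \<theta> \<le> e1" "2 * \<theta> \<le> e2" "\<theta> \<le> e3" using e by (auto simp: \<theta>_def)
  define Ka where "Ka = s1 * (s1 * (A1 * 8 powr e1) + A2 * 8 powr e2)"
  define Kb where "Kb = A3 * 8 powr e3"
  have K: "0 \<le> Ka" "0 \<le> Kb" using A s1 by (auto simp: Ka_def Kb_def)
  have h8: "0 \<le> dist s t / \<rho>" "dist s t / \<rho> \<le> 8" if "dist s t \<le> 8 * \<rho>" for s t :: 'a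
    using that \<rho> by (auto simp: field_simps)
  show ?thesis
    unfolding scale_regular_def \<theta>_def[symmetric] Ka_def[symmetric] Kb_def[symmetric]
  proof (intro conjI ballI impI)
    fix c s t assume c: "c \<in> T" "s \<in> T" "t \<in> T" and d: "dist c s \<le> 4 * \<rho>" "dist c t \<le> 4 * \<rho>"
    have st: "dist s t \<le> 8 * \<rho>" using dist_triangle3[of s t c] d by linarith
    define h where "h = dist s t / \<rho>"
    note h = h8[OF st, folded h_def]
    have sdp: "0 < sd c" "0 < sd s" "0 < sd t" "sd c \<le> s1" "sd s \<le> s1" using c sd_pos sd_le by auto
    have r1: "\<bar>corr c t\<bar> \<le> 1" using corr_bounds[OF c(1,3) sdp(1,3)] by auto
    have eq: "cov c s - cov c t = sd c * ((corr c s - corr c t) * sd s + corr c t * (sd s - sd t))"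
      using sdp by (simp add: cov_eq_corr algebra_simps)
    have "\<bar>cov c s - cov c t\<bar> \<le> s1 * (s1 * \<bar>corr c s - corr c t\<bar> + \<bar>sd s - sd t\<bar>)"
      unfolding eq abs_mult
    proof (intro mult_mono)
      have "\<bar>(corr c s - corr c t) * sd s + corr c t * (sd s - sd t)\<bar> \<le> \<bar>corr c s - corr c t\<bar> * sd s + \<bar>corr c t\<bar> * \<bar>sd s - sd t\<bar>"
        using sdp abs_triangle_ineq[of "(corr c s - corr c t) * sd s" "corr c t * (sd s - sd t)"] by (simp add: abs_mult)
      also have "\<dots> \<le> \<bar>corr c s - corr c t\<bar> * s1 + 1 * \<bar>sd s - sd t\<bar>"
        using sdp r1 by (intro add_mono mult_left_mono mult_right_mono) auto
      finally show "\<bar>(corr c s - corr c t) * sd s + corr c t * (sd s - sd t)\<bar> \<le> s1 * \<bar>corr c s - corr c t\<bar> + \<bar>sd s - sd t\<bar>"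
        by (simp add: mult.commute)
    qed (use sdp in auto)
    then have "b\<^sup>2 * \<bar>cov c s - cov c t\<bar> \<le> b\<^sup>2 * (s1 * (s1 * \<bar>corr c s - corr c t\<bar> + \<bar>sd s - sd t\<bar>))"
      by (intro mult_left_mono) auto
    also have "\<dots> = s1 * (s1 * (b\<^sup>2 * \<bar>corr c s - corr c t\<bar>) + b\<^sup>2 * \<bar>sd s - sd t\<bar>)"
      by (simp add: algebra_simps)
    also have "\<dots> \<le> s1 * (s1 * (A1 * h powr e1) + A2 * h powr e2)"
      using r[OF c d] \<sigma>[OF c(2,3) st] s1 unfolding h_def by (intro mult_left_mono add_mono) auto
    also have "\<dots> \<le> s1 * (s1 * (A1 * (8 powr e1 * h powr (2 * \<theta>))) + A2 * (8 powr e2 * h powr (2 * \<theta>)))"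
      using s1 A h \<theta> by (intro mult_left_mono add_mono powr_le_powr_bounded) auto
    also have "\<dots> = Ka * h powr (2 * \<theta>)" by (simp add: Ka_def algebra_simps)
    also have "\<dots> \<le> (Ka + Kb) * h powr (2 * \<theta>)" using K by (intro mult_right_mono) auto
    finally show "b\<^sup>2 * \<bar>cov c s - cov c t\<bar> \<le> (Ka + Kb) * (dist s t / \<rho>) powr (2 * \<theta>)" by (simp only: h_def)
  next
    fix s t assume s: "s \<in> T" "t \<in> T" and "dist s t \<le> 4 * \<rho>"
    then have st: "dist s t \<le> 8 * \<rho>" using \<rho> by linarith
    have "b * \<bar>mn s - mn t\<bar> \<le> A3 * (dist s t / \<rho>) powr e3" by (rule \<mu>[OF s st])
    also have "\<dots> \<le> A3 * (8 powr e3 * (dist s t / \<rho>) powr \<theta>)"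
      using A h8[OF st] \<theta> by (intro mult_left_mono powr_le_powr_bounded) auto
    also have "\<dots> \<le> (Ka + Kb) * (dist s t / \<rho>) powr \<theta>"
      using K by (simp add: Kb_def distrib_right)
    finally show "b * \<bar>mn s - mn t\<bar> \<le> (Ka + Kb) * (dist s t / \<rho>) powr \<theta>" .
  qed
qed

end

section \<open>Strong efficiency\<close>

context bounded_gaussian_field
begin

text \<open>The conclusion from the existence, for all large \<open>b\<close>, of a scale that is regular and at which net sums
are controlled. Below the level \<open>b1\<close> from which on these scales are available, \<open>P(M > b)\<close> is at least its value
\<open>w1\<close> at \<open>b1\<close>.\<close>

lemma strong_efficiency_of_good_scales:
  assumes ne: "T \<noteq> {}" and \<kappa>: "0 < \<kappa>" and \<epsilon>0: "0 < \<epsilon>0" and dens: "ball_volume_bound T \<kappa> \<epsilon>0"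
    and K: "0 \<le> K" and \<theta>: "0 < \<theta>" "\<theta> \<le> 1" and CL: "0 < CL"
    and scales: "\<And>b. bL \<le> b \<Longrightarrow> \<exists>\<rho>>0. \<rho> < \<epsilon>0 \<and> scale_regular K \<theta> b \<rho> \<and>
      net_controlled CL b \<rho>"
  shows "(\<forall>b>0. integrable (Q_measure P T f b) (Z_estimator P T f b) \<and>
                (\<integral>\<omega>. Z_estimator P T f b \<omega> \<partial>Q_measure P T f b) = tail_prob P T f b) \<and>
         (\<exists>\<kappa>\<^sub>0>0. \<forall>b>0. integrable (Q_measure P T f b) (\<lambda>\<omega>. (Z_estimator P T f b \<omega>)\<^sup>2) \<and>
                (\<integral>\<omega>. (Z_estimator P T f b \<omega>)\<^sup>2 \<partial>Q_measure P T f b) \<le> \<kappa>\<^sub>0 * (tail_prob P T f b)\<^sup>2)"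
proof -
  let ?d = "DIM('a)"
  obtain t1 where t1: "t1 \<in> T" using ne by blast
  have volT: "0 < measure lebesgue T"
  proof -
    have "0 < \<kappa> * (\<epsilon>0 / 2) ^ ?d" using \<kappa> \<epsilon>0 by simp
    also have "\<dots> \<le> measure lebesgue (ball t1 (\<epsilon>0 / 2) \<inter> T)"
      using dens \<epsilon>0 t1 by (simp add: ball_volume_bound_def)
    also have "\<dots> \<le> measure lebesgue T"
      using lmeasurable_compact[OF compact_T] by (intro measure_mono_fmeasurable) auto
    finally show ?thesis .
  qed
  have m_pos: "0 < mean_excursion_volume P T f x" for x
    using mean_excursion_volume_pos[OF sd_pos volT] .
  have V_pos: "AE \<omega> in P. (\<exists>t\<in>T. b < f t \<omega>) \<longrightarrow> 0 < measure lebesgue (excursion_set T f (gamma_level b) \<omega>)"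
    if b: "0 < b" for b
    using continuous_paths AE_space
  proof eventually_elim
    case (elim \<omega>)
    show ?case
    proof
      assume "\<exists>t\<in>T. b < f t \<omega>"
      then obtain t where t: "t \<in> T" "b < f t \<omega>" by blast
      have g: "gamma_level b < b" using b by (simp add: gamma_level_def)
      then have "0 < f t \<omega> - gamma_level b" using t by linarith
      then obtain \<delta> where \<delta>: "0 < \<delta>" "\<And>s. s \<in> T \<Longrightarrow> dist s t < \<delta> \<Longrightarrow> dist (f s \<omega>) (f t \<omega>) < f t \<omega> - gamma_level b"
        using elim(1) t(1) unfolding continuous_on_iff by metis
      define r where "r = min \<delta> (\<epsilon>0 / 2)"
      have r: "0 < r" "r < \<epsilon>0" "r \<le> \<delta>" using \<delta> \<epsilon>0 by (auto simp: r_def)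
      have sub: "ball t r \<inter> T \<subseteq> excursion_set T f (gamma_level b) \<omega>"
      proof
        fix s assume s: "s \<in> ball t r \<inter> T"
        then have "\<bar>f s \<omega> - f t \<omega>\<bar> < f t \<omega> - gamma_level b"
          using \<delta>(2)[of s] r by (simp add: dist_commute dist_real_def)
        then show "s \<in> excursion_set T f (gamma_level b) \<omega>" using s by (auto simp: excursion_set_def)
      qed
      have "0 < \<kappa> * r ^ ?d" using \<kappa> r by simp
      also have "\<dots> \<le> measure lebesgue (ball t r \<inter> T)"
        using dens r t by (simp add: ball_volume_bound_def)
      also have "\<dots> \<le> measure lebesgue (excursion_set T f (gamma_level b) \<omega>)"
      proof (rule measure_mono_fmeasurable[OF sub])
        have Tm: "T \<in> lmeasurable" using lmeasurable_compact[OF compact_T] .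
        show "ball t r \<inter> T \<in> sets lebesgue" using Tm by auto
        show "excursion_set T f (gamma_level b) \<omega> \<in> lmeasurable"
          by (rule fmeasurableI2[OF Tm])
            (use excursion_set_borel[OF elim] in \<open>auto simp: excursion_set_def intro: sets_completionI_sets\<close>)
      qed
      finally show "0 < measure lebesgue (excursion_set T f (gamma_level b) \<omega>)" .
    qed
  qed
  note moments = estimator_moments[OF m_pos V_pos, folded inverse_volume_moment_def]
  from moments_at_level[OF \<kappa> dens K \<theta>]
  obtain C bC where C: "0 < C" and bC: "1 \<le> bC"
    and lev: "\<forall>b\<ge>bC. \<forall>\<rho> N. 0 < \<rho> \<longrightarrow> \<rho> < \<epsilon>0 \<longrightarrow> scale_regular K \<theta> b \<rho> \<longrightarrow> finite N \<longrightarrow> N \<subseteq> T \<longrightarrow>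
    (\<forall>t\<in>T. \<exists>c\<in>N. dist t c \<le> \<rho>) \<longrightarrow>
    inverse_volume_moment b (gamma_level b) \<le> ennreal (C * (\<Sum>c\<in>N. exceed_prob b c) / \<rho> ^ DIM('a)) \<and>
    mean_excursion_volume P T f (gamma_level b) \<le> C * (\<Sum>c\<in>N. exceed_prob b c) * \<rho> ^ DIM('a)"
    by (elim exE conjE)
  define b1 where "b1 = max bC bL"
  have b1: "0 < b1" "bC \<le> b1" "bL \<le> b1" using bC by (auto simp: b1_def)
  have large: "\<exists>B\<ge>0. inverse_volume_moment b (gamma_level b) \<le> ennreal B \<and>
      mean_excursion_volume P T f (gamma_level b) * B \<le> (C * CL)\<^sup>2 * (tail_prob P T f b)\<^sup>2"
    if b: "b1 \<le> b" for b
  proof -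
    have bb: "bC \<le> b" "bL \<le> b" using b b1 by auto
    obtain \<rho> where \<rho>: "0 < \<rho>" "\<rho> < \<epsilon>0" and reg: "scale_regular K \<theta> b \<rho>"
      and low: "net_controlled CL b \<rho>"
      using scales[OF bb(2)] by blast
    obtain N where N: "finite N" "N \<subseteq> T" "separated \<rho> N" "\<forall>t\<in>T. \<exists>c\<in>N. dist t c \<le> \<rho>"
      using compact_separated_net[OF compact_T \<rho>(1)] by metis
    define S where "S = (\<Sum>c\<in>N. exceed_prob b c)"
    have S0: "0 \<le> S" by (auto simp: S_def intro: sum_nonneg)
    have Sw: "S \<le> CL * tail_prob P T f b" using low N by (auto simp: S_def net_controlled_def)
    have up: "inverse_volume_moment b (gamma_level b) \<le> ennreal (C * S / \<rho> ^ ?d)"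
      "mean_excursion_volume P T f (gamma_level b) \<le> C * S * \<rho> ^ ?d"
      using lev[rule_format, OF bb(1) \<rho> reg N(1,2)] N(4) by (auto simp: S_def)
    have B0: "0 \<le> C * S / \<rho> ^ ?d" using C S0 \<rho> by simp
    have "mean_excursion_volume P T f (gamma_level b) * (C * S / \<rho> ^ ?d) \<le> C * S * \<rho> ^ ?d * (C * S / \<rho> ^ ?d)"
      using up(2) B0 by (intro mult_right_mono)
    also have "\<dots> = (C * S)\<^sup>2" using \<rho> by (simp add: power2_eq_square)
    also have "\<dots> \<le> (C * (CL * tail_prob P T f b))\<^sup>2" using C S0 Sw by (intro power_mono mult_left_mono) auto
    finally show ?thesis using up(1) B0 by (auto simp: power_mult_distrib mult.assoc)
  qed
  obtain \<rho>1 where \<rho>1: "0 < \<rho>1" "\<rho>1 < \<epsilon>0" "scale_regular K \<theta> b1 \<rho>1" using scales[OF b1(3)] by blast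
  from inverse_volume_moment_bounded[OF \<kappa> dens K \<theta> b1(1) \<rho>1]
  obtain C1 where C1: "0 < C1" and small: "\<forall>b. 0 < b \<longrightarrow> b \<le> b1 \<longrightarrow> inverse_volume_moment b (gamma_level b) \<le> ennreal C1"
    by (elim exE conjE)
  define w1 where "w1 = tail_prob P T f b1"
  have w1: "0 < w1"
    using exceed_prob_pos[OF t1 sd_pos[OF t1], of b1] exceed_prob_le_tail_prob[OF t1, of b1] by (simp add: w1_def)
  define V where "V = measure lborel T"
  have mV: "mean_excursion_volume P T f x \<le> V" for x
  proof -
    have "mean_excursion_volume P T f x \<le> (\<integral>t. indicator T t \<partial>lborel)"
      unfolding mean_excursion_volume_eq
      using emeasure_T_finite borel_T exceed_prob_integrable
      by (intro integral_mono integrable_real_indicator) (auto simp: indicator_def)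
    then show ?thesis using borel_T by (simp add: V_def)
  qed
  have V0: "0 \<le> V" by (simp add: V_def)
  define \<kappa>0 where "\<kappa>0 = (C * CL)\<^sup>2 + V * C1 / w1\<^sup>2 + 1"
  have "0 < \<kappa>0" using V0 C1 unfolding \<kappa>0_def by (intro add_nonneg_pos add_nonneg_nonneg) auto
  have bound: "\<exists>B\<ge>0. inverse_volume_moment b (gamma_level b) \<le> ennreal B \<and>
      mean_excursion_volume P T f (gamma_level b) * B \<le> \<kappa>0 * (tail_prob P T f b)\<^sup>2" if b: "0 < b" for b
  proof (cases "b1 \<le> b")
    case True
    obtain B where B: "0 \<le> B" "inverse_volume_moment b (gamma_level b) \<le> ennreal B"
      "mean_excursion_volume P T f (gamma_level b) * B \<le> (C * CL)\<^sup>2 * (tail_prob P T f b)\<^sup>2"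
      using large[OF True] by blast
    have "(C * CL)\<^sup>2 * (tail_prob P T f b)\<^sup>2 \<le> \<kappa>0 * (tail_prob P T f b)\<^sup>2"
      using V0 C1 unfolding \<kappa>0_def by (intro mult_right_mono) auto
    with B show ?thesis by (meson order_trans)
  next
    case False
    have "w1 \<le> tail_prob P T f b" unfolding w1_def using False by (intro tail_prob_antimono) auto
    then have "w1\<^sup>2 \<le> (tail_prob P T f b)\<^sup>2" using w1 by (intro power_mono) auto
    have "mean_excursion_volume P T f (gamma_level b) * C1 \<le> V * C1" using mV C1 by (intro mult_right_mono) auto
    also have "\<dots> = V * C1 / w1\<^sup>2 * w1\<^sup>2" using w1 by simp
    also have "\<dots> \<le> V * C1 / w1\<^sup>2 * (tail_prob P T f b)\<^sup>2"
      using \<open>w1\<^sup>2 \<le> _\<close> V0 C1 by (intro mult_left_mono) auto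
    also have "\<dots> \<le> \<kappa>0 * (tail_prob P T f b)\<^sup>2"
      unfolding \<kappa>0_def by (intro mult_right_mono) auto
    finally show ?thesis using small b False C1 by (intro exI[of _ C1]) auto
  qed
  have "integrable (Q_measure P T f b) (Z_estimator P T f b) \<and>
      (\<integral>\<omega>. Z_estimator P T f b \<omega> \<partial>Q_measure P T f b) = tail_prob P T f b \<and>
      integrable (Q_measure P T f b) (\<lambda>\<omega>. (Z_estimator P T f b \<omega>)\<^sup>2) \<and>
      (\<integral>\<omega>. (Z_estimator P T f b \<omega>)\<^sup>2 \<partial>Q_measure P T f b) \<le> \<kappa>0 * (tail_prob P T f b)\<^sup>2" if b: "0 < b" for b
  proof -
    obtain B where B: "0 \<le> B" "inverse_volume_moment b (gamma_level b) \<le> ennreal B"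
      "mean_excursion_volume P T f (gamma_level b) * B \<le> \<kappa>0 * (tail_prob P T f b)\<^sup>2"
      using bound[OF b] by blast
    show ?thesis using moments[OF b B(2,1)] B(3) by (auto intro: order_trans)
  qed
  then show ?thesis using \<open>0 < \<kappa>0\<close> by blast
qed

end

lemma ball_density_imp_volume_bound:
  fixes T :: "'a::euclidean_space set"
  assumes "ball_density T"
  obtains \<kappa> \<epsilon>0 where "0 < \<kappa>" "0 < \<epsilon>0" "ball_volume_bound T \<kappa> \<epsilon>0"
proof -
  obtain \<kappa> where \<kappa>: "0 < \<kappa>" and ev: "\<forall>\<^sub>F \<epsilon> in at_right 0. \<forall>t\<in>T.
      \<kappa> * \<epsilon> ^ DIM('a) * measure lebesgue (ball (0::'a) 1) \<le> measure lebesgue (ball t \<epsilon> \<inter> T)"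
    using assms unfolding ball_density_def by blast
  then obtain \<epsilon>0 where \<epsilon>0: "0 < \<epsilon>0" "\<And>\<epsilon>. 0 < \<epsilon> \<Longrightarrow> \<epsilon> < \<epsilon>0 \<Longrightarrow> \<forall>t\<in>T.
      \<kappa> * \<epsilon> ^ DIM('a) * measure lebesgue (ball (0::'a) 1) \<le> measure lebesgue (ball t \<epsilon> \<inter> T)"
    unfolding eventually_at_right_field by auto
  have "0 < measure lebesgue (ball (0::'a) 1)" using content_ball_pos[of 1 "0::'a"] by simp
  then show thesis
    using that[of "\<kappa> * measure lebesgue (ball (0::'a) 1)" \<epsilon>0] \<kappa> \<epsilon>0
    by (auto simp: ball_volume_bound_def mult_ac)
qed

lemma mean_regularity_bounded:
  fixes \<mu> :: "'a::euclidean_space \<Rightarrow> real"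
  assumes T: "compact T" and sv: "slowly_varying_at_zero L" and \<alpha>: "0 < \<alpha>" and reg: "mean_regularity \<mu> T \<alpha> L"
  obtains m0 where "\<And>t. t \<in> T \<Longrightarrow> \<bar>\<mu> t\<bar> \<le> m0"
proof (cases "T = {}")
  case True
  then show thesis using that by simp
next
  case False
  then obtain t1 where t1: "t1 \<in> T" by blast
  obtain \<kappa> where \<kappa>: "0 < \<kappa>" and R: "\<forall>s t. s \<in> T \<longrightarrow> s + t \<in> T \<longrightarrow> \<bar>\<mu> s - \<mu> (s + t)\<bar> \<le> \<kappa> * sqrt (L (norm t)) * norm t powr (\<alpha> / 2)"
    using reg unfolding mean_regularity_def by blast
  obtain M where M: "0 < M" "\<And>x. 0 < x \<Longrightarrow> x \<le> diameter T \<Longrightarrow> L x * x powr \<alpha> \<le> M"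
    using slowly_varying_mult_powr_bounded[OF sv \<alpha>] by blast
  have "\<bar>\<mu> t\<bar> \<le> \<bar>\<mu> t1\<bar> + \<kappa> * sqrt M" if t: "t \<in> T" for t
  proof (cases "t = t1")
    case True then show ?thesis using \<kappa> M by simp
  next
    case False
    define h where "h = dist t t1"
    have h: "0 < h" "h \<le> diameter T"
      using False compact_imp_bounded[OF T] t t1 by (auto simp: h_def intro: diameter_bounded_bound)
    have "\<bar>\<mu> t - \<mu> (t + (t1 - t))\<bar> \<le> \<kappa> * sqrt (L (norm (t1 - t))) * norm (t1 - t) powr (\<alpha> / 2)"
      using R[rule_format, of t "t1 - t"] t t1 by simp
    then have "\<bar>\<mu> t - \<mu> t1\<bar> \<le> \<kappa> * (sqrt (L h) * h powr (\<alpha> / 2))"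
      by (simp add: h_def dist_norm norm_minus_commute mult.assoc)
    also have "sqrt (L h) * h powr (\<alpha> / 2) = sqrt (L h * h powr \<alpha>)"
      using h by (simp add: real_sqrt_mult powr_half_sqrt[symmetric] powr_powr)
    also have "\<kappa> * sqrt (L h * h powr \<alpha>) \<le> \<kappa> * sqrt M"
      using \<kappa> M(2)[OF h] by (intro mult_left_mono real_sqrt_le_mono) auto
    finally show ?thesis by linarith
  qed
  then show thesis by (rule that)
qed

lemma sd_regularity_continuous:
  fixes \<sigma> :: "'a::euclidean_space \<Rightarrow> real"
  assumes sv: "slowly_varying_at_zero L" and \<alpha>: "0 < \<alpha>" and \<kappa>: "0 < \<kappa>"
    and reg: "\<forall>s\<in>T. \<forall>t\<in>T. \<bar>\<sigma> t - \<sigma> s\<bar> \<le> \<kappa> * L (norm (t - s)) * norm (t - s) powr \<alpha>"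
  shows "continuous_on T \<sigma>"
  unfolding continuous_on_iff
proof (intro ballI allI impI)
  fix s and e :: real assume s: "s \<in> T" and e: "0 < e"
  obtain x0 A where x0: "0 < x0" and A: "0 < A" and P: "\<And>x. 0 < x \<Longrightarrow> x \<le> x0 \<Longrightarrow> L x * x powr \<alpha> \<le> A * x powr (\<alpha> / 2)"
    using slowly_varying_mult_powr_tendsto[OF sv \<alpha>] by blast
  define d where "d = min x0 ((e / (2 * \<kappa> * A)) powr (2 / \<alpha>))"
  show "\<exists>d>0. \<forall>t\<in>T. dist t s < d \<longrightarrow> dist (\<sigma> t) (\<sigma> s) < e"
  proof (intro exI[of _ d] conjI ballI impI)
    show "0 < d" using x0 e \<kappa> A by (simp add: d_def)
    fix t assume t: "t \<in> T" "dist t s < d"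
    show "dist (\<sigma> t) (\<sigma> s) < e"
    proof (cases "t = s")
      case True then show ?thesis using e by simp
    next
      case False
      define h where "h = dist t s"
      have h: "0 < h" "h \<le> x0" "h \<le> (e / (2 * \<kappa> * A)) powr (2 / \<alpha>)" using False t by (auto simp: h_def d_def)
      have "\<bar>\<sigma> t - \<sigma> s\<bar> \<le> \<kappa> * (L h * h powr \<alpha>)" using reg s t by (simp add: h_def dist_norm mult.assoc)
      also have "\<dots> \<le> \<kappa> * (A * h powr (\<alpha> / 2))" using \<kappa> P h by (intro mult_left_mono) auto
      also have "\<dots> \<le> \<kappa> * (A * ((e / (2 * \<kappa> * A)) powr (2 / \<alpha>)) powr (\<alpha> / 2))"
        using \<kappa> A h \<alpha> by (intro mult_left_mono powr_mono2) auto
      also have "\<dots> = e / 2" using \<kappa> A e \<alpha> by (simp add: powr_powr)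
      also have "\<dots> < e" using e by simp
      finally show ?thesis by (simp add: dist_real_def)
    qed
  qed
qed

theorem theorem1:
  fixes P :: "'w measure" and T :: "'a::euclidean_space set" and f :: "'a \<Rightarrow> 'w \<Rightarrow> real"
  assumes "prob_space P" and "compact T" and "admissible_field P T f"
  shows "(\<forall>b>0. integrable (Q_measure P T f b) (Z_estimator P T f b) \<and>
                (\<integral>\<omega>. Z_estimator P T f b \<omega> \<partial>Q_measure P T f b) = tail_prob P T f b) \<and>
         (\<exists>\<kappa>\<^sub>0>0. \<forall>b>0. integrable (Q_measure P T f b) (\<lambda>\<omega>. (Z_estimator P T f b \<omega>)\<^sup>2) \<and>
                (\<integral>\<omega>. (Z_estimator P T f b \<omega>)\<^sup>2 \<partial>Q_measure P T f b) \<le> \<kappa>\<^sub>0 * (tail_prob P T f b)\<^sup>2)"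
proof (cases "T = {}")
  case True
  have Z: "Z_estimator P T f b = (\<lambda>_. 0)" for b
    by (rule ext) (simp add: Z_estimator_def field_sup_def True indicator_def bot_ereal_def)
  have w: "tail_prob P T f b = 0" for b
    by (simp add: tail_prob_def field_sup_def True bot_ereal_def)
  show ?thesis by (simp add: Z w) (auto intro: exI[of _ 1])
next
  case ne: False
  have gauss: "gaussian_field P T f" and sdp: "\<And>t. t \<in> T \<Longrightarrow> 0 < sd_fun P f t"
    and paths: "AE \<omega> in P. continuous_on T (\<lambda>t. f t \<omega>)"
    and lt: "\<forall>s\<in>T. \<forall>t\<in>T. s \<noteq> t \<longrightarrow> corr_fun P f s t < 1" and bd: "ball_density T"
    using assms(3) unfolding admissible_field_def by auto
  obtain \<alpha>1 L1 where \<alpha>1: "0 < \<alpha>1" and sv1: "slowly_varying_at_zero L1"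
    and ex: "corr_expansion (corr_fun P f) T \<alpha>1 L1" and rg: "corr_regularity (corr_fun P f) T \<alpha>1 L1"
    and types: "(sd_type1 (sd_fun P f) T \<and> mean_regularity (mean_fun P f) T \<alpha>1 L1) \<or>
         (\<exists>\<alpha>\<^sub>2 L\<^sub>2. sd_type2 (sd_fun P f) T L1 \<alpha>\<^sub>2 L\<^sub>2 \<and> mean_regularity (mean_fun P f) T \<alpha>\<^sub>2 L\<^sub>2)"
    using assms(3) unfolding admissible_field_def by auto
  interpret prob_space P by fact
  interpret continuous_gaussian_field P T f
    by unfold_locales (use assms gauss paths in auto)
  obtain \<kappa> \<epsilon>0 where \<kappa>: "0 < \<kappa>" and \<epsilon>0: "0 < \<epsilon>0" and dens: "ball_volume_bound T \<kappa> \<epsilon>0"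
    using ball_density_imp_volume_bound[OF bd] by blast
  obtain y1 A1 e1 where y1: "0 < y1" and A1: "0 < A1" and e1: "0 < e1"
    and corr_scale: "\<And>b u c s t. 0 < u \<Longrightarrow> u \<le> y1 \<Longrightarrow> critical_scale L1 \<alpha>1 b u \<Longrightarrow> c \<in> T \<Longrightarrow> s \<in> T \<Longrightarrow> t \<in> T \<Longrightarrow>
      dist c s \<le> 4 * u \<Longrightarrow> dist c t \<le> 4 * u \<Longrightarrow>
      b\<^sup>2 * \<bar>corr_fun P f c s - corr_fun P f c t\<bar> \<le> A1 * (dist s t / u) powr e1"
    using corr_regularity_at_scale[OF sv1 rg] by blast
  from types show ?thesis
  proof
    assume t1: "sd_type1 (sd_fun P f) T \<and> mean_regularity (mean_fun P f) T \<alpha>1 L1"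
    then have sd1: "\<And>t. t \<in> T \<Longrightarrow> sd_fun P f t = 1" and mean: "mean_regularity (mean_fun P f) T \<alpha>1 L1"
      by (auto simp: sd_type1_def)
    obtain m0 where m0: "\<And>t. t \<in> T \<Longrightarrow> \<bar>mean_fun P f t\<bar> \<le> m0"
      using mean_regularity_bounded[OF assms(2) sv1 \<alpha>1 mean] by blast
    interpret bounded_gaussian_field P T f 1 1 m0
      by unfold_locales (use sd1 m0 in auto)
    obtain y2 A3 where y2: "0 < y2" and A3: "0 < A3"
      and mean_scale: "\<And>b u s t. 0 < b \<Longrightarrow> 0 < u \<Longrightarrow> u \<le> y2 \<Longrightarrow> critical_scale L1 \<alpha>1 b u \<Longrightarrow> s \<in> T \<Longrightarrow> t \<in> T \<Longrightarrow>
      dist s t \<le> 8 * u \<Longrightarrow> b * \<bar>mean_fun P f s - mean_fun P f t\<bar> \<le> A3 * (dist s t / u) powr (\<alpha>1 / 4)"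
      using mean_regularity_at_scale[OF sv1 \<alpha>1 mean] by blast
    from net_sum_le_tail_prob_corr[OF lt ex sv1 \<alpha>1 zero_less_one]
    obtain CL bL xL where CL: "0 < CL" and bL: "1 \<le> bL" and xL: "0 < xL"
      and low: "\<forall>b\<ge>bL. \<forall>u. 0 < u \<longrightarrow> u \<le> xL \<longrightarrow> critical_scale L1 \<alpha>1 b u \<longrightarrow>
        net_controlled CL b u"
      by (elim exE conjE)
    define x where "x = min (min y1 y2) (min xL (\<epsilon>0 / 2))"
    have x: "0 < x" using y1 y2 xL \<epsilon>0 by (simp add: x_def)
    obtain bs where bs: "\<And>b. bs \<le> b \<Longrightarrow> \<exists>u>0. u \<le> x \<and> critical_scale L1 \<alpha>1 b u"
      using scale_exists[OF sv1 \<alpha>1 x] by blast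
    define \<theta> where "\<theta> = min 1 (min (e1 / 2) (min (1 / 2) (\<alpha>1 / 4)))"
    define K where "K = 1 * (1 * (A1 * 8 powr e1) + 0 * 8 powr 1) + A3 * 8 powr (\<alpha>1 / 4)"
    show ?thesis
    proof (rule strong_efficiency_of_good_scales[OF ne \<kappa> \<epsilon>0 dens _ _ _ CL, of K \<theta> "max bL bs"])
      show "0 \<le> K" using A1 A3 by (simp add: K_def)
      show "0 < \<theta>" "\<theta> \<le> 1" using e1 \<alpha>1 by (auto simp: \<theta>_def)
      fix b assume b: "max bL bs \<le> b"
      then obtain u where u: "0 < u" "u \<le> x" and eq: "critical_scale L1 \<alpha>1 b u" using bs[of b] by auto
      have ux: "u \<le> y1" "u \<le> y2" "u \<le> xL" "u < \<epsilon>0" using u \<epsilon>0 by (auto simp: x_def)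
      have b0: "0 < b" using b bL by linarith
      have reg: "scale_regular K \<theta> b u"
        unfolding K_def \<theta>_def
      proof (rule scale_regularI[OF u(1) b0 less_imp_le[OF A1] order_refl less_imp_le[OF A3] e1 zero_less_one])
        \<comment> \<open>The standard deviation is constant, so the factor is zero and the exponent arbitrary.\<close>
        show "b\<^sup>2 * \<bar>sd_fun P f s - sd_fun P f t\<bar> \<le> 0 * (dist s t / u) powr 1" if "s \<in> T" "t \<in> T" for s t
          using sd1 that by simp
      qed (use corr_scale[OF u(1) ux(1) eq] mean_scale[OF b0 u(1) ux(2) eq] \<alpha>1 in auto)
      show "\<exists>\<rho>>0. \<rho> < \<epsilon>0 \<and> scale_regular K \<theta> b \<rho> \<and>
        net_controlled CL b \<rho>"
        using u(1) ux reg low eq b by (intro exI[of _ u]) auto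
    qed
  next
    assume "\<exists>\<alpha>\<^sub>2 L\<^sub>2. sd_type2 (sd_fun P f) T L1 \<alpha>\<^sub>2 L\<^sub>2 \<and> mean_regularity (mean_fun P f) T \<alpha>\<^sub>2 L\<^sub>2"
    then obtain \<alpha>2 L2 where t2: "sd_type2 (sd_fun P f) T L1 \<alpha>2 L2" and mean: "mean_regularity (mean_fun P f) T \<alpha>2 L2"
      by blast
    have \<alpha>2: "0 < \<alpha>2" and sv2: "slowly_varying_at_zero L2" using t2 by (auto simp: sd_type2_def)
    obtain \<kappa>s where \<kappa>s: "0 < \<kappa>s" and sdreg: "\<forall>s\<in>T. \<forall>t\<in>T. \<bar>sd_fun P f t - sd_fun P f s\<bar> \<le> \<kappa>s * L2 (norm (t - s)) * norm (t - s) powr \<alpha>2"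
      using t2 unfolding sd_type2_def by blast
    obtain t0 \<Lambda> where t0: "t0 \<in> T" and mx: "\<forall>t\<in>T. t \<noteq> t0 \<longrightarrow> sd_fun P f t < sd_fun P f t0" and \<Lambda>: "0 < \<Lambda>"
      and asym: "(\<lambda>t. sd_fun P f t0 - sd_fun P f t) \<sim>[at t0 within T] (\<lambda>t. \<Lambda> * L2 (norm (t - t0)) * norm (t - t0) powr \<alpha>2)"
      using t2 unfolding sd_type2_def by blast
    have cont: "continuous_on T (sd_fun P f)" using sd_regularity_continuous[OF sv2 \<alpha>2 \<kappa>s sdreg] .
    obtain tm where tm: "tm \<in> T" "\<And>t. t \<in> T \<Longrightarrow> sd_fun P f tm \<le> sd_fun P f t"
      using continuous_attains_inf[OF assms(2) ne cont] by blast
    define s0 where "s0 = sd_fun P f tm"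
    define s1 where "s1 = sd_fun P f t0"
    have s1: "0 < s1" using sdp t0 by (simp add: s1_def)
    obtain m0 where m0: "\<And>t. t \<in> T \<Longrightarrow> \<bar>mean_fun P f t\<bar> \<le> m0"
      using mean_regularity_bounded[OF assms(2) sv2 \<alpha>2 mean] by blast
    have sle: "sd_fun P f t \<le> s1" if "t \<in> T" for t
      using mx that by (cases "t = t0") (auto simp: s1_def intro: less_imp_le)
    interpret bounded_gaussian_field P T f s0 s1 m0
      by unfold_locales (use tm sdp m0 sle in \<open>auto simp: s0_def\<close>)
    obtain y2 A3 where y2: "0 < y2" and A3: "0 < A3"
      and mean_scale: "\<And>b u s t. 0 < b \<Longrightarrow> 0 < u \<Longrightarrow> u \<le> y2 \<Longrightarrow> critical_scale L2 \<alpha>2 b u \<Longrightarrow> s \<in> T \<Longrightarrow> t \<in> T \<Longrightarrow>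
      dist s t \<le> 8 * u \<Longrightarrow> b * \<bar>mean_fun P f s - mean_fun P f t\<bar> \<le> A3 * (dist s t / u) powr (\<alpha>2 / 4)"
      using mean_regularity_at_scale[OF sv2 \<alpha>2 mean] by blast
    obtain y3 A2 where y3: "0 < y3" and A2: "0 < A2"
      and sd_scale: "\<And>b u s t. 0 < u \<Longrightarrow> u \<le> y3 \<Longrightarrow> critical_scale L2 \<alpha>2 b u \<Longrightarrow> s \<in> T \<Longrightarrow> t \<in> T \<Longrightarrow>
      dist s t \<le> 8 * u \<Longrightarrow> b\<^sup>2 * \<bar>sd_fun P f s - sd_fun P f t\<bar> \<le> A2 * (dist s t / u) powr (\<alpha>2 / 2)"
      using sd_regularity_at_scale[OF sv2 \<alpha>2 \<kappa>s sdreg] by blast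
    from net_sum_le_tail_prob_corr[OF lt ex sv1 \<alpha>1 s1]
    obtain CL bL xL where CL: "0 < CL" and bL: "1 \<le> bL" and xL: "0 < xL"
      and low: "\<forall>b\<ge>bL. \<forall>u. 0 < u \<longrightarrow> u \<le> xL \<longrightarrow> critical_scale L1 \<alpha>1 b u \<longrightarrow>
        net_controlled CL b u"
      by (elim exE conjE)
    from net_sum_le_tail_prob_sd[OF sv2 \<alpha>2 s1 cont t0 mx \<Lambda> asym mean]
    obtain CM bM xM where CM: "0 < CM" and bM: "1 \<le> bM" and xM: "0 < xM"
      and low2: "\<forall>b\<ge>bM. \<forall>u. 0 < u \<longrightarrow> u \<le> xM \<longrightarrow> critical_scale L2 \<alpha>2 b u \<longrightarrow>
        net_controlled CM b u"
      by (elim exE conjE)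
    define x where "x = min (min y1 (min y2 y3)) (min (min xL xM) (\<epsilon>0 / 2))"
    have x: "0 < x" using y1 y2 y3 xL xM \<epsilon>0 by (simp add: x_def)
    obtain bs where bs: "\<And>b. bs \<le> b \<Longrightarrow> \<exists>u>0. u \<le> x \<and> critical_scale L1 \<alpha>1 b u"
      using scale_exists[OF sv1 \<alpha>1 x] by blast
    obtain bv where bv: "\<And>b. bv \<le> b \<Longrightarrow> \<exists>u>0. u \<le> x \<and> critical_scale L2 \<alpha>2 b u"
      using scale_exists[OF sv2 \<alpha>2 x] by blast
    define \<theta> where "\<theta> = min 1 (min (e1 / 2) (min (\<alpha>2 / 2 / 2) (\<alpha>2 / 4)))"
    define K where "K = s1 * (s1 * (A1 * 8 powr e1) + A2 * 8 powr (\<alpha>2 / 2)) + A3 * 8 powr (\<alpha>2 / 4)"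
    define CC where "CC = max CL CM"
    have CC: "0 < CC" "CL \<le> CC" "CM \<le> CC" using CL by (auto simp: CC_def)
    show ?thesis
    proof (rule strong_efficiency_of_good_scales[OF ne \<kappa> \<epsilon>0 dens _ _ _ CC(1), of K \<theta> "max (max bL bM) (max bs bv)"])
      show "0 \<le> K" using A1 A2 A3 s1 by (simp add: K_def)
      show "0 < \<theta>" "\<theta> \<le> 1" using e1 \<alpha>2 by (auto simp: \<theta>_def)
      fix b assume b: "max (max bL bM) (max bs bv) \<le> b"
      then obtain u where u: "0 < u" "u \<le> x" and equ: "critical_scale L1 \<alpha>1 b u" using bs[of b] by auto
      obtain v where v: "0 < v" "v \<le> x" and eqv: "critical_scale L2 \<alpha>2 b v" using bv[of b] b by auto
      have ux: "u \<le> y1" "u \<le> xL" "u < \<epsilon>0" "v \<le> y2" "v \<le> y3" "v \<le> xM" using u v \<epsilon>0 by (auto simp: x_def)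
      have b0: "0 < b" using b bL by linarith
      define \<rho> where "\<rho> = min u v"
      have \<rho>: "0 < \<rho>" "\<rho> \<le> u" "\<rho> \<le> v" using u v by (auto simp: \<rho>_def)
      have sc: "A * (dist s t / z) powr e \<le> A * (dist s t / \<rho>) powr e"
        if "0 \<le> A" "0 < e" "\<rho> \<le> z" for A e z and s t :: 'a
        using that \<rho>(1) by (intro mult_left_mono powr_mono2 divide_left_mono) auto
      have reg: "scale_regular K \<theta> b \<rho>"
        unfolding K_def \<theta>_def
      proof (rule scale_regularI[OF \<rho>(1) b0 less_imp_le[OF A1] less_imp_le[OF A2] less_imp_le[OF A3] e1])
        show "b\<^sup>2 * \<bar>corr_fun P f c s - corr_fun P f c t\<bar> \<le> A1 * (dist s t / \<rho>) powr e1"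
          if "c \<in> T" "s \<in> T" "t \<in> T" "dist c s \<le> 4 * \<rho>" "dist c t \<le> 4 * \<rho>" for c s t
        proof -
          have "dist c s \<le> 4 * u" "dist c t \<le> 4 * u" using that \<rho> by linarith+
          then show ?thesis
            using corr_scale[OF u(1) ux(1) equ that(1-3)] sc[of A1 e1 u s t] A1 e1 \<rho> by linarith
        qed
        show "b\<^sup>2 * \<bar>sd_fun P f s - sd_fun P f t\<bar> \<le> A2 * (dist s t / \<rho>) powr (\<alpha>2 / 2)"
          if "s \<in> T" "t \<in> T" "dist s t \<le> 8 * \<rho>" for s t
        proof -
          have "dist s t \<le> 8 * v" using that \<rho> by linarith
          then show ?thesis
            using sd_scale[OF v(1) ux(5) eqv that(1-2)] sc[of A2 "\<alpha>2 / 2" v s t] A2 \<alpha>2 \<rho> by linarith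
        qed
        show "b * \<bar>mean_fun P f s - mean_fun P f t\<bar> \<le> A3 * (dist s t / \<rho>) powr (\<alpha>2 / 4)"
          if "s \<in> T" "t \<in> T" "dist s t \<le> 8 * \<rho>" for s t
        proof -
          have "dist s t \<le> 8 * v" using that \<rho> by linarith
          then show ?thesis
            using mean_scale[OF b0 v(1) ux(4) eqv that(1-2)] sc[of A3 "\<alpha>2 / 4" v s t] A3 \<alpha>2 \<rho> by linarith
        qed
      qed (use \<alpha>2 s1 in auto)
      have w0: "0 \<le> tail_prob P T f b" by (rule tail_prob_nonneg)
      have nets: "(\<Sum>c\<in>N. exceed_prob b c) \<le> CC * tail_prob P T f b"
        if N: "finite N" "N \<subseteq> T" "separated \<rho> N" for N
      proof (cases "u \<le> v")
        case True
        then have "\<rho> = u" by (simp add: \<rho>_def)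
        then have "(\<Sum>c\<in>N. exceed_prob b c) \<le> CL * tail_prob P T f b"
          using low u(1) ux equ b N by (auto simp: net_controlled_def)
        then show ?thesis using mult_right_mono[OF CC(2) w0] by linarith
      next
        case False
        then have "\<rho> = v" by (simp add: \<rho>_def)
        then have "(\<Sum>c\<in>N. exceed_prob b c) \<le> CM * tail_prob P T f b"
          using low2 v(1) ux eqv b N by (auto simp: net_controlled_def)
        then show ?thesis using mult_right_mono[OF CC(3) w0] by linarith
      qed
      show "\<exists>\<rho>>0. \<rho> < \<epsilon>0 \<and> scale_regular K \<theta> b \<rho> \<and>
        net_controlled CC b \<rho>"
        using \<rho> ux reg nets by (intro exI[of _ \<rho>]) (auto simp: net_controlled_def)
    qed
  qed
qed

end
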